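(* Every normally traceable graph has an end-faithful spanning tree.
   Context: All graphs may be infinite. A ray is a one-way infinite path; two rays of a graph $G$ are equivalent if for every finite $X\subseteq V(G)$ both have a tail in the same component of $G-X$; the ends of $G$ are the equivalence classes, and $\Omega(G)$ is the set of ends. For a subgraph $H\subseteq G$ there is a natural map $\varphi:\Omega(H)\to\Omega(G)$ with $\eta\subseteq\varphi(\eta)$. A spanning tree $T$ of $G$ is end-faithful if this natural map $\Omega(T)\to\Omega(G)$ is bijective. A rooted tree $T\subseteq G$ is normal in $G$ if the endvertices of every $T$-path in $G$ (a path meeting $T$ exactly in its endvertices) are comparable in the tree-order of $T$. A set $U\subseteq V(G)$ is normally spanned in $G$ if $U$ is contained in some tree $T\subseteq G$ that is normal in $G$. A tree-decomposition $(T,(V_t)_{t\in T})$ of $G$ is rayless if the tree $T$ contains no ray. A connected graph $G$ is normally traceable if it has a rayless tree-decomposition all of whose parts $V_t$ are normally spanned in $G$. *)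

theory Defs
  imports Main
begin

section \<open>Graphs, paths and trees\<close>

text \<open>
  Graphs are undirected and simple and may be infinite, of any cardinality.  An edge is a
  two-element set of vertices.  No condition is built into the type: well-formedness is the
  predicate \<open>is_graph\<close>.
\<close>

datatype 'a ugraph = Graph (verts: "'a set") (edges: "'a set set")

definition is_graph :: "'a ugraph \<Rightarrow> bool" where
  "is_graph G \<longleftrightarrow> (\<forall>e\<in>edges G. e \<subseteq> verts G \<and> card e = 2)"

definition subgraph :: "'a ugraph \<Rightarrow> 'a ugraph \<Rightarrow> bool" where
  "subgraph H G \<longleftrightarrow> is_graph H \<and> is_graph G \<and> verts H \<subseteq> verts G \<and> edges H \<subseteq> edges G"

definition adj :: "'a ugraph \<Rightarrow> 'a \<Rightarrow> 'a \<Rightarrow> bool" where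
  "adj G u v \<longleftrightarrow> {u, v} \<in> edges G"

definition delete_verts :: "'a ugraph \<Rightarrow> 'a set \<Rightarrow> 'a ugraph" where
  "delete_verts G X = Graph (verts G - X) {e \<in> edges G. e \<inter> X = {}}"

definition path :: "'a ugraph \<Rightarrow> 'a list \<Rightarrow> bool" where
  "path G p \<longleftrightarrow> p \<noteq> [] \<and> distinct p \<and> set p \<subseteq> verts G \<and> successively (adj G) p"

definition path_edges :: "'a list \<Rightarrow> 'a set set" where
  "path_edges p = {{p ! i, p ! Suc i} | i. Suc i < length p}"

definition path_between :: "'a ugraph \<Rightarrow> 'a \<Rightarrow> 'a list \<Rightarrow> 'a \<Rightarrow> bool" where
  "path_between G u p v \<longleftrightarrow> path G p \<and> hd p = u \<and> last p = v"

definition cycle :: "'a ugraph \<Rightarrow> 'a list \<Rightarrow> bool" where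
  "cycle G p \<longleftrightarrow> path G p \<and> length p \<ge> 3 \<and> adj G (last p) (hd p)"

definition connected :: "'a ugraph \<Rightarrow> bool" where
  "connected G \<longleftrightarrow> is_graph G \<and> verts G \<noteq> {} \<and>
     (\<forall>u\<in>verts G. \<forall>v\<in>verts G. \<exists>p. path_between G u p v)"

definition component :: "'a ugraph \<Rightarrow> 'a ugraph \<Rightarrow> bool" where
  "component G C \<longleftrightarrow> subgraph C G \<and> connected C \<and>
     (\<forall>D. subgraph D G \<and> connected D \<and> subgraph C D \<longrightarrow> D = C)"

definition tree :: "'a ugraph \<Rightarrow> bool" where
  "tree T \<longleftrightarrow> connected T \<and> (\<nexists>p. cycle T p)"

definition spanning_tree :: "'a ugraph \<Rightarrow> 'a ugraph \<Rightarrow> bool" where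
  "spanning_tree G T \<longleftrightarrow> subgraph T G \<and> tree T \<and> verts T = verts G"

text \<open>In a tree there is exactly one path between two given vertices.\<close>

definition on_tree_path :: "'a ugraph \<Rightarrow> 'a \<Rightarrow> 'a \<Rightarrow> 'a \<Rightarrow> bool" where
  "on_tree_path T u x v \<longleftrightarrow> (\<exists>p. path_between T u p v \<and> x \<in> set p)"


section \<open>Rays and ends\<close>

text \<open>
  A ray is represented by the enumeration of its vertices that starts at its unique vertex of
  degree one; this determines the enumeration, so distinct sequences are distinct rays.
\<close>

definition ray :: "'a ugraph \<Rightarrow> (nat \<Rightarrow> 'a) \<Rightarrow> bool" where
  "ray G r \<longleftrightarrow> inj r \<and> range r \<subseteq> verts G \<and> (\<forall>i. adj G (r i) (r (Suc i)))"

definition rays :: "'a ugraph \<Rightarrow> (nat \<Rightarrow> 'a) set" where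
  "rays G = {r. ray G r}"

definition has_tail_in :: "(nat \<Rightarrow> 'a) \<Rightarrow> 'a ugraph \<Rightarrow> bool" where
  "has_tail_in r C \<longleftrightarrow> (\<exists>n. \<forall>i\<ge>n. r i \<in> verts C)"

definition ray_equiv :: "'a ugraph \<Rightarrow> ((nat \<Rightarrow> 'a) \<times> (nat \<Rightarrow> 'a)) set" where
  "ray_equiv G = {(r, s). r \<in> rays G \<and> s \<in> rays G \<and>
     (\<forall>X. finite X \<and> X \<subseteq> verts G \<longrightarrow>
        (\<exists>C. component (delete_verts G X) C \<and> has_tail_in r C \<and> has_tail_in s C))}"

definition ends :: "'a ugraph \<Rightarrow> (nat \<Rightarrow> 'a) set set" where
  "ends G = rays G // ray_equiv G"

definition end_map :: "'a ugraph \<Rightarrow> 'a ugraph \<Rightarrow> (nat \<Rightarrow> 'a) set \<Rightarrow> (nat \<Rightarrow> 'a) set" where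
  "end_map H G \<eta> = (THE \<omega>. \<omega> \<in> ends G \<and> \<eta> \<subseteq> \<omega>)"

definition end_faithful_spanning_tree :: "'a ugraph \<Rightarrow> 'a ugraph \<Rightarrow> bool" where
  "end_faithful_spanning_tree G T \<longleftrightarrow>
     spanning_tree G T \<and> bij_betw (end_map T G) (ends T) (ends G)"

definition rayless :: "'a ugraph \<Rightarrow> bool" where
  "rayless G \<longleftrightarrow> rays G = {}"


section \<open>Normal trees\<close>

definition tree_le :: "'a ugraph \<Rightarrow> 'a \<Rightarrow> 'a \<Rightarrow> 'a \<Rightarrow> bool" where
  "tree_le T r x y \<longleftrightarrow> on_tree_path T r x y"

text \<open>
  A \<open>T\<close>-path is non-trivial and meets \<open>T\<close> exactly in its endvertices; in particular a
  \<open>T\<close>-path of length one is not an edge of \<open>T\<close>.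
\<close>

definition H_path :: "'a ugraph \<Rightarrow> 'a ugraph \<Rightarrow> 'a list \<Rightarrow> bool" where
  "H_path G T p \<longleftrightarrow> path G p \<and> length p \<ge> 2 \<and>
     set p \<inter> verts T = {hd p, last p} \<and> path_edges p \<inter> edges T = {}"

definition normal_tree :: "'a ugraph \<Rightarrow> 'a ugraph \<Rightarrow> 'a \<Rightarrow> bool" where
  "normal_tree G T r \<longleftrightarrow> subgraph T G \<and> tree T \<and> r \<in> verts T \<and>
     (\<forall>p. H_path G T p \<longrightarrow> tree_le T r (hd p) (last p) \<or> tree_le T r (last p) (hd p))"

definition normally_spanned :: "'a ugraph \<Rightarrow> 'a set \<Rightarrow> bool" where
  "normally_spanned G U \<longleftrightarrow> (\<exists>T r. normal_tree G T r \<and> U \<subseteq> verts T)"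


section \<open>Tree-decompositions and normally traceable graphs\<close>

definition tree_decomposition :: "'a ugraph \<Rightarrow> 'b ugraph \<Rightarrow> ('b \<Rightarrow> 'a set) \<Rightarrow> bool" where
  "tree_decomposition G T V \<longleftrightarrow> tree T \<and>
     (\<Union>t\<in>verts T. V t) = verts G \<and>
     (\<forall>e\<in>edges G. \<exists>t\<in>verts T. e \<subseteq> V t) \<and>
     (\<forall>t\<^sub>1\<in>verts T. \<forall>t\<^sub>2\<in>verts T. \<forall>t\<^sub>3\<in>verts T.
        on_tree_path T t\<^sub>1 t\<^sub>2 t\<^sub>3 \<longrightarrow> V t\<^sub>1 \<inter> V t\<^sub>3 \<subseteq> V t\<^sub>2)"

text \<open>
  The nodes of the decomposition tree live in a type of their own, passed as an argument.  A
  theorem that assumes \<open>normally_traceable TYPE('b) G\<close> for a type variable \<open>'b\<close> covers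
  decomposition trees of every cardinality.
\<close>

definition normally_traceable :: "'b itself \<Rightarrow> 'a ugraph \<Rightarrow> bool" where
  "normally_traceable _ G \<longleftrightarrow> connected G \<and>
     (\<exists>(T :: 'b ugraph) V. tree_decomposition G T V \<and> rayless T \<and>
        (\<forall>t\<in>verts T. normally_spanned G (V t)))"


section \<open>The end map is well defined\<close>

lemma is_graph_edgeD: "is_graph G \<Longrightarrow> adj G u v \<Longrightarrow> u \<in> verts G \<and> v \<in> verts G"
  by (auto simp: is_graph_def adj_def)

lemma adj_commute: "adj G u v \<longleftrightarrow> adj G v u"
  by (simp add: adj_def insert_commute)

lemma rtranclp_adj_sym: "(adj G)\<^sup>*\<^sup>* u v \<Longrightarrow> (adj G)\<^sup>*\<^sup>* v u"
proof (induction rule: rtranclp_induct)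
  case (step y z)
  from step.hyps(2) have "adj G z y" by (simp add: adj_commute)
  then show ?case using step.IH by (rule converse_rtranclp_into_rtranclp)
qed simp

lemma successively_imp_rtranclp:
  "successively R p \<Longrightarrow> p \<noteq> [] \<Longrightarrow> R\<^sup>*\<^sup>* (hd p) (last p)"
proof (induction p rule: induct_list012)
  case (3 x y zs)
  then show ?case by (auto intro: converse_rtranclp_into_rtranclp)
qed auto

lemma path_between_iff_rtranclp:
  assumes "is_graph G" "u \<in> verts G"
  shows "(\<exists>p. path_between G u p v) \<longleftrightarrow> (adj G)\<^sup>*\<^sup>* u v"
proof
  assume "\<exists>p. path_between G u p v"
  then show "(adj G)\<^sup>*\<^sup>* u v"
    using successively_imp_rtranclp by (fastforce simp: path_between_def path_def)
next
  assume "(adj G)\<^sup>*\<^sup>* u v"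
  then show "\<exists>p. path_between G u p v"
  proof (induction rule: rtranclp_induct)
    case base
    have "path_between G u [u] u" using assms by (simp add: path_between_def path_def)
    then show ?case ..
  next
    case (step v w)
    then obtain p where p: "path G p" "hd p = u" "last p = v" by (auto simp: path_between_def)
    show ?case
    proof (cases "w \<in> set p")
      case True
      then obtain ys zs where "p = ys @ w # zs" by (auto simp: in_set_conv_decomp)
      then have "p = (ys @ [w]) @ zs" by simp
      with p have "path_between G u (ys @ [w]) w"
        by (auto simp: path_between_def path_def successively_append_iff hd_append)
      then show ?thesis ..
    next
      case False
      then have "path_between G u (p @ [w]) w"
        using p step.hyps(2) is_graph_edgeD[OF assms(1) step.hyps(2)]
        by (auto simp: path_between_def path_def successively_append_iff)
      then show ?thesis ..
    qed
  qed
qed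

lemma connected_iff_rtranclp:
  "connected G \<longleftrightarrow> is_graph G \<and> verts G \<noteq> {} \<and> (\<forall>u\<in>verts G. \<forall>v\<in>verts G. (adj G)\<^sup>*\<^sup>* u v)"
  by (auto simp: connected_def path_between_iff_rtranclp)

lemma adj_subgraph: "subgraph H G \<Longrightarrow> adj H u v \<Longrightarrow> adj G u v"
  by (auto simp: subgraph_def adj_def)

lemma rtranclp_adj_subgraph: "subgraph H G \<Longrightarrow> (adj H)\<^sup>*\<^sup>* u v \<Longrightarrow> (adj G)\<^sup>*\<^sup>* u v"
  by (metis adj_subgraph mono_rtranclp)

lemma connected_subset_component:
  assumes G: "is_graph G" and d: "d \<in> verts G"
  obtains C where "component G C" "verts C = {v. (adj G)\<^sup>*\<^sup>* d v}"
proof -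
  define R where "R = {v. (adj G)\<^sup>*\<^sup>* d v}"
  define C where "C = Graph R {e \<in> edges G. e \<subseteq> R}"
  have RV: "R \<subseteq> verts G"
  proof
    fix v assume "v \<in> R"
    then have "(adj G)\<^sup>*\<^sup>* d v" by (simp add: R_def)
    then show "v \<in> verts G"
      by (induction rule: rtranclp_induct) (use d is_graph_edgeD[OF G] in blast)+
  qed
  have gC: "is_graph C" and sC: "subgraph C G"
    using G RV by (auto simp: C_def is_graph_def subgraph_def)
  have reach: "(adj C)\<^sup>*\<^sup>* d v" if "v \<in> R" for v
  proof -
    have "(adj G)\<^sup>*\<^sup>* d v" using that by (simp add: R_def)
    then show ?thesis
    proof (induction rule: rtranclp_induct)
      case (step y z)
      then have "adj C y z"
        by (auto simp: C_def R_def adj_def intro: rtranclp.rtrancl_into_rtrancl)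
      with step.IH show ?case by (rule rtranclp.rtrancl_into_rtrancl)
    qed simp
  qed
  have "d \<in> R" by (simp add: R_def)
  moreover have "(adj C)\<^sup>*\<^sup>* u v" if "u \<in> R" "v \<in> R" for u v
    using reach[OF that(1)] reach[OF that(2)] by (meson rtranclp_adj_sym rtranclp_trans)
  ultimately have conC: "connected C"
    using gC by (auto simp: connected_iff_rtranclp C_def)
  have "D = C" if "subgraph D G" "connected D" "subgraph C D" for D
  proof -
    have "d \<in> verts D" using that(3) \<open>d \<in> R\<close> by (auto simp: subgraph_def C_def)
    then have "verts D \<subseteq> R"
      using that(1,2) rtranclp_adj_subgraph[OF that(1)] by (auto simp: connected_iff_rtranclp R_def)
    moreover have "edges D \<subseteq> edges C"
      using that(1) calculation by (fastforce simp: subgraph_def C_def is_graph_def)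
    ultimately show ?thesis
      using that(3) by (auto simp: subgraph_def C_def intro!: ugraph.expand)
  qed
  then have "component G C" using sC conC by (auto simp: component_def)
  then show ?thesis by (rule that) (simp add: C_def R_def)
qed

lemma component_verts:
  assumes "component G C" "d \<in> verts C"
  shows "verts C = {v. (adj G)\<^sup>*\<^sup>* d v}" "edges C = {e \<in> edges G. e \<subseteq> verts C}"
proof -
  have sC: "subgraph C G" and cC: "connected C" and G: "is_graph G" and d: "d \<in> verts G"
    using assms by (auto simp: component_def subgraph_def)
  obtain D where D: "component G D" "verts D = {v. (adj G)\<^sup>*\<^sup>* d v}"
    using connected_subset_component[OF G d] .
  have sub: "verts C \<subseteq> verts D"
    using cC assms(2) rtranclp_adj_subgraph[OF sC] by (auto simp: D(2) connected_iff_rtranclp)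
  define E where "E = Graph (verts D) {e \<in> edges G. e \<subseteq> verts D}"
  have sDG: "subgraph D G" and cD: "connected D" using D by (auto simp: component_def)
  have gE: "is_graph E" using G by (auto simp: E_def is_graph_def)
  have incl: "subgraph H E" if "subgraph H G" "verts H \<subseteq> verts D" for H
    using that gE by (auto simp: subgraph_def E_def is_graph_def)
  have sE: "subgraph E G" "subgraph D E" "subgraph C E"
    using G gE sDG incl[OF sDG] incl[OF sC sub] by (auto simp: subgraph_def E_def)
  have "connected E"
    using cD gE rtranclp_adj_subgraph[OF sE(2)] by (auto simp: connected_iff_rtranclp E_def)
  then have "E = C" using assms(1) sE by (auto simp: component_def)
  then have vC: "verts C = verts D" and eC: "edges C = {e \<in> edges G. e \<subseteq> verts D}"
    by (simp_all flip: \<open>E = C\<close> add: E_def)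
  show "verts C = {v. (adj G)\<^sup>*\<^sup>* d v}" using vC D(2) by simp
  show "edges C = {e \<in> edges G. e \<subseteq> verts C}" using vC eC by simp
qed

lemma component_eqI:
  assumes "component G C" "component G D" "d \<in> verts C" "d \<in> verts D"
  shows "C = D"
  using component_verts[OF assms(1,3)] component_verts[OF assms(2,4)]
  by (auto intro!: ugraph.expand)

lemma is_graph_delete_verts: "is_graph G \<Longrightarrow> is_graph (delete_verts G X)"
  by (auto simp: is_graph_def delete_verts_def)

lemma ray_has_tail_in_component:
  assumes G: "is_graph G" and r: "r \<in> rays G" and X: "finite X"
  shows "\<exists>C. component (delete_verts G X) C \<and> has_tail_in r C"
proof -
  let ?G = "delete_verts G X"
  have r': "inj r" "range r \<subseteq> verts G" "\<And>i. adj G (r i) (r (Suc i))"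
    using r by (auto simp: rays_def ray_def)
  have "finite (r -` X)" using X r'(1) by (rule finite_vimageI)
  then obtain n where n: "\<forall>i\<in>r -` X. i < n" using finite_nat_set_iff_bounded by blast
  then have nX: "r i \<notin> X" if "i \<ge> n" for i
    using n that by (meson leD vimageI)
  have "r n \<in> verts ?G" using nX[of n] r'(2) by (auto simp: delete_verts_def)
  then obtain C where C: "component ?G C" "verts C = {v. (adj ?G)\<^sup>*\<^sup>* (r n) v}"
    using connected_subset_component[OF is_graph_delete_verts[OF G]] by metis
  have "(adj ?G)\<^sup>*\<^sup>* (r n) (r i)" if "i \<ge> n" for i
    using that
  proof (induction rule: dec_induct)
    case (step i)
    have "adj ?G (r i) (r (Suc i))"
      using r'(3)[of i] nX[of i] nX[of "Suc i"] step.hyps by (auto simp: adj_def delete_verts_def)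
    with step.IH show ?case by (rule rtranclp.rtrancl_into_rtrancl)
  qed simp
  then have "has_tail_in r C" by (auto simp: has_tail_in_def C(2))
  with C(1) show ?thesis by blast
qed

lemma has_tail_in_component_unique:
  assumes "component G C" "component G D" "has_tail_in r C" "has_tail_in r D"
  shows "C = D"
proof -
  obtain m n where "\<forall>i\<ge>m. r i \<in> verts C" "\<forall>i\<ge>n. r i \<in> verts D"
    using assms(3,4) by (auto simp: has_tail_in_def)
  then have "r (max m n) \<in> verts C" "r (max m n) \<in> verts D" by auto
  with assms(1,2) show ?thesis by (rule component_eqI)
qed

lemma equiv_ray_equiv:
  assumes "is_graph G"
  shows "equiv (rays G) (ray_equiv G)"
proof (rule equivI)
  show "ray_equiv G \<subseteq> rays G \<times> rays G" by (auto simp: ray_equiv_def)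
  show "refl_on (rays G) (ray_equiv G)"
    using ray_has_tail_in_component[OF assms] by (simp add: refl_on_def ray_equiv_def)
  show "sym (ray_equiv G)"
    unfolding sym_def ray_equiv_def by blast
  show "trans (ray_equiv G)"
  proof (rule transI)
    fix r s t assume rs: "(r, s) \<in> ray_equiv G" and st: "(s, t) \<in> ray_equiv G"
    have "\<exists>C. component (delete_verts G X) C \<and> has_tail_in r C \<and> has_tail_in t C"
      if X: "finite X" "X \<subseteq> verts G" for X
    proof -
      obtain C where C: "component (delete_verts G X) C" "has_tail_in r C" "has_tail_in s C"
        using rs X by (auto simp: ray_equiv_def)
      obtain D where D: "component (delete_verts G X) D" "has_tail_in s D" "has_tail_in t D"
        using st X by (auto simp: ray_equiv_def)
      have "C = D" using has_tail_in_component_unique[OF C(1) D(1) C(3) D(2)] .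
      with C D show ?thesis by blast
    qed
    moreover have "r \<in> rays G" "t \<in> rays G" using rs st by (simp_all add: ray_equiv_def)
    ultimately show "(r, t) \<in> ray_equiv G" by (simp add: ray_equiv_def)
  qed
qed

lemma ray_equiv_subgraph:
  assumes "subgraph H G"
  shows "ray_equiv H \<subseteq> ray_equiv G"
proof (rule subrelI)
  fix r s assume rs: "(r, s) \<in> ray_equiv H"
  have rays: "r \<in> rays G" "s \<in> rays G"
    using rs assms by (auto simp: ray_equiv_def rays_def ray_def subgraph_def adj_def)
  have "\<exists>C. component (delete_verts G X) C \<and> has_tail_in r C \<and> has_tail_in s C"
    if X: "finite X" "X \<subseteq> verts G" for X
  proof -
    let ?G = "delete_verts G X" and ?H = "delete_verts H (X \<inter> verts H)"
    have gG: "is_graph ?G" using assms by (auto simp: subgraph_def is_graph_delete_verts)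
    have HG: "subgraph ?H ?G"
    proof -
      have "is_graph ?H" using assms by (auto simp: subgraph_def is_graph_delete_verts)
      moreover have "verts ?H \<subseteq> verts ?G"
        using assms by (auto simp: subgraph_def delete_verts_def)
      moreover have "edges ?H \<subseteq> edges ?G"
      proof
        fix e assume "e \<in> edges ?H"
        then have "e \<in> edges H" "e \<inter> (X \<inter> verts H) = {}" by (auto simp: delete_verts_def)
        moreover from this have "e \<subseteq> verts H" "e \<in> edges G"
          using assms by (auto simp: subgraph_def is_graph_def)
        ultimately show "e \<in> edges ?G" by (auto simp: delete_verts_def)
      qed
      ultimately show ?thesis using gG by (simp add: subgraph_def)
    qed
    obtain C where C: "component ?H C" "has_tail_in r C" "has_tail_in s C"
      using rs X by (auto simp: ray_equiv_def)
    then obtain d where d: "d \<in> verts C" by (auto simp: component_def connected_def)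
    then have "d \<in> verts ?G" using C(1) HG by (auto simp: component_def subgraph_def)
    then obtain D where D: "component ?G D" "verts D = {v. (adj ?G)\<^sup>*\<^sup>* d v}"
      using connected_subset_component[OF gG] by metis
    have "verts C \<subseteq> verts D"
      using component_verts(1)[OF C(1) d] rtranclp_adj_subgraph[OF HG] by (auto simp: D(2))
    then have "has_tail_in r D" "has_tail_in s D"
      using C(2,3) by (auto simp: has_tail_in_def)
    with D(1) show ?thesis by blast
  qed
  then show "(r, s) \<in> ray_equiv G" using rays by (auto simp: ray_equiv_def)
qed

lemma end_map_ex1:
  assumes HG: "subgraph H G" and \<eta>: "\<eta> \<in> ends H"
  shows "\<exists>!\<omega>. \<omega> \<in> ends G \<and> \<eta> \<subseteq> \<omega>"
proof -
  have eH: "equiv (rays H) (ray_equiv H)" and eG: "equiv (rays G) (ray_equiv G)"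
    using HG by (auto simp: subgraph_def equiv_ray_equiv)
  obtain r where r: "r \<in> rays H" "\<eta> = ray_equiv H `` {r}"
    using \<eta> by (auto simp: ends_def elim: quotientE)
  have rG: "r \<in> rays G" using r(1) HG by (auto simp: rays_def ray_def subgraph_def adj_def)
  have r\<eta>: "r \<in> \<eta>" using equiv_class_self[OF eH r(1)] r(2) by simp
  show ?thesis
  proof (rule ex1I)
    show "ray_equiv G `` {r} \<in> ends G \<and> \<eta> \<subseteq> ray_equiv G `` {r}"
      using rG ray_equiv_subgraph[OF HG] by (auto simp: ends_def r(2) intro: quotientI)
  next
    fix \<omega> assume \<omega>: "\<omega> \<in> ends G \<and> \<eta> \<subseteq> \<omega>"
    then have "r \<in> \<omega>" using r\<eta> by blast
    moreover obtain s where "\<omega> = ray_equiv G `` {s}"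
      using \<omega> by (auto simp: ends_def elim: quotientE)
    ultimately show "\<omega> = ray_equiv G `` {r}"
      using equiv_class_eq[OF eG] by auto
  qed
qed

lemma end_map:
  assumes "subgraph H G" "\<eta> \<in> ends H"
  shows "end_map H G \<eta> \<in> ends G" "\<eta> \<subseteq> end_map H G \<eta>"
  using theI'[OF end_map_ex1[OF assms]] by (simp_all add: end_map_def)

end

theory Submission
  imports Defs
begin

text \<open>
  The levels of a normal tree are dispersed: every ray is separated from them by finitely many
  vertices.  Hence, by induction along the rayless decomposition tree, \<open>G\<close> has a rank: it can be
  dismantled by deleting a countable union of dispersed sets and recursing into the components.
  Conversely (Jung), countable unions of dispersed sets are normally spanned in every connected
  induced subgraph, so at each recursion step there is a normal tree \<open>T\<close> all of whose remaining
  components have smaller rank.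

  Ends of a component \<open>D\<close> of \<open>W - T\<close> may be equivalent in \<open>W\<close> to the end of the normal ray to which
  the neighbours of \<open>D\<close> converge, so the induction needs spanning forests that omit prescribed ends.
  The statement proved is: for every decreasing sequence \<open>B\<close> of vertex sets there is a spanning
  forest with roots in \<open>B 0\<close> whose rays represent, each once, exactly the ends outside the closure of
  some \<open>B n\<close>.  For \<open>B 0\<close> a single vertex and \<open>B 1\<close> empty this is an end-faithful spanning tree.  In the
  induction step, \<open>D\<close> gets the forest for the sets \<open>B n\<close> enlarged by the neighbours of nodes of height
  at least \<open>n\<close>, and normal rays in the closure of all \<open>B n\<close> are broken infinitely often by rerouting
  them through components to \<open>B 0\<close>.
\<close>

section \<open>Reachability, rays and limits in induced subgraphs\<close>

text \<open>A single set in place of the sequence \<open>B\<close> would be too coarse: a low node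
  may have infinitely many neighbours in a component \<open>D\<close> of \<open>W - T\<close>. By
  normality the neighbours of \<open>D\<close> in \<open>T\<close> form a chain, so the neighbours
  in \<open>D\<close> of ever higher nodes single out just the end of the branch below
  \<open>D\<close>. That end is represented by the tree or must be omitted anyway. Roots in
  \<open>B 0\<close> mean that every root of the forest of \<open>D\<close> is an allowed root of
  the whole forest or has a neighbour in the tree to hang from.

  Breaking a normal ray infinitely often requires for its nodes separate escapes to
  \<open>B 0\<close> that do not collide inside a component. There is room for this if above every
  node infinitely many nodes and components meet \<open>B 0\<close>. If some \<open>B n\<close>
  meets only finitely many above height \<open>n\<close>, then one component together with a tail of
  the ray already has the end of the ray in the closure of all \<open>B n\<close>, and the induction
  hypothesis is applied to this connected union. So the induction must tolerate extra vertices. A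
  tail is countable, hence a countable union of dispersed sets, and the next normal tree swallows
  it.\<close>

locale sgraph =
  fixes E :: "'a \<Rightarrow> 'a \<Rightarrow> bool"
  assumes E_sym: "E u v \<Longrightarrow> E v u"
begin

definition step :: "'a set \<Rightarrow> 'a \<Rightarrow> 'a \<Rightarrow> bool" where
  "step Z u v \<longleftrightarrow> E u v \<and> v \<in> Z"

definition reach :: "'a set \<Rightarrow> 'a \<Rightarrow> 'a \<Rightarrow> bool" where
  "reach Z a b \<longleftrightarrow> a \<in> Z \<and> (step Z)\<^sup>*\<^sup>* a b"

definition comp :: "'a set \<Rightarrow> 'a \<Rightarrow> 'a set" where
  "comp Z a = {b. reach Z a b}"

definition conn :: "'a set \<Rightarrow> bool" where
  "conn Z \<longleftrightarrow> Z \<noteq> {} \<and> (\<forall>a\<in>Z. \<forall>b\<in>Z. reach Z a b)"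

definition is_ray :: "'a set \<Rightarrow> (nat \<Rightarrow> 'a) \<Rightarrow> bool" where
  "is_ray W r \<longleftrightarrow> inj r \<and> (\<forall>n. r n \<in> W) \<and> (\<forall>n. E (r n) (r (Suc n)))"

text \<open>For a decreasing sequence \<open>B\<close> of vertex sets: the end of the ray \<open>r\<close> in the graph induced
  on \<open>W\<close> lies in the closure of every \<open>B n\<close>.\<close>

definition lim :: "'a set \<Rightarrow> (nat \<Rightarrow> 'a set) \<Rightarrow> (nat \<Rightarrow> 'a) \<Rightarrow> bool" where
  "lim W B r \<longleftrightarrow> (\<forall>X n. finite X \<longrightarrow> (\<exists>i\<ge>n. \<exists>b\<in>B n. reach (W - X) (r i) b))"

text \<open>For rays this is equivalence: the end of \<open>r\<close> lies in the closure of every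
  tail of \<open>s\<close>. Phrased through \<open>lim\<close>, it inherits the transport lemmas for
  limits.\<close>

definition eqv :: "'a set \<Rightarrow> (nat \<Rightarrow> 'a) \<Rightarrow> (nat \<Rightarrow> 'a) \<Rightarrow> bool" where
  "eqv W r s \<longleftrightarrow> lim W (\<lambda>n. s ` {n..}) r"

lemma reach_refl: "a \<in> Z \<Longrightarrow> reach Z a a"
  by (simp add: reach_def)

lemma reach_step: "reach Z a b \<Longrightarrow> E b c \<Longrightarrow> c \<in> Z \<Longrightarrow> reach Z a c"
  by (auto simp: reach_def step_def intro: rtranclp.rtrancl_into_rtrancl)

lemma reach_edge: "a \<in> Z \<Longrightarrow> E a b \<Longrightarrow> b \<in> Z \<Longrightarrow> reach Z a b"
  using reach_refl reach_step by blast

lemma reach_induct [consumes 1, case_names refl step]: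
  assumes "reach Z a b" "a \<in> Z \<Longrightarrow> P a"
    "\<And>b c. reach Z a b \<Longrightarrow> P b \<Longrightarrow> E b c \<Longrightarrow> c \<in> Z \<Longrightarrow> P c"
  shows "P b"
proof -
  have a: "a \<in> Z" and st: "(step Z)\<^sup>*\<^sup>* a b" using assms(1) by (auto simp: reach_def)
  from st show ?thesis
  proof (induction rule: rtranclp_induct)
    case base then show ?case using assms(2) a by blast
  next
    case (step y z)
    then show ?case using assms(3)[of y z] a by (auto simp: reach_def step_def)
  qed
qed

lemma reach_in: "reach Z a b \<Longrightarrow> a \<in> Z \<and> b \<in> Z"
  by (induction rule: reach_induct) (auto simp: reach_def)

lemma reach_trans: "reach Z a b \<Longrightarrow> reach Z b c \<Longrightarrow> reach Z a c"
  by (auto simp: reach_def)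

lemma reach_sym: "reach Z a b \<Longrightarrow> reach Z b a"
proof (induction rule: reach_induct)
  case (step b c)
  then have "reach Z c b" using reach_edge[of c Z b] reach_in E_sym by blast
  then show ?case using step reach_trans by blast
qed (rule reach_refl)

lemma reach_via: "reach Z u a \<Longrightarrow> reach Z u b \<Longrightarrow> reach Z a b"
  by (rule reach_trans[OF reach_sym])

lemma connI: "u \<in> Z \<Longrightarrow> (\<And>w. w \<in> Z \<Longrightarrow> reach Z u w) \<Longrightarrow> conn Z"
  unfolding conn_def using reach_via by blast

lemma reach_mono: "reach Z a b \<Longrightarrow> Z \<subseteq> Z' \<Longrightarrow> reach Z' a b"
proof (induction rule: reach_induct)
  case (step b c) then show ?case using reach_step by blast
qed (auto intro: reach_refl)

lemma reach_exit:
  assumes "reach S a c" "a \<in> P" "c \<notin> P"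
  shows "\<exists>u v. reach (S \<inter> P) a u \<and> E u v \<and> v \<in> S - P"
proof -
  have "reach (S \<inter> P) a c \<or> (\<exists>u v. reach (S \<inter> P) a u \<and> E u v \<and> v \<in> S - P)"
    using assms(1)
  proof (induction rule: reach_induct)
    case refl then show ?case using assms(2) reach_refl by blast
  next
    case (step b c)
    then show ?case by (metis DiffI IntI reach_step)
  qed
  then show ?thesis using assms(3) reach_in by blast
qed

text \<open>Closure of \<open>P\<close> is demanded only at vertices already reached inside
  \<open>P\<close>; \<open>islI\<close> controls just those.\<close>

lemma reach_closed:
  assumes "reach S a c" "a \<in> P" "\<And>u v. u \<in> P \<Longrightarrow> reach (S \<inter> P) a u \<Longrightarrow> E u v \<Longrightarrow> v \<in> S \<Longrightarrow> v \<in> P"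
  shows "reach (S \<inter> P) a c"
  using assms(1)
proof (induction rule: reach_induct)
  case refl then show ?case using assms(2) reach_refl by blast
next
  case (step b c)
  then show ?case using assms(3)[of b c] reach_in[of "S \<inter> P" a b] reach_step[of "S \<inter> P" a b c] by blast
qed

lemma comp_subset: "comp Z a \<subseteq> Z"
  using reach_in by (auto simp: comp_def)

lemma comp_self: "a \<in> Z \<Longrightarrow> a \<in> comp Z a"
  by (simp add: comp_def reach_refl)

lemma comp_eq: "b \<in> comp Z a \<Longrightarrow> comp Z b = comp Z a"
  unfolding comp_def using reach_trans reach_sym by blast

lemma comp_closed: "u \<in> comp Z a \<Longrightarrow> E u v \<Longrightarrow> v \<in> Z \<Longrightarrow> v \<in> comp Z a"
  unfolding comp_def using reach_step by blast

lemma reach_comp: assumes "reach Z a b" shows "reach (comp Z a) a b"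
proof -
  have "reach (Z \<inter> comp Z a) a b"
    using assms reach_in[OF assms] comp_self[of a Z] comp_closed[of _ Z a] by (intro reach_closed) auto
  then show ?thesis using reach_mono by blast
qed

lemma conn_comp: "a \<in> Z \<Longrightarrow> conn (comp Z a)"
proof -
  assume a: "a \<in> Z"
  show ?thesis
    by (rule connI[OF comp_self[OF a]]) (rule reach_comp, simp add: comp_def)
qed

lemma conn_union: assumes "conn D" "conn F" "E u v" "u \<in> D" "v \<in> F" shows "conn (D \<union> F)"
proof -
  have 1: "reach (D \<union> F) u w" if "w \<in> D" for w
    using that assms reach_mono[of D u w "D \<union> F"] by (auto simp: conn_def)
  have 2: "reach (D \<union> F) v w" if "w \<in> F" for w
    using that assms reach_mono[of F v w "D \<union> F"] by (auto simp: conn_def)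
  have 3: "reach (D \<union> F) u v" using assms reach_edge by blast
  have "reach (D \<union> F) u w" if "w \<in> D \<union> F" for w using that 1 2 reach_trans[OF 3] by blast
  then show ?thesis using assms(4) by (auto intro: connI)
qed

section \<open>Rays and closures of vertex sets\<close>

lemma ray_mono: "is_ray W r \<Longrightarrow> W \<subseteq> W' \<Longrightarrow> is_ray W' r"
  by (auto simp: is_ray_def)

lemma ray_shift_into: "is_ray W r \<Longrightarrow> (\<And>i. i \<ge> a \<Longrightarrow> r i \<in> D) \<Longrightarrow> is_ray D (\<lambda>n. r (n + a))"
  by (auto simp: is_ray_def inj_eq intro!: injI)

lemma inj_avoid:
  assumes "inj (r :: nat \<Rightarrow> 'a)" "finite X" shows "\<exists>n. \<forall>i\<ge>n. r i \<notin> X"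
proof -
  have "finite (r -` X)" using assms by (simp add: finite_vimageI)
  then obtain n where "\<forall>i\<in>r -` X. i < n" using finite_nat_set_iff_bounded by blast
  then show ?thesis by (metis leD vimageI)
qed

lemma chain_reach:
  assumes "\<And>i. i \<ge> n \<Longrightarrow> r i \<in> Z" "\<And>i. i \<ge> n \<Longrightarrow> E (r i) (r (Suc i))" "i \<ge> n" "j \<ge> n"
  shows "reach Z (r i) (r j)"
proof -
  have "reach Z (r n) (r k)" if "k \<ge> n" for k
    using that
  proof (induction rule: dec_induct)
    case base show ?case using assms(1)[of n] reach_refl by blast
  next
    case (step k) then show ?case using assms(1)[of "Suc k"] assms(2)[of k] reach_step by force
  qed
  then show ?thesis using assms(3,4) by (auto intro: reach_via)
qed

lemma ray_tail_reach:
  assumes "is_ray W r" "finite X" shows "\<exists>n. \<forall>i\<ge>n. \<forall>j\<ge>n. reach (W - X) (r i) (r j)"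
proof -
  obtain n where "\<forall>i\<ge>n. r i \<notin> X" using inj_avoid[of r X] assms by (auto simp: is_ray_def)
  then show ?thesis using chain_reach[of n r "W - X"] assms(1) by (auto simp: is_ray_def)
qed

lemma limI: "(\<And>X n. finite X \<Longrightarrow> \<exists>i\<ge>n. \<exists>b\<in>B n. reach (W - X) (r i) b) \<Longrightarrow> lim W B r"
  by (simp add: lim_def)

lemma limE: "lim W B r \<Longrightarrow> finite X \<Longrightarrow> (\<And>i b. i \<ge> n \<Longrightarrow> b \<in> B n \<Longrightarrow> reach (W - X) (r i) b \<Longrightarrow> P) \<Longrightarrow> P"
  unfolding lim_def by blast

lemma not_limE:
  assumes "\<not> lim W B r"
  obtains X n where "finite X" "\<forall>i\<ge>n. \<forall>b\<in>B n. \<not> reach (W - X) (r i) b"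
  using assms that unfolding lim_def by blast

lemma lim_mono: assumes "lim W B r" "W \<subseteq> W'" "\<And>n. B n \<inter> W \<subseteq> B' n" shows "lim W' B' r"
proof (rule limI)
  fix X :: "'a set" and n :: nat assume X: "finite X"
  obtain i b where "i \<ge> n" "b \<in> B n" "reach (W - X) (r i) b" using limE[OF assms(1) X] by metis
  moreover from this have "b \<in> B' n" using assms(3)[of n] reach_in by blast
  moreover have "W - X \<subseteq> W' - X" using assms(2) by blast
  ultimately show "\<exists>i\<ge>n. \<exists>b\<in>B' n. reach (W' - X) (r i) b" using reach_mono by blast
qed

text \<open>\<open>lim\<close> couples the position on the ray with the index of \<open>B\<close>.
  Shifting the ray shifts that index, which antitonicity absorbs.\<close>

lemma lim_shift:
  assumes "antimono B" shows "lim W B (\<lambda>n. r (n + a)) \<longleftrightarrow> lim W B r"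
proof
  assume l: "lim W B (\<lambda>n. r (n + a))"
  show "lim W B r"
  proof (rule limI)
    fix X :: "'a set" and n :: nat assume X: "finite X"
    show "\<exists>i\<ge>n. \<exists>b\<in>B n. reach (W - X) (r i) b"
      by (rule limE[OF l X, of n]) (metis trans_le_add1)
  qed
next
  assume l: "lim W B r"
  show "lim W B (\<lambda>n. r (n + a))"
  proof (rule limI)
    fix X :: "'a set" and n :: nat assume X: "finite X"
    obtain i b where "i \<ge> n + a" "b \<in> B (n + a)" "reach (W - X) (r i) b" using limE[OF l X] by metis
    moreover have "B (n + a) \<subseteq> B n" using assms by (simp add: antimonoD)
    moreover have "i - a + a = i" "i - a \<ge> n" using calculation(1) by auto
    ultimately show "\<exists>i\<ge>n. \<exists>b\<in>B n. reach (W - X) (r (i + a)) b" by (metis subsetD)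
  qed
qed

lemma antimono_tails: "antimono (\<lambda>n. (s :: nat \<Rightarrow> 'a) ` {n..})"
  by (auto simp: antimono_def)

text \<open>If the end avoids both closures, the union of the two finite separators, taken at the
  later of the two indices, separates it from both sequences at once.\<close>

lemma lim_union:
  assumes "antimono B" "antimono B'" shows "lim W (\<lambda>n. B n \<union> B' n) r \<longleftrightarrow> lim W B r \<or> lim W B' r"
proof
  assume l: "lim W (\<lambda>n. B n \<union> B' n) r"
  show "lim W B r \<or> lim W B' r"
  proof (rule ccontr)
    assume "\<not> ?thesis"
    then have n1: "\<not> lim W B r" and n2: "\<not> lim W B' r" by auto
    obtain X n where fin1: "finite X" and 1: "\<forall>i\<ge>n. \<forall>b\<in>B n. \<not> reach (W - X) (r i) b"
      using not_limE[OF n1] .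
    obtain X' n' where fin2: "finite X'" and 2: "\<forall>i\<ge>n'. \<forall>b\<in>B' n'. \<not> reach (W - X') (r i) b"
      using not_limE[OF n2] .
    note fin = fin1 fin2
    obtain i b where i: "i \<ge> max n n'" "b \<in> B (max n n') \<union> B' (max n n')"
      and re: "reach (W - (X \<union> X')) (r i) b"
      using limE[OF l finite_UnI[OF fin]] by metis
    have re': "reach (W - X) (r i) b" "reach (W - X') (r i) b"
      by (rule reach_mono[OF re], blast)+
    have "B (max n n') \<subseteq> B n" "B' (max n n') \<subseteq> B' n'" using assms by (auto simp: antimono_def)
    then show False using i re' 1 2 by auto
  qed
next
  show "lim W B r \<or> lim W B' r \<Longrightarrow> lim W (\<lambda>n. B n \<union> B' n) r"
    using lim_mono[of W _ r W "\<lambda>n. B n \<union> B' n"] by blast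
qed

lemma eqv_alt: "eqv W r s \<longleftrightarrow> (\<forall>X n. finite X \<longrightarrow> (\<exists>i\<ge>n. \<exists>j\<ge>n. reach (W - X) (r i) (s j)))"
  unfolding eqv_def lim_def by simp (metis atLeast_iff) 

lemma eqv_sym: "eqv W r s \<Longrightarrow> eqv W s r"
  unfolding eqv_alt by (meson reach_sym)

lemma eqv_mono: "eqv W r s \<Longrightarrow> W \<subseteq> W' \<Longrightarrow> eqv W' r s"
  unfolding eqv_def by (rule lim_mono) auto

lemma eqv_refl: assumes "is_ray W r" shows "eqv W r r"
  unfolding eqv_alt
proof (intro allI impI)
  fix X :: "'a set" and n :: nat assume "finite X"
  then obtain m where m: "\<forall>i\<ge>m. \<forall>j\<ge>m. reach (W - X) (r i) (r j)" using ray_tail_reach assms by blast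
  show "\<exists>i\<ge>n. \<exists>j\<ge>n. reach (W - X) (r i) (r j)"
    using m by (intro exI[of _ "max n m"] conjI) simp_all
qed

lemma lim_cong_eqv:
  assumes "eqv W r s" "is_ray W s" "lim W B s" shows "lim W B r"
proof (rule limI)
  fix X :: "'a set" and n :: nat assume X: "finite X"
  obtain m where m: "\<forall>i\<ge>m. \<forall>j\<ge>m. reach (W - X) (s i) (s j)" using ray_tail_reach assms(2) X by blast
  \<comment> \<open>Raising \<open>n\<close> to \<open>m\<close> would change \<open>B n\<close>.
    Deleting the first \<open>m\<close> vertices of \<open>s\<close> instead forces \<open>i\<close>
    into the part of \<open>s\<close> that is connected in \<open>W - X\<close>.\<close>
  have X2: "finite (X \<union> s ` {..<m})" using X by simp
  obtain i b where i: "i \<ge> n" "b \<in> B n" "reach (W - (X \<union> s ` {..<m})) (s i) b"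
    using limE[OF assms(3) X2] by metis
  have "i \<ge> m" using reach_in[OF i(3)] by (metis Diff_iff UnCI imageI lessThan_iff not_le)
  have r1: "reach (W - X) (s i) b" by (rule reach_mono[OF i(3)]) blast
  obtain k j where k: "k \<ge> max n m" "j \<ge> max n m" "reach (W - X) (r k) (s j)"
    using assms(1) X unfolding eqv_alt by metis
  have "reach (W - X) (r k) b" using k m \<open>i \<ge> m\<close> r1 reach_trans by (meson max.boundedE)
  then show "\<exists>i\<ge>n. \<exists>b\<in>B n. reach (W - X) (r i) b" using k i by auto
qed

lemma eqv_shift_left: "eqv W (\<lambda>n. r (n + a)) s \<longleftrightarrow> eqv W r s"
  unfolding eqv_def by (rule lim_shift[OF antimono_tails])

lemma eqv_shift_right: "eqv W r (\<lambda>n. s (n + a)) \<longleftrightarrow> eqv W r s"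
  using eqv_shift_left eqv_sym by metis

text \<open>Past finitely many vertices, the ray cannot leave \<open>D\<close> within \<open>W\<close>.\<close>

definition isl :: "'a set \<Rightarrow> 'a set \<Rightarrow> (nat \<Rightarrow> 'a) \<Rightarrow> bool" where
  "isl W D r \<longleftrightarrow> (\<exists>Y n. finite Y \<and> (\<forall>X i b. Y \<subseteq> X \<longrightarrow> n \<le> i \<longrightarrow> reach (W - X) (r i) b \<longrightarrow> reach (D - X) (r i) b))"

lemma isl_lim: assumes "isl W D r" "lim W B r" "antimono B" shows "lim D B r"
proof (rule limI)
  fix X :: "'a set" and n :: nat assume X: "finite X"
  obtain Y m where Y: "finite Y" "\<And>X i b. Y \<subseteq> X \<Longrightarrow> m \<le> i \<Longrightarrow> reach (W - X) (r i) b \<Longrightarrow> reach (D - X) (r i) b"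
    using assms(1) unfolding isl_def by blast
  have "finite (X \<union> Y)" using X Y by simp
  then obtain i b where i: "i \<ge> max n m" "b \<in> B (max n m)" "reach (W - (X \<union> Y)) (r i) b"
    using limE[OF assms(2)] by metis
  then have "reach (D - (X \<union> Y)) (r i) b" using Y(2)[of "X \<union> Y" i b] by simp
  then have "reach (D - X) (r i) b" by (rule reach_mono) blast
  moreover have "b \<in> B n" using i(2) antimonoD[OF assms(3), of n "max n m"] by auto
  ultimately show "\<exists>i\<ge>n. \<exists>b\<in>B n. reach (D - X) (r i) b" using i(1) by auto
qed

lemma isl_eqv: "isl W D r \<Longrightarrow> eqv W r s \<Longrightarrow> eqv D r s"
  unfolding eqv_def using isl_lim antimono_tails by blast

text \<open>A tail of \<open>s\<close> is reachable from \<open>r\<close> after the deletion of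
  \<open>Y\<close>, and whatever is reachable in this way lies in \<open>D\<close>.\<close>

lemma isl_tail:
  assumes "isl W D r" "eqv W r s" "is_ray W s" shows "\<exists>n. \<forall>i\<ge>n. s i \<in> D"
proof -
  obtain Y m where Y: "finite Y" "\<And>X i b. Y \<subseteq> X \<Longrightarrow> m \<le> i \<Longrightarrow> reach (W - X) (r i) b \<Longrightarrow> reach (D - X) (r i) b"
    using assms(1) unfolding isl_def by blast
  obtain n where n: "\<forall>i\<ge>n. \<forall>j\<ge>n. reach (W - Y) (s i) (s j)" using ray_tail_reach assms(3) Y(1) by blast
  obtain i j where "i \<ge> max m n" "j \<ge> max m n" "reach (W - Y) (r i) (s j)"
    using assms(2) Y(1) unfolding eqv_alt by metis
  then have "reach (W - Y) (r i) (s k)" if "k \<ge> n" for k using n that reach_trans by (meson max.boundedE)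
  then have "reach (D - Y) (r i) (s k)" if "k \<ge> n" for k using Y(2)[of Y i] that \<open>i \<ge> max m n\<close> by simp
  then show ?thesis using reach_in by blast
qed

end

section \<open>Parent functions\<close>

inductive terminates :: "('a \<Rightarrow> 'a option) \<Rightarrow> 'a \<Rightarrow> bool" for p where
  "p x = None \<Longrightarrow> terminates p x"
| "p x = Some y \<Longrightarrow> terminates p y \<Longrightarrow> terminates p x"

definition leads :: "('a \<Rightarrow> 'a option) \<Rightarrow> 'a \<Rightarrow> 'a \<Rightarrow> bool" where
  "leads p a b \<longleftrightarrow> (\<lambda>x y. p x = Some y)\<^sup>*\<^sup>* a b"

text \<open>Rays are read away from the root. Nothing is lost, since a ray of a terminating forest
  cannot run towards a root forever.\<close>

definition parent_ray :: "'a set \<Rightarrow> ('a \<Rightarrow> 'a option) \<Rightarrow> (nat \<Rightarrow> 'a) \<Rightarrow> bool" where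
  "parent_ray W p r \<longleftrightarrow> (\<forall>n. r n \<in> W \<and> p (r (Suc n)) = Some (r n))"

text \<open>In a forest, two rays belong to the same end iff they share a tail.\<close>

definition tail_eq :: "(nat \<Rightarrow> 'a) \<Rightarrow> (nat \<Rightarrow> 'a) \<Rightarrow> bool" where
  "tail_eq r s \<longleftrightarrow> (\<exists>a b. \<forall>n. r (n + a) = s (n + b))"

lemma leads_refl: "leads p a a" by (simp add: leads_def)

lemma leads_step: "p a = Some b \<Longrightarrow> leads p b c \<Longrightarrow> leads p a c"
  unfolding leads_def by (rule converse_rtranclp_into_rtranclp)

lemma leads_trans: "leads p a b \<Longrightarrow> leads p b c \<Longrightarrow> leads p a c"
  unfolding leads_def by (rule rtranclp_trans)

lemma leads_cases: "leads p a b \<Longrightarrow> a = b \<or> (\<exists>c. p a = Some c \<and> leads p c b)"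
  unfolding leads_def by (erule converse_rtranclpE) auto

lemma leads_induct [consumes 1, case_names refl step]:
  "leads p a b \<Longrightarrow> P b \<Longrightarrow> (\<And>a c. p a = Some c \<Longrightarrow> leads p c b \<Longrightarrow> P c \<Longrightarrow> P a) \<Longrightarrow> P a"
  unfolding leads_def by (erule converse_rtranclp_induct) auto

lemma leads_terminates: "leads p a b \<Longrightarrow> terminates p b \<Longrightarrow> terminates p a"
  by (induction rule: leads_induct) (auto intro: terminates.intros)

lemma terminates_leads: "terminates p a \<Longrightarrow> \<exists>b. leads p a b \<and> p b = None"
  by (induction rule: terminates.induct) (blast intro: leads_refl leads_step)+

lemma leads_linear: "leads p a b \<Longrightarrow> leads p a c \<Longrightarrow> leads p b c \<or> leads p c b"
proof (induction rule: leads_induct)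
  case (step a a')
  then show ?case using leads_cases[of p a c] leads_step by (metis option.sel)
qed simp

text \<open>A cycle through \<open>a\<close> also passes through the parent of \<open>a\<close>, so
  induction on termination pushes it down to a root, which has no parent.\<close>

lemma terminates_no_cycle:
  assumes "terminates p a" "p a = Some c" "leads p c a" shows False
  using assms
proof (induction arbitrary: c rule: terminates.induct)
  case (2 x y)
  then have yx: "leads p y x" by simp
  then have "y = x \<or> (\<exists>z. p y = Some z \<and> leads p z x)" by (rule leads_cases)
  then show ?case
  proof
    assume "y = x" then show False using 2 leads_refl[of p x] by auto
  next
    assume "\<exists>z. p y = Some z \<and> leads p z x"
    then obtain z where "p y = Some z" "leads p z x" by blast
    moreover have "leads p z y" using calculation(2) 2(1) leads_trans leads_step leads_refl by metis
    ultimately show False using 2(3) by blast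
  qed
qed simp

lemma parent_ray_leads: "parent_ray W p r \<Longrightarrow> i \<le> j \<Longrightarrow> leads p (r j) (r i)"
proof (induction j)
  case 0 then show ?case by (simp add: leads_refl)
next
  case (Suc j)
  then show ?case using leads_step[of p "r (Suc j)" "r j"] leads_refl
    by (cases "i = Suc j") (auto simp: parent_ray_def)
qed

lemma parent_ray_inj:
  assumes r: "parent_ray W p r" and t: "\<And>x. x \<in> W \<Longrightarrow> terminates p x" shows "inj r"
proof -
  have "r i \<noteq> r j" if "i < j" for i j
  proof
    assume e: "r i = r j"
    obtain k where j: "j = Suc k" "i \<le> k" using \<open>i < j\<close> by (metis less_Suc_eq_le not0_implies_Suc not_less0)
    have "p (r j) = Some (r k)" "leads p (r k) (r i)"
      using r j parent_ray_leads[OF r] by (auto simp: parent_ray_def)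
    then show False using terminates_no_cycle[OF t[of "r j"]] r e by (auto simp: parent_ray_def)
  qed
  then show ?thesis by (metis injI linorder_neqE_nat)
qed

lemma tail_eq_shift: "tail_eq (\<lambda>n. r (n + a)) (\<lambda>n. s (n + b)) \<Longrightarrow> tail_eq r s"
  unfolding tail_eq_def by (metis add.assoc)

context sgraph begin

text \<open>The rays of the forest given by \<open>p\<close> represent exactly the ends that do not lie in the
  closure of all \<open>B n\<close>.\<close>

definition good :: "'a set \<Rightarrow> (nat \<Rightarrow> 'a set) \<Rightarrow> ('a \<Rightarrow> 'a option) \<Rightarrow> bool" where
  "good W B p \<longleftrightarrow>
     (\<forall>x\<in>W. p x = None \<longrightarrow> x \<in> B 0) \<and>
     (\<forall>x\<in>W. \<forall>y. p x = Some y \<longrightarrow> y \<in> W \<and> E x y) \<and>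
     (\<forall>x\<in>W. terminates p x) \<and>
     (\<forall>r. parent_ray W p r \<longrightarrow> \<not> lim W B r) \<and>
     (\<forall>r s. parent_ray W p r \<longrightarrow> parent_ray W p s \<longrightarrow> eqv W r s \<longrightarrow> tail_eq r s) \<and>
     (\<forall>r. is_ray W r \<longrightarrow> \<not> lim W B r \<longrightarrow> (\<exists>s. parent_ray W p s \<and> eqv W r s))"

lemma parent_ray_is_ray:
  assumes "parent_ray W p r" "\<And>x. x \<in> W \<Longrightarrow> terminates p x"
    "\<And>x y. x \<in> W \<Longrightarrow> p x = Some y \<Longrightarrow> E x y"
  shows "is_ray W r"
  using parent_ray_inj[OF assms(1,2)] assms(1,3) E_sym by (auto simp: is_ray_def parent_ray_def)

lemma good_ray: "good W B p \<Longrightarrow> parent_ray W p r \<Longrightarrow> is_ray W r"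
  by (rule parent_ray_is_ray) (auto simp: good_def)

lemma parent_ray_agree_tail:
  assumes r: "parent_ray W p r" "inj (r :: nat \<Rightarrow> 'a)" and F: "finite F" "\<And>x. x \<in> W - F \<Longrightarrow> p x = q x"
  shows "\<exists>a. parent_ray W q (\<lambda>n. r (n + a))"
proof -
  obtain a where "\<forall>i\<ge>a. r i \<notin> F" using inj_avoid[OF r(2) F(1)] by blast
  then have "parent_ray W q (\<lambda>n. r (n + a))" using r(1) by (simp add: parent_ray_def F(2)[symmetric])
  then show ?thesis ..
qed

text \<open>The clauses of \<open>good\<close> on rays depend only on tails, and a ray of either
  forest eventually avoids \<open>F\<close>.\<close>

lemma good_finite_change:
  assumes g: "good W B p" and B: "antimono B" and F: "finite F" "\<And>x. x \<in> W - F \<Longrightarrow> q x = p x"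
    and q: "\<And>x. x \<in> W \<Longrightarrow> q x = None \<Longrightarrow> x \<in> B 0" "\<And>x y. x \<in> W \<Longrightarrow> q x = Some y \<Longrightarrow> y \<in> W \<and> E x y"
      "\<And>x. x \<in> W \<Longrightarrow> terminates q x"
  shows "good W B q"
proof -
  have qp: "\<exists>a. parent_ray W p (\<lambda>n. r (n + a))" if "parent_ray W q r" for r
    using parent_ray_agree_tail[OF that parent_ray_inj[OF that q(3)] F] .
  have pq: "\<exists>a. parent_ray W q (\<lambda>n. r (n + a))" if "parent_ray W p r" for r
    using parent_ray_agree_tail[OF that _ F(1), of q] good_ray[OF g that] F(2) by (auto simp: is_ray_def)
  have 1: "\<not> lim W B r" if r: "parent_ray W q r" for r
  proof -
    obtain a where "parent_ray W p (\<lambda>n. r (n + a))" using qp[OF r] by blast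
    then show ?thesis using g lim_shift[OF B] by (auto simp: good_def)
  qed
  have 2: "tail_eq r s" if r: "parent_ray W q r" and s: "parent_ray W q s" and e: "eqv W r s" for r s
  proof -
    obtain a where a: "parent_ray W p (\<lambda>n. r (n + a))" using qp[OF r] by blast
    obtain b where b: "parent_ray W p (\<lambda>n. s (n + b))" using qp[OF s] by blast
    have "eqv W (\<lambda>n. r (n + a)) (\<lambda>n. s (n + b))" using e by (simp add: eqv_shift_left eqv_shift_right)
    then show ?thesis using g a b tail_eq_shift[of r a s b] by (auto simp: good_def)
  qed
  have 3: "\<exists>s. parent_ray W q s \<and> eqv W r s" if r: "is_ray W r" "\<not> lim W B r" for r
  proof -
    obtain s where s: "parent_ray W p s" "eqv W r s" using g r unfolding good_def by blast
    obtain a where "parent_ray W q (\<lambda>n. s (n + a))" using pq[OF s(1)] by blast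
    then show ?thesis using s(2) eqv_shift_right by blast
  qed
  show ?thesis unfolding good_def using q 1 2 3 by blast
qed

text \<open>Follow a walk in \<open>W\<close> from \<open>b\<close> to \<open>d\<close>. Once
  \<open>b\<close> is a root, each vertex of the walk that does not yet lead to \<open>b\<close> is
  redirected to its predecessor; only finitely many parents change.\<close>

lemma good_reroute:
  assumes g: "good W B p" and B: "antimono B" and W: "conn W" and db: "d \<in> W" "b \<in> W" "b \<in> B 0"
  shows "\<exists>q. good W B q \<and> leads q d b \<and> q b = None"
proof -
  \<comment> \<open>One redirection: \<open>v\<close> is the new parent of \<open>a\<close>, either
    none if \<open>a = b\<close>, or a neighbour that already leads to the root
    \<open>b\<close>.\<close>
  have red: "\<exists>q. good W B q \<and> leads q a b \<and> q b = None"
    if g: "good W B p" and a: "a \<in> W" and na: "\<not> leads p a b \<or> a = b"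
      and v: "v = None \<and> a = b \<or> (\<exists>c. v = Some c \<and> c \<in> W \<and> E a c \<and> leads p c b \<and> p b = None \<and> a \<noteq> b)"
    for p a v
  proof -
    define q where "q = p(a := v)"
    have keep: "leads q x b" if "leads p x b" "\<not> leads p x a" for x
      using that
    proof (induction rule: leads_induct)
      case refl show ?case by (rule leads_refl)
    next
      case (step x c)
      have "x \<noteq> a" using step.prems leads_refl by metis
      then have "q x = Some c" using step.hyps by (simp add: q_def)
      moreover have "\<not> leads p c a" using step leads_step by metis
      ultimately show ?case using step.IH leads_step by metis
    qed
    have ab: "leads q a b" "q b = None"
    proof -
      show "leads q a b"
      proof (cases "a = b")
        case True then show ?thesis by (simp add: leads_refl)
      next
        case False
        then obtain c where c: "v = Some c" "leads p c b" "p b = None" using v by auto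
        \<comment> \<open>The vertices that \<open>c\<close> leads to are linearly ordered. If
          \<open>a\<close> were among them, it would be comparable with \<open>b\<close>, against
          \<open>na\<close> or against \<open>b\<close> being a root.\<close>
        have "\<not> leads p c a"
        proof
          assume "leads p c a"
          then have "leads p a b \<or> leads p b a" using leads_linear c(2) by metis
          then show False using na False leads_cases[of p b a] c(3) by auto
        qed
        then have "leads q c b" using keep c(2) by blast
        moreover have "q a = Some c" using c by (simp add: q_def)
        ultimately show ?thesis using leads_step by metis
      qed
      show "q b = None" using v by (auto simp: q_def)
    qed
    have ta: "terminates q a" using leads_terminates[OF ab(1)] ab(2) terminates.intros(1) by metis
    have qx: "q x = p x" if "x \<noteq> a" for x using that by (simp add: q_def)
    have te: "terminates q x" if "x \<in> W" for x
    proof -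
      have "terminates p x" using g that by (auto simp: good_def)
      then show ?thesis
      proof (induction rule: terminates.induct)
        case (1 x)
        then show ?case using ta terminates.intros(1)[of q x] qx[of x] by (cases "x = a") simp_all
      next
        case (2 x y)
        then show ?case using ta terminates.intros(2)[of q x y] qx[of x] by (cases "x = a") simp_all
      qed
    qed
    have "good W B q"
    proof (rule good_finite_change[OF g B, of "{a}"])
      show "x \<in> B 0" if "x \<in> W" "q x = None" for x
        using that v g db by (cases "x = a") (auto simp: q_def good_def)
      show "y \<in> W \<and> E x y" if "x \<in> W" "q x = Some y" for x y
        using that v g by (cases "x = a") (auto simp: q_def good_def)
    qed (use te in \<open>auto simp: q_def\<close>)
    then show ?thesis using ab by blast
  qed
  have "reach W b d" using W db by (auto simp: conn_def)
  then show ?thesis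
  proof (induction rule: reach_induct)
    case refl
    show ?case by (rule red[OF g db(2), of None]) auto
  next
    case (step x c)
    then obtain q where q: "good W B q" "leads q x b" "q b = None" by blast
    show ?case
    proof (cases "leads q c b")
      case True then show ?thesis using q by blast
    next
      case False
      then have "c \<noteq> b" using leads_refl by metis
      then show ?thesis using red[OF q(1), of c "Some x"] step.hyps reach_in E_sym False q by blast
    qed
  qed
qed

end

section \<open>Normal trees\<close>

text \<open>A normal tree is encoded by the sequence of nodes \<open>t 0 w, t 1 w, \<dots>\<close> below each
  vertex \<open>w\<close> and the component \<open>C k w\<close> containing \<open>w\<close> that is left when the first \<open>k\<close> of these
  nodes are deleted.  Both are junk (the component is empty) once \<open>w\<close> itself has been a node.\<close>

locale normal_structure = sgraph E for E :: "'a \<Rightarrow> 'a \<Rightarrow> bool" +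
  fixes W :: "'a set" and C :: "nat \<Rightarrow> 'a \<Rightarrow> 'a set" and t :: "nat \<Rightarrow> 'a \<Rightarrow> 'a"
  assumes W_conn: "conn W"
    and C_0: "w \<in> W \<Longrightarrow> C 0 w = W"
    and C_Suc: "w \<in> W \<Longrightarrow> C (Suc k) w = comp (C k w - {t k w}) w"
    and t_in: "w \<in> W \<Longrightarrow> w \<in> C k w \<Longrightarrow> t k w \<in> C k w"
    and t_cong: "w \<in> W \<Longrightarrow> v \<in> C k w \<Longrightarrow> t k v = t k w"
    and t_edge: "w \<in> W \<Longrightarrow> w \<in> C (Suc k) w \<Longrightarrow> E (t k w) (t (Suc k) w)"
begin

lemma C_Suc_subset: "w \<in> W \<Longrightarrow> C (Suc k) w \<subseteq> C k w - {t k w}"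
  using C_Suc comp_subset by metis

lemma C_mono: assumes "w \<in> W" "j \<le> k" shows "C k w \<subseteq> C j w"
  using assms(2) by (induction rule: dec_induct) (use C_Suc_subset[OF assms(1)] in blast)+

lemma C_subset: "w \<in> W \<Longrightarrow> C k w \<subseteq> W"
  using C_mono[of w 0 k] C_0 by simp

lemma C_self: "w \<in> W \<Longrightarrow> v \<in> C k w \<Longrightarrow> w \<in> C k w"
  by (cases k) (auto simp: C_0 C_Suc comp_def dest: reach_in intro: reach_refl)

lemma C_cong: "w \<in> W \<Longrightarrow> v \<in> C k w \<Longrightarrow> C k v = C k w"
proof (induction k)
  case 0 then show ?case by (simp add: C_0)
next
  case (Suc k)
  have v: "v \<in> C k w" using Suc.prems C_Suc_subset by blast
  then have "v \<in> W" using C_subset Suc.prems(1) by blast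
  then show ?case using Suc v C_Suc[of v k] C_Suc[of w k] t_cong[of w v k] comp_eq by metis
qed

lemma C_conn: "w \<in> W \<Longrightarrow> w \<in> C k w \<Longrightarrow> conn (C k w)"
proof (cases k)
  case 0 then show "w \<in> W \<Longrightarrow> conn (C k w)" using W_conn C_0 by simp
next
  case (Suc j)
  show "conn (C k w)" if "w \<in> W" "w \<in> C k w"
    using conn_comp[of w "C j w - {t j w}"] C_Suc_subset[OF that(1), of j] that Suc C_Suc[OF that(1), of j] by auto
qed

lemma C_next: "w \<in> W \<Longrightarrow> w \<in> C k w \<Longrightarrow> w \<noteq> t k w \<Longrightarrow> w \<in> C (Suc k) w"
  by (simp add: C_Suc comp_self)

lemma C_nbr: "w \<in> W \<Longrightarrow> a \<in> C k w \<Longrightarrow> E a b \<Longrightarrow> b \<in> W \<Longrightarrow> (\<And>j. j < k \<Longrightarrow> b \<noteq> t j w) \<Longrightarrow> b \<in> C k w"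
proof (induction k)
  case (Suc k)
  have "a \<in> C k w" using Suc.prems(1,2) C_Suc_subset by blast
  then have "b \<in> C k w" using Suc.IH Suc.prems by simp
  then have "b \<in> C k w - {t k w}" using Suc.prems(5)[of k] by simp
  then show ?case using Suc.prems comp_closed by (simp add: C_Suc)
qed (simp add: C_0)

lemma C_sep:
  assumes "reach (W - X) a b" "w \<in> W" "a \<in> C k w" "\<And>j. j < k \<Longrightarrow> t j w \<in> X" shows "b \<in> C k w"
  using assms(1)
proof (induction rule: reach_induct)
  case (step b c) then show ?case using C_nbr[OF assms(2), of b k c] assms(4) by blast
qed (use assms in simp)

section \<open>Nodes, heights and normality\<close>

definition T :: "'a set" where "T = {w \<in> W. \<exists>k. w \<in> C k w \<and> t k w = w}"

definition h :: "'a \<Rightarrow> nat" where "h w = (LEAST k. w \<in> C k w \<and> t k w = w)"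

lemma T_W: "T \<subseteq> W" by (auto simp: T_def)

lemma T_h: "w \<in> T \<Longrightarrow> w \<in> C (h w) w \<and> t (h w) w = w"
  unfolding h_def T_def by (rule LeastI_ex) simp

lemma T_C_iff: assumes "w \<in> T" shows "w \<in> C k w \<longleftrightarrow> k \<le> h w"
proof
  have W: "w \<in> W" using assms T_W by blast
  have "w \<notin> C (Suc (h w)) w" using C_Suc_subset[OF W] T_h[OF assms] by fastforce
  then show "w \<in> C k w \<Longrightarrow> k \<le> h w" using C_mono[OF W, of "Suc (h w)" k] by (meson not_less_eq_eq subsetD)
  show "k \<le> h w \<Longrightarrow> w \<in> C k w" using C_mono[OF W] T_h[OF assms] by blast
qed

lemma h_eq: assumes "w \<in> W" "w \<in> C k w" "t k w = w" shows "w \<in> T" "h w = k"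
proof -
  show T: "w \<in> T" using assms by (auto simp: T_def)
  have "w \<notin> C (Suc k) w" using C_Suc_subset[OF assms(1)] assms(3) by fastforce
  then show "h w = k" using T_C_iff[OF T] assms(2) by (metis le_antisym not_less_eq_eq)
qed

lemma t_node:
  assumes "w \<in> W" "w \<in> C k w"
  shows "t k w \<in> T" "h (t k w) = k" "C k (t k w) = C k w" "t k w \<in> W"
proof -
  have i: "t k w \<in> C k w" using t_in assms by blast
  then show W: "t k w \<in> W" using C_subset assms(1) by blast
  show c: "C k (t k w) = C k w" by (rule C_cong[OF assms(1) i])
  have "t k (t k w) = t k w" by (rule t_cong[OF assms(1) i])
  then show "t k w \<in> T" "h (t k w) = k" using h_eq[OF W] i c by auto
qed

lemma notT_C: assumes "w \<in> W" "w \<notin> T" shows "w \<in> C k w"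
proof (induction k)
  case 0 show ?case using assms by (simp add: C_0)
next
  case (Suc k) then show ?case using C_next[OF assms(1)] h_eq(1)[OF assms(1)] assms(2) by metis
qed

text \<open>This is normality: tree neighbours of a vertex outside \<open>T\<close> lie on the chain
  of nodes below it. Having height \<open>h y\<close>, the node \<open>y\<close> differs from all
  lower nodes of that chain, so it survives in the component of \<open>d\<close> at its own
  height.\<close>

lemma nbr_T: assumes "d \<in> W" "d \<notin> T" "y \<in> T" "E d y" shows "t (h y) d = y"
proof -
  have yW: "y \<in> W" using assms T_W by blast
  have "y \<in> C (h y) d"
  proof (rule C_nbr[OF assms(1) notT_C[OF assms(1,2)] assms(4) yW])
    show "y \<noteq> t j d" if "j < h y" for j
      using t_node(2)[OF assms(1) notT_C[OF assms(1,2)], of j] that by auto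
  qed
  then show ?thesis using t_cong[OF assms(1)] T_h[OF assms(3)] by metis
qed

text \<open>A branch from the root, encoded by its nested components. Adjacency of consecutive nodes
  then follows from \<open>t_edge\<close>.\<close>

definition normal_ray :: "(nat \<Rightarrow> 'a) \<Rightarrow> bool" where
  "normal_ray R \<longleftrightarrow> (\<forall>k. R k \<in> W \<and> t k (R k) = R k \<and> (\<forall>m\<ge>k. R m \<in> C k (R k)))"

lemma normal_rayD:
  assumes "normal_ray R"
  shows "R k \<in> W" "R k \<in> T" "h (R k) = k" "R k \<in> C k (R k)" "t k (R k) = R k"
    "k \<le> m \<Longrightarrow> R m \<in> C k (R k)" "k \<le> m \<Longrightarrow> C k (R m) = C k (R k)" "k \<le> m \<Longrightarrow> t k (R m) = R k"
proof -
  show 1: "R k \<in> W" "R k \<in> C k (R k)" "t k (R k) = R k" and 2: "k \<le> m \<Longrightarrow> R m \<in> C k (R k)"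
    using assms by (auto simp: normal_ray_def)
  show "R k \<in> T" "h (R k) = k" using h_eq 1 by auto
  show "k \<le> m \<Longrightarrow> C k (R m) = C k (R k)" "k \<le> m \<Longrightarrow> t k (R m) = R k"
    using C_cong[OF 1(1) 2] t_cong[OF 1(1) 2] 1 by auto
qed

lemma normal_ray_edge: assumes "normal_ray R" shows "E (R k) (R (Suc k))"
  using t_edge[of "R (Suc k)" k] normal_rayD(1,4,5)[OF assms, of "Suc k"]
    normal_rayD(8)[OF assms, of k "Suc k"] by simp

lemma normal_ray_is_ray: assumes "normal_ray R" shows "is_ray W R"
  using normal_ray_edge[OF assms] normal_rayD(1,3)[OF assms]
  by (auto simp: is_ray_def intro: inj_on_inverseI[of _ h])

lemma normal_ray_C_mono: "normal_ray R \<Longrightarrow> j \<le> k \<Longrightarrow> C k (R k) \<subseteq> C j (R j)"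
  using C_mono[of "R k" j k] normal_rayD by metis

lemma normal_ray_C_eq: "normal_ray R \<Longrightarrow> w \<in> C k (R k) \<Longrightarrow> w \<in> W \<and> C k w = C k (R k) \<and> t k w = R k \<and> w \<in> C k w"
  using C_cong t_cong normal_rayD C_subset by (metis subsetD)

lemma normal_ray_sep:
  assumes "normal_ray R" "reach (W - X) a b" "a \<in> C k (R k)" "R ` {..<k} \<subseteq> X" shows "b \<in> C k (R k)"
  using assms(4) normal_rayD(8)[OF assms(1)]
  by (intro C_sep[OF assms(2) normal_rayD(1)[OF assms(1)] assms(3)]) (auto simp: image_subset_iff)

lemma normal_ray_eqI:
  assumes "normal_ray R" "normal_ray S" "\<And>n. \<exists>k\<ge>n. C k (R k) \<inter> C k (S k) \<noteq> {}" shows "R = S"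
proof
  fix n
  obtain k w where k: "k \<ge> n" "w \<in> C k (R k)" "w \<in> C k (S k)" using assms(3) by blast
  then have "w \<in> C n (R n)" "w \<in> C n (S n)" using normal_ray_C_mono assms by blast+
  then show "R n = S n" using normal_ray_C_eq assms by metis
qed

lemma normal_ray_share:
  assumes "normal_ray R" "normal_ray S" "R k = S m" shows "k = m" "j \<le> k \<Longrightarrow> R j = S j"
proof -
  show km: "k = m" using assms normal_rayD(3) by metis
  show "j \<le> k \<Longrightarrow> R j = S j" using assms normal_rayD(8)[of _ j k] unfolding km by metis
qed

text \<open>A vertex that never becomes a node survives all deletions and so determines an infinite
  branch.\<close>

lemma branch_of_vertex:
  assumes "w \<in> W" "w \<notin> T" shows "normal_ray (\<lambda>k. t k w)" "w \<in> C k (t k w)"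
proof -
  have c: "w \<in> C k w" for k using notT_C assms by blast
  note n = t_node[OF assms(1) c]
  have "t m w \<in> C k (t k w)" if "k \<le> m" for k m
    using C_mono[OF assms(1) that] t_in[OF assms(1) c] n(3) by blast
  moreover have "t k (t k w) = t k w" for k using n T_h by metis
  ultimately show "normal_ray (\<lambda>k. t k w)" using n by (auto simp: normal_ray_def)
  show "w \<in> C k (t k w)" using n(3) c by blast
qed

text \<open>After the deletion of \<open>k\<close> nodes the ray has a tail in one component; these
  nested components determine a branch, which need not be equivalent to the ray.\<close>

lemma ray_branch:
  assumes r: "is_ray W r" shows "\<exists>R. normal_ray R \<and> (\<forall>k. \<exists>n. \<forall>i\<ge>n. r i \<in> C k (R k))"
proof -
  have rW: "r i \<in> W" and rE: "E (r i) (r (Suc i))" for i using r by (auto simp: is_ray_def)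
  have "\<exists>n. \<forall>i\<ge>n. r i \<in> C k (r n)" for k
  proof (induction k)
    case 0 then show ?case using rW C_0 by blast
  next
    case (Suc k)
    then obtain n where n: "\<forall>i\<ge>n. r i \<in> C k (r n)" by blast
    obtain m where m: "\<forall>i\<ge>m. r i \<notin> {t k (r n)}" using inj_avoid[of r "{t k (r n)}"] r by (auto simp: is_ray_def)
    define N where "N = max n m"
    have c: "C k (r N) = C k (r n)" "t k (r N) = t k (r n)"
      using n C_cong[OF rW] t_cong[OF rW] by (auto simp: N_def)
    have "r i \<in> C (Suc k) (r N)" if "i \<ge> N" for i
      using that
    proof (induction rule: dec_induct)
      case base
      then show ?case using C_next[OF rW, of N k] c n m by (auto simp: N_def)
    next
      case (step i)
      then show ?case using comp_closed[of "r i" _ "r N" "r (Suc i)"] c n m rE[of i] rW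
        by (auto simp: C_Suc N_def)
    qed
    then show ?case by blast
  qed
  then obtain f where f: "\<And>k i. i \<ge> f k \<Longrightarrow> r i \<in> C k (r (f k))" by metis
  define R where "R k = t k (r (f k))" for k
  have ff: "r (f k) \<in> C k (r (f k))" for k using f by simp
  note n = t_node[OF rW ff, folded R_def]
  have "R m \<in> C k (R k)" if "k \<le> m" for k m
  proof -
    let ?i = "max (f k) (f m)"
    have "R m \<in> C m (r (f m))" using t_in[OF rW ff] by (simp add: R_def)
    also have "\<dots> = C m (r ?i)" by (rule C_cong[OF rW f, symmetric]) simp
    also have "\<dots> \<subseteq> C k (r ?i)" by (rule C_mono[OF rW that])
    also have "\<dots> = C k (r (f k))" by (rule C_cong[OF rW f]) simp
    also have "\<dots> = C k (R k)" by (rule n(3)[symmetric])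
    finally show ?thesis .
  qed
  moreover have "t k (R k) = R k" for k using n T_h by metis
  ultimately have "normal_ray R" using n by (auto simp: normal_ray_def)
  then show ?thesis using f n(3) by metis
qed

text \<open>The nodes from \<open>w\<close> down to height \<open>k\<close> stay inside
  \<open>C k w\<close>, where \<open>X\<close> contains no node.\<close>

lemma tree_down:
  assumes "w \<in> T" "w \<in> C k w" "X \<inter> T \<inter> C k w = {}" shows "reach (W - X) w (t k w)"
proof -
  have W: "w \<in> W" using assms T_W by blast
  have ok: "t j w \<in> W - X" if "k \<le> j" "j \<le> h w" for j
  proof -
    have j: "w \<in> C j w" using that T_C_iff[OF assms(1)] by simp
    have "t j w \<in> C k w" using t_in[OF W j] C_mono[OF W that(1)] by blast
    then show ?thesis using t_node[OF W j] assms(3) by blast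
  qed
  have "reach (W - X) (t k w) (t j w)" if "k \<le> j" "j \<le> h w" for j
    using that
  proof (induction rule: dec_induct)
    case base then show ?case using ok[of k] reach_refl by blast
  next
    case (step j)
    then show ?case using ok[of "Suc j"] t_edge[OF W, of j] T_C_iff[OF assms(1)] by (auto intro: reach_step)
  qed
  then show ?thesis using assms T_C_iff T_h reach_sym by metis
qed

lemma comp_branch:
  assumes "d \<in> W" "d \<notin> T" "u \<in> comp (W - T) d"
  shows "u \<in> C k d" "C k u = C k d" "t k u = t k d" "u \<in> W" "u \<notin> T"
proof -
  have "reach (W - T) d u" using assms(3) by (simp add: comp_def)
  then show u: "u \<in> C k d"
  proof (induction rule: reach_induct)
    case (step b c)
    have "c \<noteq> t j d" for j using step.hyps(3) t_node(1)[OF assms(1) notT_C[OF assms(1,2)]] by blast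
    then show ?case using C_nbr[OF assms(1) step.IH step.hyps(2)] step.hyps(3) by blast
  qed (use notT_C assms in blast)
  show "C k u = C k d" by (rule C_cong[OF assms(1) u])
  show "t k u = t k d" by (rule t_cong[OF assms(1) u])
  show "u \<in> W" "u \<notin> T" using comp_subset assms(3) by blast+
qed

text \<open>A node inside \<open>C m w\<close> has height at least \<open>m\<close>, so any
  \<open>k\<close> above the heights occurring in \<open>X\<close> works, uniformly in
  \<open>w\<close>.\<close>

lemma escape_finite:
  assumes "finite X" shows "\<exists>k. \<forall>m\<ge>k. \<forall>w\<in>W. w \<in> C m w \<longrightarrow> X \<inter> T \<inter> C m w = {}"
proof -
  obtain k where k: "\<forall>x\<in>h ` X. x < k" using assms finite_nat_set_iff_bounded by blast
  have "x \<notin> C m w" if "m \<ge> k" "w \<in> W" "x \<in> X" "x \<in> T" for m w x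
  proof
    assume "x \<in> C m w"
    then have "x \<in> C m x" using C_cong that by blast
    then have "m \<le> h x" using T_C_iff that by blast
    then show False using k that by fastforce
  qed
  then show ?thesis by blast
qed

lemma normal_ray_hits:
  assumes R: "normal_ray R" and br: "\<And>k. \<exists>n. \<forall>i\<ge>n. r i \<in> C k (R k)" and hits: "\<And>n. \<exists>i\<ge>n. r i \<in> T"
  shows "eqv W r R"
  unfolding eqv_alt
proof (intro allI impI)
  fix X :: "'a set" and n :: nat assume "finite X"
  then obtain k0 where k0: "\<forall>m\<ge>k0. \<forall>w\<in>W. w \<in> C m w \<longrightarrow> X \<inter> T \<inter> C m w = {}" using escape_finite by blast
  let ?k = "max n k0"
  obtain m where m: "\<forall>i\<ge>m. r i \<in> C ?k (R ?k)" using br by blast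
  obtain i where i: "i \<ge> max n m" "r i \<in> T" using hits by blast
  have c: "r i \<in> W" "t ?k (r i) = R ?k" "r i \<in> C ?k (r i)" using m i normal_ray_C_eq[OF R, of "r i" ?k] by auto
  have "X \<inter> T \<inter> C ?k (r i) = {}" using k0 c by simp
  then have "reach (W - X) (r i) (R ?k)" using tree_down[OF i(2) c(3)] c(2) by simp
  then show "\<exists>i\<ge>n. \<exists>j\<ge>n. reach (W - X) (r i) (R j)" using i(1) by (metis max.bounded_iff max.cobounded1)
qed

text \<open>A ray that meets \<open>T\<close> infinitely often is equivalent to its branch. Any
  other ray has a tail in one component of \<open>W - T\<close>, and all of that component lies
  above the same branch.\<close>

lemma non_branch_ray:
  assumes r: "is_ray W r" and R: "normal_ray R" and br: "\<And>k. \<exists>n. \<forall>i\<ge>n. r i \<in> C k (R k)"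
    and ne: "\<not> eqv W r R"
  shows "\<exists>n. r n \<in> W - T \<and> (\<forall>k. t k (r n) = R k) \<and> (\<forall>i\<ge>n. r i \<in> comp (W - T) (r n))"
proof -
  obtain n where n: "\<forall>i\<ge>n. r i \<notin> T" using normal_ray_hits[OF R br] ne by blast
  have rW: "r i \<in> W" for i using r by (auto simp: is_ray_def)
  have c: "r i \<in> comp (W - T) (r n)" if "i \<ge> n" for i
    unfolding comp_def using chain_reach[of n r "W - T" n i] n r that by (simp add: is_ray_def)
  have "t k (r n) = R k" for k
  proof -
    obtain m where m: "\<forall>i\<ge>m. r i \<in> C k (R k)" using br by blast
    have "r (max n m) \<in> C k (R k)" using m by simp
    then have "t k (r (max n m)) = R k" using normal_ray_C_eq[OF R] by blast
    then show ?thesis using comp_branch(3)[OF rW, of n "r (max n m)"] n c by simp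
  qed
  then show ?thesis using c n rW by blast
qed

text \<open>Pieces partition \<open>W\<close> into single nodes and components of
  \<open>W - T\<close>. They are the units of counting: a finite set meets only finitely
  many.\<close>

definition piece :: "'a \<Rightarrow> 'a set" where
  "piece b = (if b \<in> T then {b} else comp (W - T) b)"

lemma piece_self: "b \<in> W \<Longrightarrow> b \<in> piece b"
  by (auto simp: piece_def intro: comp_self)

lemma piece_eq: "b \<in> W \<Longrightarrow> a \<in> piece b \<Longrightarrow> piece a = piece b"
  using comp_eq comp_branch(5) by (auto simp: piece_def split: if_splits)

lemma piece_W: "b \<in> W \<Longrightarrow> piece b \<subseteq> W"
  using comp_subset[of "W - T" b] by (auto simp: piece_def)

lemma piece_C: "b \<in> W \<Longrightarrow> w \<in> W \<Longrightarrow> b \<in> C k w \<Longrightarrow> piece b \<subseteq> C k w"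
  using comp_branch(1)[of b _ k] C_cong[of w b k] by (auto simp: piece_def split: if_splits)

lemma piece_attached:
  assumes b: "b \<in> W" "b \<notin> T" and w: "w \<in> W" "b \<in> C k w"
  shows "\<exists>u v. u \<in> piece b \<and> E u v \<and> v \<in> T \<and> v \<in> C k w \<and> reach (piece b) b u"
proof -
  have wC: "w \<in> C k w" using C_self w by blast
  then have "conn (C k w)" using C_conn w by blast
  then have "reach (C k w) b (t k w)" using w t_in[OF w(1) wC] by (simp add: conn_def)
  then obtain u v where uv: "reach (C k w \<inter> - T) b u" "E u v" "v \<in> C k w - (- T)"
    using reach_exit[of "C k w" b "t k w" "- T"] b t_node[OF w(1) wC] by blast
  have "reach (W - T) b u" by (rule reach_mono[OF uv(1)]) (use C_subset[OF w(1)] in blast)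
  then have "u \<in> piece b" "reach (piece b) b u" using b reach_comp by (auto simp: piece_def comp_def)
  then show ?thesis using uv by blast
qed

text \<open>Given finite \<open>X\<close>, go up to a height where the cone contains no node of
  \<open>X\<close>. One of the infinitely many pieces avoids \<open>X\<close>, and from it a path
  leads to the tree and down to the branch.\<close>

lemma rich_lim:
  assumes R: "normal_ray R" and B: "antimono B" and inf: "\<And>k. infinite (piece ` (B k \<inter> C k (R k)))"
  shows "lim W B R"
proof (rule limI)
  fix X :: "'a set" and n :: nat assume X: "finite X"
  then obtain k0 where k0: "\<forall>m\<ge>k0. \<forall>w\<in>W. w \<in> C m w \<longrightarrow> X \<inter> T \<inter> C m w = {}" using escape_finite by blast
  let ?k = "max n k0"
  note Rk = normal_rayD[OF R, of ?k]
  have "\<exists>P\<in>piece ` (B ?k \<inter> C ?k (R ?k)). P \<inter> X = {}"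
  proof (rule ccontr)
    assume no: "\<not> ?thesis"
    \<comment> \<open>If every such piece meets \<open>X\<close>, each is the piece of a vertex of
      \<open>X\<close>, so there are only finitely many.\<close>
    have "piece ` (B ?k \<inter> C ?k (R ?k)) \<subseteq> piece ` (X \<inter> W)"
    proof (rule image_subsetI)
      fix b assume b: "b \<in> B ?k \<inter> C ?k (R ?k)"
      then have bW: "b \<in> W" using C_subset[OF Rk(1)] by blast
      obtain x where "x \<in> X" "x \<in> piece b" using no b by blast
      then have "piece b = piece x" "x \<in> X \<inter> W" using piece_eq[OF bW] piece_W[OF bW] by auto
      then show "piece b \<in> piece ` (X \<inter> W)" by blast
    qed
    then show False using inf X finite_subset by (metis finite_Int finite_imageI)
  qed
  then obtain b where b: "b \<in> B ?k" "b \<in> C ?k (R ?k)" "piece b \<inter> X = {}" by blast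
  have bW: "b \<in> W" using b C_subset Rk by blast
  have down: "reach (W - X) v (R ?k)" if "v \<in> T" "v \<in> C ?k (R ?k)" for v
  proof -
    have "X \<inter> T \<inter> C ?k v = {}" using k0 normal_ray_C_eq[OF R that(2)] max.cobounded2 by blast
    then show ?thesis using tree_down[OF that(1), of ?k X] normal_ray_C_eq[OF R that(2)] by metis
  qed
  have "reach (W - X) b (R ?k)"
  proof (cases "b \<in> T")
    case True then show ?thesis using down b by blast
  next
    case False
    obtain u v where uv: "u \<in> piece b" "E u v" "v \<in> T" "v \<in> C ?k (R ?k)" "reach (piece b) b u"
      using piece_attached[OF bW False Rk(1) b(2)] by blast
    have "reach (W - X) b u" by (rule reach_mono[OF uv(5)]) (use piece_W[OF bW] b(3) in blast)
    moreover have "v \<in> W - X" using down[OF uv(3,4)] reach_in by blast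
    ultimately show ?thesis using uv down[OF uv(3,4)] reach_step reach_trans by blast
  qed
  moreover have "b \<in> B n" using b(1) antimonoD[OF B, of n ?k] by auto
  ultimately show "\<exists>i\<ge>n. \<exists>b\<in>B n. reach (W - X) (R i) b" using reach_sym by (metis max.cobounded1)
qed

text \<open>A path in \<open>W\<close> can leave a component of \<open>W - T\<close> only through a
  node \<open>t j d\<close>. The low ones are finitely many and join the deleted set;
  \<open>nb\<close> excludes the others.\<close>

lemma islI:
  assumes d: "d \<in> W" "d \<notin> T" and X: "finite X" and r: "\<And>i. i \<ge> n \<Longrightarrow> r i \<in> W - X \<Longrightarrow> r i \<in> comp (W - T) d"
    and nb: "\<And>i u j. i \<ge> n \<Longrightarrow> j \<ge> n \<Longrightarrow> reach (comp (W - T) d - X) (r i) u \<Longrightarrow> t j d \<notin> X \<Longrightarrow> \<not> E u (t j d)"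
  shows "isl W (comp (W - T) d) r"
proof -
  let ?D = "comp (W - T) d"
  let ?Y = "X \<union> (\<lambda>k. t k d) ` {..<n}"
  have "reach (?D - X') (r i) b" if X': "?Y \<subseteq> X'" and i: "n \<le> i" and re: "reach (W - X') (r i) b" for X' i b
  proof -
    have ri: "r i \<in> ?D" using r[OF i] reach_in[OF re] X' by blast
    have "reach ((W - X') \<inter> ?D) (r i) b"
    proof (rule reach_closed[OF re ri])
      fix u v assume u: "u \<in> ?D" "reach ((W - X') \<inter> ?D) (r i) u" "E u v" "v \<in> W - X'"
      show "v \<in> ?D"
      proof (cases "v \<in> T")
        case False then show ?thesis using comp_closed u by blast
      next
        case True
        note ub = comp_branch[OF d u(1)]
        have v: "t (h v) d = v" using nbr_T[OF ub(4,5) True u(3)] ub(3) by simp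
        have "h v \<ge> n" using v X' u(4) by (metis Diff_iff UnCI imageI lessThan_iff not_le subsetD)
        moreover have "reach (?D - X) (r i) u" by (rule reach_mono[OF u(2)]) (use X' in blast)
        ultimately show ?thesis using nb[OF i, of "h v" u] v u(3,4) X' by auto
      qed
    qed
    then show ?thesis by (rule reach_mono) blast
  qed
  then show ?thesis unfolding isl_def using X by (intro exI[of _ ?Y] exI[of _ n]) auto
qed

end

section \<open>Existence of normal trees\<close>

context sgraph begin

section \<open>Dispersed sets and their countable unions\<close>

definition dispersed :: "'a set \<Rightarrow> 'a set \<Rightarrow> bool" where
  "dispersed V U \<longleftrightarrow> (\<forall>r. is_ray V r \<longrightarrow> \<not> lim V (\<lambda>_. U) r)"

definition sigma_dispersed :: "'a set \<Rightarrow> 'a set \<Rightarrow> bool" where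
  "sigma_dispersed V U \<longleftrightarrow> (\<exists>A :: nat \<Rightarrow> 'a set. U \<subseteq> (\<Union>n. A n) \<and> (\<forall>n. dispersed V (A n)))"

lemma sigma_dispersed_mono: "sigma_dispersed V U \<Longrightarrow> U' \<subseteq> U \<Longrightarrow> sigma_dispersed V U'"
  unfolding sigma_dispersed_def by blast

lemma dispersed_finite: assumes "finite U" shows "dispersed V U"
  unfolding dispersed_def
proof (intro allI impI notI)
  fix r assume "lim V (\<lambda>_. U) r"
  then obtain i b where "b \<in> U" "reach (V - U) (r i) b" using limE[OF _ assms] by metis
  then show False using reach_in by blast
qed

lemma sigma_dispersed_range: "sigma_dispersed V (range (f :: nat \<Rightarrow> 'a))"
  unfolding sigma_dispersed_def
  by (rule exI[of _ "\<lambda>n. {f n}"]) (auto intro: dispersed_finite)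

lemma sigma_dispersed_Un:
  assumes "sigma_dispersed V U" "sigma_dispersed V U'" shows "sigma_dispersed V (U \<union> U')"
proof -
  obtain A A' :: "nat \<Rightarrow> 'a set" where A: "U \<subseteq> (\<Union>n. A n)" "\<And>n. dispersed V (A n)"
    "U' \<subseteq> (\<Union>n. A' n)" "\<And>n. dispersed V (A' n)"
    using assms unfolding sigma_dispersed_def by blast
  define F where "F n = (if even n then A (n div 2) else A' (n div 2))" for n
  have "A n \<subseteq> (\<Union>n. F n)" "A' n \<subseteq> (\<Union>n. F n)" for n
    using UN_upper[of "2 * n" UNIV F] UN_upper[of "Suc (2 * n)" UNIV F] by (auto simp: F_def)
  then have "(\<Union>n. A n) \<subseteq> (\<Union>n. F n)" "(\<Union>n. A' n) \<subseteq> (\<Union>n. F n)" by (simp_all only: UN_least)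
  then have "U \<union> U' \<subseteq> (\<Union>n. F n)" by (meson A(1,3) Un_least subset_trans)
  moreover have "dispersed V (F n)" for n using A by (simp add: F_def)
  ultimately show ?thesis unfolding sigma_dispersed_def by blast
qed

definition dst :: "'a set \<Rightarrow> 'a set \<Rightarrow> 'a \<Rightarrow> nat" where
  "dst S Z c = (LEAST n. \<exists>u\<in>S. (step Z ^^ n) c u)"

lemma dst_le: "u \<in> S \<Longrightarrow> (step Z ^^ n) c u \<Longrightarrow> dst S Z c \<le> n"
  unfolding dst_def by (rule Least_le) blast

lemma dst_walk: "u \<in> S \<Longrightarrow> (step Z ^^ n) c u \<Longrightarrow> \<exists>u\<in>S. (step Z ^^ dst S Z c) c u"
  unfolding dst_def by (rule LeastI) blast

lemma reach_walk: "reach Z a b \<Longrightarrow> \<exists>n. (step Z ^^ n) a b"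
  unfolding reach_def by (simp add: rtranclp_power)

lemma walk_reach: "(step Z ^^ n) a b \<Longrightarrow> a \<in> Z \<Longrightarrow> reach Z a b"
  unfolding reach_def by (auto simp: rtranclp_power)

lemma walk_mono: "(step Z ^^ n) a b \<Longrightarrow> Z \<subseteq> Z' \<Longrightarrow> (step Z' ^^ n) a b"
  by (erule relpowp_mono[rotated]) (auto simp: step_def)

lemma walk_comp: "(step Z ^^ n) c u \<Longrightarrow> c \<in> comp Z a \<Longrightarrow> (step (comp Z a) ^^ n) c u \<and> u \<in> comp Z a"
proof (induction n arbitrary: u)
  case (Suc n)
  then obtain v where v: "(step Z ^^ n) c v" "step Z v u" by auto
  have IH: "(step (comp Z a) ^^ n) c v" "v \<in> comp Z a" using Suc.IH[OF v(1) Suc.prems(2)] by auto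
  then have "u \<in> comp Z a" using v(2) comp_closed[of v Z a u] by (simp add: step_def)
  moreover from this have "step (comp Z a) v u" using v(2) by (simp add: step_def)
  ultimately show ?case using relpowp_Suc_I[OF IH(1)] by blast
qed simp

text \<open>A shortest walk to \<open>S\<close> never visits a vertex farther from \<open>S\<close>
  than its start. In particular, a shortest walk starting nearer than a given vertex avoids that
  vertex.\<close>

lemma dst_descending:
  assumes "u \<in> S" "(step Z ^^ n) c u" "dst S Z c = m"
  shows "\<exists>u\<in>S. (step {v \<in> Z. dst S Z v \<le> m} ^^ m) c u"
  using assms
proof (induction m arbitrary: c u n)
  case 0
  then show ?case using dst_walk[OF 0(1,2)] by auto
next
  case (Suc m)
  obtain u where u: "u \<in> S" "(step Z ^^ Suc m) c u" using dst_walk[OF Suc.prems(1,2)] Suc.prems(3) by auto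
  obtain c' where c': "step Z c c'" "(step Z ^^ m) c' u" using relpowp_Suc_D2[OF u(2)] by blast
  have "dst S Z c' \<le> m" by (rule dst_le[OF u(1) c'(2)])
  moreover obtain u' where u': "u' \<in> S" "(step Z ^^ dst S Z c') c' u'" using dst_walk[OF u(1) c'(2)] by blast
  have "Suc m \<le> Suc (dst S Z c')"
    using dst_le[OF u'(1) relpowp_Suc_I2[OF c'(1) u'(2)]] Suc.prems(3) by simp
  ultimately have m: "dst S Z c' = m" by simp
  obtain v where v: "v \<in> S" "(step {v \<in> Z. dst S Z v \<le> m} ^^ m) c' v" using Suc.IH[OF u(1) c'(2) m] by blast
  have "(step {v \<in> Z. dst S Z v \<le> Suc m} ^^ m) c' v" by (rule walk_mono[OF v(2)]) auto
  moreover have "step {v \<in> Z. dst S Z v \<le> Suc m} c c'" using c'(1) m by (simp add: step_def)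
  ultimately have "(step {v \<in> Z. dst S Z v \<le> Suc m} ^^ Suc m) c v" using relpowp_Suc_I2[of "step {v \<in> Z. dst S Z v \<le> Suc m}" c c' m v] by blast
  then show ?case using v(1) by blast
qed

text \<open>In each new component \<open>Z\<close> hanging off the node \<open>x\<close>, pick a neighbour of \<open>x\<close> nearest to
  the first set \<open>A j\<close> that meets \<open>Z\<close>.\<close>

definition target :: "(nat \<Rightarrow> 'a set) \<Rightarrow> 'a set \<Rightarrow> 'a set" where
  "target A Z = A (LEAST j. A j \<inter> Z \<noteq> {}) \<inter> Z"

definition choice :: "(nat \<Rightarrow> 'a set) \<Rightarrow> 'a set \<Rightarrow> 'a \<Rightarrow> 'a" where
  "choice A Z x = arg_min (dst (target A Z) Z) (\<lambda>c. c \<in> Z \<and> E x c)"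

primrec stage :: "'a set \<Rightarrow> 'a \<Rightarrow> (nat \<Rightarrow> 'a set) \<Rightarrow> nat \<Rightarrow> 'a \<Rightarrow> 'a set \<times> 'a" where
  "stage W a A 0 w = (W, a)"
| "stage W a A (Suc k) w =
     (let Z = comp (fst (stage W a A k w) - {snd (stage W a A k w)}) w in (Z, choice A Z (snd (stage W a A k w))))"

lemma choice_props:
  assumes "c \<in> Z" "E x c"
  shows "choice A Z x \<in> Z" "E x (choice A Z x)" "dst (target A Z) Z (choice A Z x) \<le> dst (target A Z) Z c"
  using arg_min_nat_lemma[of "\<lambda>c. c \<in> Z \<and> E x c" c "dst (target A Z) Z"] assms by (auto simp: choice_def)

lemma stage_normal_structure:
  assumes W: "conn W" and a: "a \<in> W"
  shows "normal_structure E W (\<lambda>k w. fst (stage W a A k w)) (\<lambda>k w. snd (stage W a A k w))"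
proof -
  define C where "C k w = fst (stage W a A k w)" for k w
  define t where "t k w = snd (stage W a A k w)" for k w
  have C0: "C 0 w = W" and t0: "t 0 w = a" for w by (auto simp: C_def t_def)
  have CS: "C (Suc k) w = comp (C k w - {t k w}) w" and tS: "t (Suc k) w = choice A (C (Suc k) w) (t k w)" for k w
    by (auto simp: C_def t_def Let_def)
  have sub: "C (Suc k) w \<subseteq> C k w" for k w using CS comp_subset by blast
  \<comment> \<open>Connectedness of the old component gives the deleted node a neighbour in the new
    one, so \<open>choice\<close> selects from a nonempty set.\<close>
  have nb: "\<exists>c. c \<in> C (Suc k) w \<and> E (t k w) c" if "w \<in> C (Suc k) w" "conn (C k w)" "t k w \<in> C k w" for k w
  proof -
    have "w \<in> C k w" using that(1) sub by blast
    then have "reach (C k w) w (t k w)" using that(2,3) by (simp add: conn_def)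
    moreover have "w \<noteq> t k w" using that(1) comp_subset unfolding CS by blast
    ultimately obtain u v where uv: "reach (C k w \<inter> - {t k w}) w u" "E u v" "v \<in> C k w - (- {t k w})"
      using reach_exit[of "C k w" w "t k w" "- {t k w}"] by blast
    have "reach (C k w - {t k w}) w u" by (rule reach_mono[OF uv(1)]) blast
    then show ?thesis using uv(2,3) E_sym unfolding CS comp_def by blast
  qed
  have main: "conn (C k w) \<and> t k w \<in> C k w" if "w \<in> W" "w \<in> C k w" for k w
    using that
  proof (induction k)
    case 0 then show ?case using W a by (simp add: C0 t0)
  next
    case (Suc k)
    then have "conn (C k w) \<and> t k w \<in> C k w" using sub by blast
    then obtain c where "c \<in> C (Suc k) w" "E (t k w) c" using nb Suc.prems by blast
    then have "t (Suc k) w \<in> C (Suc k) w" unfolding tS by (rule choice_props)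
    moreover have "conn (C (Suc k) w)"
      using conn_comp[of w "C k w - {t k w}"] Suc.prems(2) comp_subset unfolding CS by blast
    ultimately show ?case by blast
  qed
  have cong: "v \<in> C k w \<Longrightarrow> stage W a A k v = stage W a A k w" for k v w
  proof (induction k)
    case (Suc k)
    then have e: "stage W a A k v = stage W a A k w" using sub by blast
    have "comp (C k w - {t k w}) v = comp (C k w - {t k w}) w" using Suc.prems comp_eq unfolding CS by blast
    then show ?case by (simp add: e C_def t_def Let_def)
  qed simp
  have "normal_structure E W C t"
  proof
    show "t k v = t k w" if "w \<in> W" "v \<in> C k w" for w k v using cong[OF that(2)] by (simp add: t_def)
    show "E (t k w) (t (Suc k) w)" if w: "w \<in> W" "w \<in> C (Suc k) w" for w k
    proof -
      have "conn (C k w)" "t k w \<in> C k w" using main[OF w(1)] w(2) sub by auto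
      then obtain c where "c \<in> C (Suc k) w" "E (t k w) c" using nb[OF w(2)] by blast
      then show ?thesis unfolding tS by (rule choice_props)
    qed
  qed (use W C0 CS main in auto)
  then show ?thesis unfolding C_def[abs_def] t_def[abs_def] .
qed

text \<open>If some vertex of \<open>U\<close> never became a node, its branch would eventually aim
  at one fixed \<open>A j\<close>. Nodes cannot come closer to \<open>A j\<close> forever, and each
  failure to do so yields a connection to \<open>A j\<close> inside a discarded part. Infinitely
  many such connections put the branch into the closure of \<open>A j\<close>, although
  \<open>A j\<close> is dispersed.\<close>

lemma normal_structure_exists:
  assumes W: "conn W" and a: "a \<in> W" and WV: "W \<subseteq> V" and U: "sigma_dispersed V U"
  shows "\<exists>C t. normal_structure E W C t \<and> (\<forall>w. t 0 w = a) \<and> U \<inter> W \<subseteq> normal_structure.T W C t"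
proof -
  obtain A :: "nat \<Rightarrow> 'a set" where A: "U \<subseteq> (\<Union>n. A n)" "\<And>n. dispersed V (A n)"
    using U unfolding sigma_dispersed_def by blast
  define C where "C k w = fst (stage W a A k w)" for k w
  define t where "t k w = snd (stage W a A k w)" for k w
  have tS: "t (Suc k) w = choice A (C (Suc k) w) (t k w)" for k w
    by (auto simp: C_def t_def Let_def)
  have ns: "normal_structure E W C t"
    using stage_normal_structure[OF W a] unfolding C_def[abs_def] t_def[abs_def] .
  interpret normal_structure E W C t by (rule ns)
  have "U \<inter> W \<subseteq> T"
  proof
    fix w assume "w \<in> U \<inter> W"
    then obtain i where w: "w \<in> A i" "w \<in> W" using A by blast
    show "w \<in> T"
    proof (rule ccontr)
      assume nT: "w \<notin> T"
      note br = branch_of_vertex[OF w(2) nT] and wC = notT_C[OF w(2) nT]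
      have nT': "t k w \<in> C k w" for k using t_in w wC by blast
      \<comment> \<open>The least index of a set meeting the component grows with \<open>k\<close>
        and is bounded by \<open>i\<close>, so it is eventually constant.\<close>
      define J where "J k = (LEAST j. A j \<inter> C k w \<noteq> {})" for k
      have J1: "A (J k) \<inter> C k w \<noteq> {}" and J2: "J k \<le> i" for k
        unfolding J_def using w(1) wC[of k] LeastI[of "\<lambda>j. A j \<inter> C k w \<noteq> {}" i] Least_le[of "\<lambda>j. A j \<inter> C k w \<noteq> {}" i]
        by blast+
      have J3: "J k \<le> J m" if "k \<le> m" for k m
        unfolding J_def[of k] using J1[of m] C_mono[OF w(2) that] by (intro Least_le) blast
      have "finite (range J)" using J2 by (auto intro: finite_subset[of _ "{..i}"])
      then obtain k0 where "J k0 = Max (range J)" using Max_in[of "range J"] by (metis UNIV_not_empty image_is_empty imageE)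
      then have k0: "J k \<le> J k0" for k using Max_ge[OF \<open>finite (range J)\<close>, of "J k"] by simp
      define j where "j = J k0"
      have Jj: "J k = j" if "k \<ge> k0" for k using J3[OF that] k0[of k] by (simp add: j_def)
      have tg: "target A (C k w) = A j \<inter> C k w" if "k \<ge> k0" for k
        using Jj[OF that] by (simp add: target_def J_def)
      define d where "d k = dst (target A (C k w)) (C k w) (t k w)" for k
      \<comment> \<open>The node reaches \<open>A j\<close> within the part that step
        \<open>k\<close> discards.\<close>
      define bad where "bad k \<longleftrightarrow> (\<exists>u\<in>A j. reach (C k w - C (Suc k) w) (t k w) u)" for k
      have dec: "d (Suc k) < d k" if k: "k \<ge> k0" and nb: "\<not> bad k" for k
      proof -
        let ?Z = "C k w" and ?x = "t k w" and ?S = "A j \<inter> C k w"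
        have xn: "?x \<in> ?Z - C (Suc k) w" using nT' C_Suc_subset[OF w(2)] by blast
        obtain u0 where u0: "u0 \<in> ?S" using J1[of k] Jj[OF k] by blast
        then have "reach ?Z ?x u0" using C_conn[OF w(2) wC] nT' by (auto simp: conn_def)
        then obtain n where n: "(step ?Z ^^ n) ?x u0" using reach_walk by blast
        have dk: "d k = dst ?S ?Z ?x" by (simp add: d_def tg[OF k])
        obtain u where u: "u \<in> ?S" "(step ?Z ^^ d k) ?x u" using dst_walk[OF u0 n] dk by auto
        have "d k \<noteq> 0"
        proof
          assume "d k = 0"
          then have "?x \<in> A j" using u by simp
          then show False using nb xn reach_refl unfolding bad_def by blast
        qed
        then obtain m where m: "d k = Suc m" using not0_implies_Suc by blast
        obtain c where c: "step ?Z ?x c" "(step ?Z ^^ m) c u" using relpowp_Suc_D2 u(2) m by metis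
        have cm: "dst ?S ?Z c \<le> m" by (rule dst_le[OF u(1) c(2)])
        obtain v where v: "v \<in> ?S" "(step {v \<in> ?Z. dst ?S ?Z v \<le> dst ?S ?Z c} ^^ dst ?S ?Z c) c v"
          using dst_descending[OF u(1) c(2) refl] by blast
        have walk: "(step (?Z - {?x}) ^^ dst ?S ?Z c) c v"
          by (rule walk_mono[OF v(2)]) (use cm m dk in auto)
        have cZ: "c \<in> ?Z - {?x}" using c(1) cm m dk by (auto simp: step_def)
        have cS: "C (Suc k) w = comp (?Z - {?x}) w" by (rule C_Suc[OF w(2)])
        \<comment> \<open>The second vertex \<open>c\<close> of a shortest walk to
          \<open>A j\<close> either competes for the next node, which is then at least as near as
          \<open>c\<close>, or lies in a discarded component, which makes \<open>k\<close>
          bad.\<close>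
        show ?thesis
        proof (cases "c \<in> C (Suc k) w")
          case True
          then have wk: "(step (C (Suc k) w) ^^ dst ?S ?Z c) c v" "v \<in> C (Suc k) w"
            using walk_comp[OF walk] cS by auto
          have tgS: "target A (C (Suc k) w) = A j \<inter> C (Suc k) w" using tg k by simp
          have "v \<in> target A (C (Suc k) w)" using v(1) wk(2) tgS by blast
          then have "dst (target A (C (Suc k) w)) (C (Suc k) w) c \<le> dst ?S ?Z c" using dst_le wk(1) by blast
          moreover have "d (Suc k) \<le> dst (target A (C (Suc k) w)) (C (Suc k) w) c"
            unfolding d_def tS by (rule choice_props(3)[OF True]) (use c in \<open>simp add: step_def\<close>)
          ultimately show ?thesis using cm m by linarith
        next
          case False
          have "reach (comp (?Z - {?x}) c) c v" by (rule reach_comp[OF walk_reach[OF walk cZ]])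
          moreover have "comp (?Z - {?x}) c \<subseteq> ?Z - C (Suc k) w"
          proof
            fix y assume y: "y \<in> comp (?Z - {?x}) c"
            have "y \<notin> comp (?Z - {?x}) w"
            proof
              assume "y \<in> comp (?Z - {?x}) w"
              then have "comp (?Z - {?x}) c = comp (?Z - {?x}) w" using comp_eq[OF y] comp_eq by metis
              then show False using comp_self[OF cZ] False cS by simp
            qed
            then show "y \<in> ?Z - C (Suc k) w" using y comp_subset cS by fast
          qed
          ultimately have cv: "reach (?Z - C (Suc k) w) c v" using reach_mono by blast
          have "reach (?Z - C (Suc k) w) ?x c"
            by (rule reach_edge[OF xn]) (use c cv reach_in in \<open>auto simp: step_def\<close>)
          then show ?thesis using nb v(1) cv reach_trans unfolding bad_def by blast
        qed
      qed
      have inf_bad: "\<exists>k\<ge>n. bad k" for n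
      proof (rule ccontr)
        assume no: "\<not> ?thesis"
        let ?N = "max n k0"
        have "d (?N + i) + i \<le> d ?N" for i
        proof (induction i)
          case (Suc i)
          have "d (Suc (?N + i)) < d (?N + i)" by (rule dec) (use no in auto)
          then show ?case using Suc by simp
        qed simp
        from this[of "Suc (d ?N)"] show False by simp
      qed
      let ?R = "\<lambda>k. t k w"
      have "is_ray V ?R" using ray_mono[OF normal_ray_is_ray[OF br(1)] WV] .
      then have "\<not> lim V (\<lambda>_. A j) ?R" using A(2) unfolding dispersed_def by blast
      then obtain X n where X: "finite X" "\<forall>i\<ge>n. \<forall>b\<in>A j. \<not> reach (V - X) (t i w) b" by (rule not_limE)
      \<comment> \<open>The components decrease, so their successive differences are disjoint and
        each vertex of \<open>X\<close> lies in at most one of them.\<close>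
      have "\<exists>K. \<forall>k\<ge>K. X \<inter> (C k w - C (Suc k) w) = {}" using X(1)
      proof induction
        case (insert x X)
        then obtain K where K: "\<forall>k\<ge>K. X \<inter> (C k w - C (Suc k) w) = {}" by blast
        have "\<exists>K'. \<forall>k\<ge>K'. x \<notin> C k w - C (Suc k) w"
        proof (cases "\<exists>k. x \<notin> C k w")
          case True then show ?thesis using C_mono[OF w(2)] by blast
        qed auto
        then obtain K' where "\<forall>k\<ge>K'. x \<notin> C k w - C (Suc k) w" ..
        then show ?case using K by (intro exI[of _ "max K K'"]) auto
      qed simp
      then obtain K where K: "\<forall>k\<ge>K. X \<inter> (C k w - C (Suc k) w) = {}" ..
      obtain k where k: "k \<ge> max K n" "bad k" using inf_bad by blast
      then obtain u where u: "u \<in> A j" "reach (C k w - C (Suc k) w) (t k w) u" unfolding bad_def by blast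
      have "C k w - C (Suc k) w \<subseteq> V - X" using K k(1) C_subset[OF w(2), of k] WV by auto
      then show False using X(2) u reach_mono k(1) by (meson max.boundedE)
    qed
  qed
  moreover have "\<forall>w. t 0 w = a" by (simp add: t_def)
  ultimately show ?thesis using ns by blast
qed

end

section \<open>The induction step: rays to be destroyed\<close>

text \<open>\<open>IH\<close> allows a countable addition \<open>F\<close> and an arbitrary antitone
  sequence because it is used twice: on a component alone with an enlarged sequence, and on a
  component together with the tail of a killed ray.\<close>

locale induction_step = normal_structure E W C t
  for E :: "'a \<Rightarrow> 'a \<Rightarrow> bool" and W :: "'a set" and C :: "nat \<Rightarrow> 'a \<Rightarrow> 'a set" and t :: "nat \<Rightarrow> 'a \<Rightarrow> 'a" +
  fixes B :: "nat \<Rightarrow> 'a set"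
  assumes B_anti: "antimono B"
    and root: "w \<in> W \<Longrightarrow> t 0 w \<in> B 0"
    and IH: "\<And>d (f :: nat \<Rightarrow> 'a) F B' b. d \<in> W \<Longrightarrow> d \<notin> T \<Longrightarrow> F \<subseteq> range f \<Longrightarrow> F \<subseteq> W \<Longrightarrow>
      conn (comp (W - T) d \<union> F) \<Longrightarrow> antimono B' \<Longrightarrow> b \<in> B' 0 \<Longrightarrow> b \<in> comp (W - T) d \<union> F \<Longrightarrow>
      \<exists>p. good (comp (W - T) d \<union> F) B' p"
begin

abbreviation K :: "'a \<Rightarrow> 'a set" where "K d \<equiv> comp (W - T) d"

abbreviation cone :: "(nat \<Rightarrow> 'a) \<Rightarrow> nat \<Rightarrow> 'a set" where "cone R k \<equiv> C k (R k)"

text \<open>Killed rays are the normal rays whose end must not be represented.  If all killed rays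
  through some node of a killed ray \<open>R\<close> use only finitely many pieces, then \<open>R\<close> itself is the
  only one; its tail is rebuilt, together with one component \<open>K (pd R)\<close> converging to it, by
  the induction hypothesis for \<open>Z R\<close>.\<close>

definition killed :: "(nat \<Rightarrow> 'a) \<Rightarrow> bool" where
  "killed R \<longleftrightarrow> normal_ray R \<and> lim W B R"

definition poor :: "(nat \<Rightarrow> 'a) \<Rightarrow> bool" where
  "poor R \<longleftrightarrow> killed R \<and> (\<exists>n. finite (piece ` (B n \<inter> cone R n)))"

lemma killedD: "killed R \<Longrightarrow> normal_ray R" "poor R \<Longrightarrow> killed R" "poor R \<Longrightarrow> normal_ray R"
  by (auto simp: killed_def poor_def)

lemma B_le: "m \<le> n \<Longrightarrow> B n \<subseteq> B m"
  by (rule antimonoD[OF B_anti])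

lemma T_in_W: "x \<in> T \<Longrightarrow> x \<in> W" using T_W by blast

lemma killed_meets: assumes "killed R" shows "B n \<inter> cone R k \<noteq> {}"
proof -
  have R: "normal_ray R" "lim W B R" using assms by (auto simp: killed_def)
  have "finite (R ` {..<k})" by simp
  then obtain i b where ib: "i \<ge> max n k" "b \<in> B (max n k)" "reach (W - R ` {..<k}) (R i) b"
    using limE[OF R(2)] by metis
  have "R i \<in> cone R k" using normal_rayD(6)[OF R(1)] ib(1) by simp
  then have "b \<in> cone R k" using normal_ray_sep[OF R(1) ib(3)] by simp
  then show ?thesis using ib(2) B_le[of n "max n k"] by auto
qed

text \<open>Each of the finitely many pieces that does not lie in all cones drops out at some
  height; beyond the largest of these heights only deep pieces remain.\<close>

lemma finite_pieces_deep:
  assumes R: "normal_ray R" and fin: "finite (piece ` (B n \<inter> cone R n))"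
  shows "\<exists>m\<ge>n. \<forall>b\<in>B m \<inter> cone R m. \<forall>k. b \<in> cone R k"
proof -
  \<comment> \<open>For a piece contained in all cones this value is arbitrary, and can only enlarge
    \<open>m\<close>.\<close>
  define kf where "kf P = (SOME k. \<exists>b\<in>P. b \<notin> cone R k)" for P
  let ?F = "piece ` (B n \<inter> cone R n)"
  define m where "m = Max (insert n (kf ` ?F))"
  have m: "n \<le> m" "\<And>P. P \<in> ?F \<Longrightarrow> kf P \<le> m" using fin by (auto simp: m_def)
  have "b \<in> cone R k" if b: "b \<in> B m" "b \<in> cone R m" for b k
  proof (rule ccontr)
    assume nb: "b \<notin> cone R k"
    have bW: "b \<in> W" using b(2) C_subset normal_rayD(1)[OF R] by blast
    have F: "piece b \<in> ?F" using b B_le[OF m(1)] normal_ray_C_mono[OF R m(1)] by blast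
    have "\<exists>k. \<exists>b\<in>piece b. b \<notin> cone R k" using nb piece_self[OF bW] by blast
    then have "\<exists>a\<in>piece b. a \<notin> cone R (kf (piece b))" unfolding kf_def by (rule someI_ex)
    then obtain a where a: "a \<in> piece b" "a \<notin> cone R (kf (piece b))" by blast
    have "b \<in> cone R (kf (piece b))" using b(2) normal_ray_C_mono[OF R m(2)[OF F]] by blast
    then show False using a piece_C[OF bW normal_rayD(1)[OF R]] by blast
  qed
  then show ?thesis using m(1) by blast
qed

lemma deep_notT: assumes "normal_ray R" "\<And>k. b \<in> cone R k" shows "b \<in> W" "b \<notin> T" "t k b = R k"
proof -
  show "b \<in> W" "t k b = R k" using normal_ray_C_eq[OF assms] by auto
  show "b \<notin> T" using normal_ray_C_eq[OF assms, of "Suc (h b)"] T_C_iff[of b "Suc (h b)"] by auto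
qed

definition witness :: "(nat \<Rightarrow> 'a) \<Rightarrow> nat \<times> 'a \<Rightarrow> bool" where
  "witness R x \<longleftrightarrow> (case x of (m, d) \<Rightarrow> d \<in> W \<and> d \<notin> T \<and> (\<forall>k. t k d = R k) \<and>
     (\<forall>b\<in>B m \<inter> cone R m. \<forall>k. b \<in> cone R k) \<and> lim (K d \<union> R ` {m..}) B R)"

text \<open>Pigeonhole over finitely many pieces: if no single piece, joined to the tail of
  \<open>R\<close>, kept \<open>R\<close> in the closures, the finitely many separators together
  would separate \<open>R\<close> from some \<open>B N\<close> in \<open>W\<close>.\<close>

lemma poor_witness: assumes "poor R" shows "\<exists>x. witness R x"
proof -
  have R: "normal_ray R" "lim W B R" using assms by (auto simp: poor_def killed_def)
  obtain n where n: "finite (piece ` (B n \<inter> cone R n))" using assms by (auto simp: poor_def)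
  obtain m where m: "m \<ge> n" and deep: "\<And>b k. b \<in> B m \<Longrightarrow> b \<in> cone R m \<Longrightarrow> b \<in> cone R k"
    using finite_pieces_deep[OF R(1) n] by blast
  let ?F = "piece ` (B m \<inter> cone R m)"
  have finF: "finite ?F"
    by (rule finite_subset[OF _ n]) (use B_le[OF m] normal_ray_C_mono[OF R(1) m] in blast)
  have "\<exists>P\<in>?F. lim (P \<union> R ` {m..}) B R"
  proof (rule ccontr)
    assume "\<not> ?thesis"
    then have "\<forall>P\<in>?F. \<exists>Xn. finite (fst Xn) \<and> (\<forall>i\<ge>snd Xn. \<forall>b\<in>B (snd Xn). \<not> reach (P \<union> R ` {m..} - fst Xn) (R i) b)"
      unfolding lim_def by fastforce
    then obtain g where g: "\<And>P. P \<in> ?F \<Longrightarrow> finite (fst (g P))"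
      "\<And>P i b. P \<in> ?F \<Longrightarrow> i \<ge> snd (g P) \<Longrightarrow> b \<in> B (snd (g P)) \<Longrightarrow> \<not> reach (P \<union> R ` {m..} - fst (g P)) (R i) b"
      by metis
    define N where "N = Max (insert m (snd ` g ` ?F))"
    have N: "m \<le> N" "\<And>P. P \<in> ?F \<Longrightarrow> snd (g P) \<le> N" using finF by (auto simp: N_def)
    \<comment> \<open>The first \<open>N\<close> nodes are deleted too, so that a walk leaving the
      component of \<open>b\<close> enters the ray at height at least \<open>N\<close>, hence in its
      tail.\<close>
    define X where "X = (\<Union>P\<in>?F. fst (g P)) \<union> R ` {..<N}"
    have "finite X" unfolding X_def using finF g(1) by (intro finite_UnI finite_UN_I) auto
    then obtain i b where ib: "i \<ge> N" "b \<in> B N" "reach (W - X) (R i) b" using limE[OF R(2)] by metis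
    have "b \<in> cone R N" by (rule normal_ray_sep[OF R(1) ib(3)]) (use ib(1) normal_rayD(6)[OF R(1)] in \<open>auto simp: X_def\<close>)
    then have b: "b \<in> B m" "b \<in> cone R m" using ib(2) B_le[OF N(1)] normal_ray_C_mono[OF R(1) N(1)] by auto
    note bT = deep_notT[OF R(1) deep[OF b]]
    have P: "piece b \<in> ?F" using b by blast
    have pK: "piece b = K b" using bT by (simp add: piece_def)
    have "R i \<notin> K b" using comp_branch(5)[OF bT(1,2)] normal_rayD(2)[OF R(1)] by blast
    then obtain u v where uv: "reach ((W - X) \<inter> K b) b u" "E u v" "v \<in> (W - X) - K b"
      using reach_exit[OF reach_sym[OF ib(3)], of "K b"] comp_self bT by blast
    have uK: "u \<in> K b" using uv(1) reach_in by blast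
    have vT: "v \<in> T" using comp_closed[OF uK uv(2)] uv(3) by blast
    have v: "R (h v) = v" using nbr_T[OF _ _ vT uv(2)] comp_branch[OF bT(1,2) uK] bT(3) by simp
    have hv: "h v \<ge> N" using uv(3) v unfolding X_def by (metis DiffE DiffD2 UnCI imageI lessThan_iff not_le)
    let ?Z = "piece b \<union> R ` {m..} - fst (g (piece b))"
    have "R (h v) \<in> R ` {m..}" using hv N(1) by simp
    then have vR: "v \<in> R ` {m..}" using v by simp
    have sX: "fst (g (piece b)) \<subseteq> X" using P unfolding X_def by blast
    have "reach ?Z b u" by (rule reach_mono[OF uv(1)]) (use sX pK in blast)
    moreover have "v \<in> ?Z" using vR sX uv(3) by blast
    ultimately have "reach ?Z (R (h v)) b" using reach_step[OF _ uv(2)] v reach_sym by metis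
    moreover have "b \<in> B (snd (g (piece b)))" using ib(2) B_le[OF N(2)[OF P]] by blast
    ultimately show False using g(2)[OF P] hv N(2)[OF P] by (meson order_trans)
  qed
  then obtain b where b: "b \<in> B m" "b \<in> cone R m" "lim (piece b \<union> R ` {m..}) B R" by blast
  note bT = deep_notT[OF R(1) deep[OF b(1,2)]]
  have "witness R (m, b)" unfolding witness_def using bT b deep by (simp add: piece_def)
  then show ?thesis ..
qed

text \<open>\<open>pm R\<close> is the height at which the rebuilt tail begins; \<open>pd R\<close>
  below is a vertex of the component joined to it.\<close>

definition pm :: "(nat \<Rightarrow> 'a) \<Rightarrow> nat" where "pm R = fst (SOME x. witness R x)"
definition pd :: "(nat \<Rightarrow> 'a) \<Rightarrow> 'a" where "pd R = snd (SOME x. witness R x)"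
definition Z :: "(nat \<Rightarrow> 'a) \<Rightarrow> 'a set" where "Z R = K (pd R) \<union> R ` {pm R..}"

lemma poorD:
  assumes "poor R"
  shows "pd R \<in> W" "pd R \<notin> T" "t k (pd R) = R k" "b \<in> B (pm R) \<Longrightarrow> b \<in> cone R (pm R) \<Longrightarrow> b \<in> cone R k"
    "lim (Z R) B R"
proof -
  have "witness R (pm R, pd R)" unfolding pm_def pd_def using someI_ex[OF poor_witness[OF assms]] by simp
  then show "pd R \<in> W" "pd R \<notin> T" "t k (pd R) = R k" "lim (Z R) B R"
    "b \<in> B (pm R) \<Longrightarrow> b \<in> cone R (pm R) \<Longrightarrow> b \<in> cone R k"
    unfolding witness_def Z_def by auto
qed

text \<open>A killed ray through \<open>R m\<close> meets \<open>B m\<close> in arbitrarily high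
  cones of its own. Such vertices lie in all cones of \<open>R\<close>, so both rays have the same
  nodes.\<close>

lemma deep_isolates:
  assumes R: "normal_ray R" and deep: "\<And>b k. b \<in> B m \<Longrightarrow> b \<in> cone R m \<Longrightarrow> b \<in> cone R k"
    and S: "killed S" "S m = R m"
  shows "S = R"
proof
  fix j
  have Sn: "normal_ray S" using S killedD by blast
  have jm: "j \<le> max j m" "m \<le> max j m" by auto
  obtain b where b: "b \<in> B m" "b \<in> cone S (max j m)" using killed_meets[OF S(1)] by blast
  have bm: "b \<in> cone S m" "b \<in> cone S j" using b normal_ray_C_mono[OF Sn] jm by blast+
  then have "b \<in> cone R j" using deep[OF b(1)] S(2) by simp
  then show "S j = R j" using bm normal_ray_C_eq[OF Sn bm(2)] normal_ray_C_eq[OF R] by metis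
qed

lemma isolated: "poor R \<Longrightarrow> killed S \<Longrightarrow> S (pm R) = R (pm R) \<Longrightarrow> S = R"
  by (rule deep_isolates[OF killedD(3)]) (use poorD in blast)+

lemma Z_T: assumes "poor R" shows "x \<in> Z R \<Longrightarrow> x \<in> T \<Longrightarrow> h x \<ge> pm R \<and> x = R (h x)"
  using comp_branch(5)[OF poorD(1,2)[OF assms]] normal_rayD(3)[OF killedD(3)[OF assms]] by (auto simp: Z_def)

lemma Z_notT: assumes "poor R" shows "x \<in> Z R \<Longrightarrow> x \<notin> T \<Longrightarrow> K x = K (pd R) \<and> (\<forall>k. t k x = R k)"
  using comp_branch(3)[OF poorD(1,2)[OF assms]] poorD(3)[OF assms] comp_eq normal_rayD(2)[OF killedD(3)[OF assms]]
  by (auto simp: Z_def)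

lemma Z_W: assumes "poor R" shows "Z R \<subseteq> W"
  using comp_subset[of "W - T" "pd R"] normal_rayD(1)[OF killedD(3)[OF assms]] by (auto simp: Z_def)

lemma KZ: "K (pd R) \<subseteq> Z R" by (auto simp: Z_def)

lemma tail_Z: "pm R \<le> k \<Longrightarrow> R k \<in> Z R" by (auto simp: Z_def)

lemma Z_disjoint: assumes "poor R" "poor S" "x \<in> Z R" "x \<in> Z S" shows "R = S"
proof (cases "x \<in> T")
  case True
  have x: "pm R \<le> h x" "R (h x) = S (h x)" using Z_T[OF assms(1,3) True] Z_T[OF assms(2,4) True] by auto
  have "R (pm R) = S (pm R)" using normal_ray_share(2)[OF killedD(3)[OF assms(1)] killedD(3)[OF assms(2)] x(2) x(1)] .
  then show ?thesis using isolated[OF assms(1) killedD(2)[OF assms(2)]] by simp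
next
  case False
  then show ?thesis using Z_notT[OF assms(1,3)] Z_notT[OF assms(2,4)] by (metis ext)
qed

text \<open>A vertex \<open>b\<close> witnessing the limit lies in all cones of \<open>R\<close> if
  it is a node, which is impossible; so it lies in the component, and a walk from it to
  \<open>R\<close> provides the edge joining component and tail.\<close>

lemma Z_conn: assumes p: "poor R" shows "conn (Z R)" "\<exists>b\<in>B 0. b \<in> Z R"
proof -
  have R: "normal_ray R" by (rule killedD(3)[OF p])
  obtain i b where ib: "b \<in> B (pm R)" "reach (Z R - {}) (R i) b" using limE[OF poorD(5)[OF p] finite.emptyI] by metis
  then have bZ: "b \<in> Z R" "R i \<in> Z R" using reach_in[OF ib(2)] by auto
  then show "\<exists>b\<in>B 0. b \<in> Z R" using ib(1) B_le[of 0 "pm R"] by auto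
  have bT: "b \<notin> T"
  proof
    assume bT: "b \<in> T"
    then have b: "pm R \<le> h b" "b = R (h b)" using Z_T[OF p bZ(1)] by auto
    have "b \<in> cone R (pm R)" using normal_rayD(6)[OF R b(1)] b(2) by simp
    then have "b \<in> cone R (Suc (h b))" using poorD(4)[OF p ib(1)] by blast
    then have "b \<in> C (Suc (h b)) b" using normal_ray_C_eq[OF R] by blast
    then show False using T_C_iff[OF bT] by simp
  qed
  then have bK: "b \<in> K (pd R)" using bZ(1) normal_rayD(2)[OF R] by (auto simp: Z_def)
  have "R i \<notin> K (pd R)" using comp_branch(5)[OF poorD(1,2)[OF p]] normal_rayD(2)[OF R] by blast
  then obtain u v where uv: "reach ((Z R - {}) \<inter> K (pd R)) b u" "E u v" "v \<in> Z R - {} - K (pd R)"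
    using reach_exit[OF reach_sym[OF ib(2)] bK] by blast
  have "u \<in> K (pd R)" using reach_in[OF uv(1)] by blast
  moreover have "v \<in> R ` {pm R..}" using uv(3) by (auto simp: Z_def)
  moreover have "conn (R ` {pm R..})"
  proof (rule connI)
    show "R (pm R) \<in> R ` {pm R..}" by simp
    show "reach (R ` {pm R..}) (R (pm R)) w" if "w \<in> R ` {pm R..}" for w
    proof -
      from that have "\<exists>k. k \<ge> pm R \<and> w = R k" by auto
      then obtain k where k: "k \<ge> pm R" "w = R k" by blast
      show ?thesis unfolding k(2)
        by (rule chain_reach[of "pm R"]) (use k(1) normal_ray_edge[OF R] in auto)
    qed
  qed
  moreover have "conn (K (pd R))" by (rule conn_comp) (use poorD[OF p] in blast)
  ultimately show "conn (Z R)" unfolding Z_def using conn_union uv(2) by blast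
qed

definition pZ :: "(nat \<Rightarrow> 'a) \<Rightarrow> 'a \<Rightarrow> 'a option" where "pZ R = (SOME p. good (Z R) B p)"

lemma pZ_good: assumes "poor R" shows "good (Z R) B (pZ R)"
proof -
  obtain b where b: "b \<in> B 0" "b \<in> Z R" using Z_conn(2)[OF assms] by blast
  have "\<exists>p. good (Z R) B p" unfolding Z_def
  proof (rule IH[OF poorD(1,2)[OF assms], of "R ` {pm R..}" R B b])
    show "R ` {pm R..} \<subseteq> W" using normal_rayD(1)[OF killedD(3)[OF assms]] by blast
  qed (use Z_conn(1)[OF assms] b B_anti in \<open>auto simp: Z_def\<close>)
  then show ?thesis unfolding pZ_def by (rule someI_ex)
qed

section \<open>Nodes of killed rays and their private pieces\<close>

definition Zall :: "'a set" where "Zall = (\<Union>R\<in>{R. poor R}. Z R)"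

definition killed_nodes :: "'a set" where "killed_nodes = {R k | R k. killed R}"

definition below_poor :: "'a \<Rightarrow> bool" where
  "below_poor x \<longleftrightarrow> (\<exists>R. poor R \<and> h x < pm R \<and> R (h x) = x)"

text \<open>Every rich node has infinitely many pieces above it, so it can be connected to \<open>B 0\<close>
  through a piece of its own.\<close>

definition rich :: "'a set" where
  "rich = {x \<in> killed_nodes. x \<notin> Zall \<and> \<not> below_poor x}"

lemma killed_nodesD: assumes "x \<in> killed_nodes" shows "\<exists>R. killed R \<and> x = R (h x)" "x \<in> T"
  using assms normal_rayD(2,3) killedD(1) by (auto simp: killed_nodes_def)

lemma richD: "x \<in> rich \<Longrightarrow> x \<in> killed_nodes" "x \<in> rich \<Longrightarrow> x \<in> T" "x \<in> rich \<Longrightarrow> x \<in> W"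
  using killed_nodesD(2) T_in_W by (auto simp: rich_def)

lemma rich_infinite: assumes "x \<in> rich" shows "infinite (piece ` (B 0 \<inter> C (h x) x))"
proof
  assume fin: "finite (piece ` (B 0 \<inter> C (h x) x))"
  obtain R where R: "killed R" "x = R (h x)" using killed_nodesD(1) assms by (auto simp: rich_def)
  have "piece ` (B (h x) \<inter> cone R (h x)) \<subseteq> piece ` (B 0 \<inter> C (h x) x)" using R(2) B_le[of 0 "h x"] by auto
  then have "poor R" unfolding poor_def using R(1) finite_subset[OF _ fin] by blast
  then show False using assms R(2) tail_Z[of R "h x"] unfolding rich_def below_poor_def Zall_def
    by (metis (mono_tags, lifting) UN_I mem_Collect_eq not_le)
qed

text \<open>Recursion on height: below \<open>x\<close> there are only \<open>h x\<close> nodes,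
  whose pieces must be avoided, while infinitely many pieces are available. Distinctness along
  chains suffices for \<open>own_inj\<close>.\<close>

lemma own_exists:
  "\<exists>f. \<forall>x. x \<in> rich \<longrightarrow> f x \<in> B 0 \<inter> C (h x) x \<and> (\<forall>j<h x. t j x \<in> rich \<longrightarrow> piece (f (t j x)) \<noteq> piece (f x))"
proof (rule dependent_wf_choice[where R = "measure h" and
      P = "\<lambda>f x r. x \<in> rich \<longrightarrow> r \<in> B 0 \<inter> C (h x) x \<and> (\<forall>j<h x. t j x \<in> rich \<longrightarrow> piece (f (t j x)) \<noteq> piece r)"])
  have ht: "h (t j x) = j" if "x \<in> rich" "j < h x" for x j
    using t_node(2)[of x j] that richD[OF that(1)] T_C_iff[of x j] by simp
  show "(x \<in> rich \<longrightarrow> r \<in> B 0 \<inter> C (h x) x \<and> (\<forall>j<h x. t j x \<in> rich \<longrightarrow> piece (f (t j x)) \<noteq> piece r)) =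
     (x \<in> rich \<longrightarrow> r \<in> B 0 \<inter> C (h x) x \<and> (\<forall>j<h x. t j x \<in> rich \<longrightarrow> piece (g (t j x)) \<noteq> piece r))"
    if "\<And>z. (z, x) \<in> measure h \<Longrightarrow> f z = g z" for f g :: "'a \<Rightarrow> 'a" and x r
    using that ht by (auto simp: in_measure)
  show "\<exists>r. x \<in> rich \<longrightarrow> r \<in> B 0 \<inter> C (h x) x \<and> (\<forall>j<h x. t j x \<in> rich \<longrightarrow> piece (f (t j x)) \<noteq> piece r)" for x and f :: "'a \<Rightarrow> 'a"
  proof (cases "x \<in> rich")
    case True
    have "finite ((\<lambda>j. piece (f (t j x))) ` {..<h x})" by simp
    then have "\<not> piece ` (B 0 \<inter> C (h x) x) \<subseteq> (\<lambda>j. piece (f (t j x))) ` {..<h x}"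
      using rich_infinite[OF True] finite_subset by blast
    then show ?thesis by blast
  qed auto
qed simp

definition own :: "'a \<Rightarrow> 'a" where
  "own = (SOME f. \<forall>x. x \<in> rich \<longrightarrow> f x \<in> B 0 \<inter> C (h x) x \<and> (\<forall>j<h x. t j x \<in> rich \<longrightarrow> piece (f (t j x)) \<noteq> piece (f x)))"

lemma own:
  assumes "x \<in> rich"
  shows "own x \<in> B 0" "own x \<in> C (h x) x" "own x \<in> W"
    "j < h x \<Longrightarrow> t j x \<in> rich \<Longrightarrow> piece (own (t j x)) \<noteq> piece (own x)"
proof -
  have 1: "own x \<in> B 0 \<inter> C (h x) x \<and> (\<forall>j<h x. t j x \<in> rich \<longrightarrow> piece (own (t j x)) \<noteq> piece (own x))"
    using someI_ex[OF own_exists] assms unfolding own_def by blast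
  then show "own x \<in> B 0" "own x \<in> C (h x) x" "own x \<in> W"
    "j < h x \<Longrightarrow> t j x \<in> rich \<Longrightarrow> piece (own (t j x)) \<noteq> piece (own x)"
    using C_subset[OF richD(3)[OF assms]] by blast+
qed

lemma cone_compare:
  assumes "x \<in> T" "y \<in> T" "w \<in> C (h x) x" "w \<in> C (h y) y" "h x \<le> h y" shows "t (h x) y = x"
proof -
  note x = T_in_W[OF assms(1)] and y = T_in_W[OF assms(2)]
  have "w \<in> C (h x) y" using assms(4) C_mono[OF y assms(5)] by blast
  then have "t (h x) y = t (h x) w" using t_cong[OF y] by simp
  also have "\<dots> = t (h x) x" by (rule t_cong[OF x assms(3)])
  finally show ?thesis using T_h[OF assms(1)] by simp
qed

text \<open>Cones are nested or disjoint, so nodes sharing a piece are comparable, and along a chain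
  the pieces were chosen distinct.\<close>

lemma own_inj: assumes "x \<in> rich" "y \<in> rich" "piece (own x) = piece (own y)" shows "x = y"
proof -
  have *: "x = y" if x: "x \<in> rich" and y: "y \<in> rich" and e: "piece (own x) = piece (own y)" and le: "h x \<le> h y" for x y
  proof (rule ccontr)
    assume ne: "x \<noteq> y"
    have "own y \<in> piece (own x)" using e piece_self[OF own(3)[OF y]] by simp
    then have "own y \<in> C (h x) x" using piece_C[OF own(3)[OF x] richD(3)[OF x] own(2)[OF x]] by blast
    then have tx: "t (h x) y = x" using cone_compare richD x y own(2)[OF y] le by blast
    show False
    proof (cases "h x = h y")
      case True then show False using tx T_h[OF richD(2)[OF y]] ne by simp
    next
      case False
      then show False using own(4)[OF y, of "h x"] tx x e le by auto
    qed
  qed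
  show ?thesis using *[of x y] *[of y x] assms by (metis nat_le_linear)
qed

section \<open>The induction step: the parent function\<close>

text \<open>The first entry is the node where the escape of \<open>x\<close> leaves the tree.
  \<open>None\<close> means that this node itself serves as a root; \<open>Some u\<close> names the
  vertex through which the piece of \<open>own x\<close> is entered.\<close>

definition attach_ok :: "'a \<Rightarrow> 'a \<times> 'a option \<Rightarrow> bool" where
  "attach_ok x ye \<longleftrightarrow> fst ye \<in> T \<and> fst ye \<in> C (h x) x \<and>
     (case snd ye of None \<Rightarrow> fst ye \<in> B 0
      | Some u \<Rightarrow> u \<in> piece (own x) \<and> own x \<notin> T \<and> E (fst ye) u)"

definition attach :: "'a \<Rightarrow> 'a \<times> 'a option" where "attach x = (SOME ye. attach_ok x ye)"

lemma attach: assumes x: "x \<in> rich" shows "attach_ok x (attach x)"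
proof -
  have "\<exists>ye. attach_ok x ye"
  proof (cases "own x \<in> T")
    case True
    then show ?thesis using own[OF x] by (intro exI[of _ "(own x, None)"]) (simp add: attach_ok_def)
  next
    case False
    obtain u v where "u \<in> piece (own x)" "E u v" "v \<in> T" "v \<in> C (h x) x"
      using piece_attached[OF own(3)[OF x] False richD(3)[OF x] own(2)[OF x]] by blast
    then show ?thesis using False E_sym by (intro exI[of _ "(v, Some u)"]) (simp add: attach_ok_def)
  qed
  then show ?thesis unfolding attach_def by (rule someI_ex)
qed

text \<open>Escapes of rich nodes are one kind of exit. The other is the step from the node just
  below a rebuilt tail into that tail; for \<open>pm R = 0\<close> there is no such node.\<close>

definition exit_to :: "'a \<Rightarrow> 'a option \<Rightarrow> bool" where
  "exit_to y e \<longleftrightarrow> (\<exists>x\<in>rich. attach x = (y, e)) \<or>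
     (\<exists>R. poor R \<and> 0 < pm R \<and> y = R (pm R - 1) \<and> e = Some (R (pm R)))"

definition Y :: "'a set" where "Y = {y. \<exists>e. exit_to y e}"

definition under :: "'a set" where "under = {z \<in> T. \<exists>y\<in>Y. y \<in> C (h z) z}"

lemma Y_T: "Y \<subseteq> T"
proof
  fix y assume "y \<in> Y"
  then obtain e where "exit_to y e" by (auto simp: Y_def)
  then show "y \<in> T" unfolding exit_to_def
    using attach[unfolded attach_ok_def] normal_rayD(2) killedD(3) by (metis fst_conv)
qed

lemma Y_under: "Y \<subseteq> under"
  using Y_T T_h by (auto simp: under_def)

lemma rich_under: assumes "x \<in> rich" shows "x \<in> under"
proof -
  obtain y e where ye: "attach x = (y, e)" by fastforce
  then have "y \<in> Y" using assms by (auto simp: Y_def exit_to_def)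
  moreover have "y \<in> C (h x) x" using attach[OF assms] ye by (simp add: attach_ok_def)
  ultimately show ?thesis using richD(2)[OF assms] by (auto simp: under_def)
qed

lemma below_poor_under: assumes "x \<in> T" "below_poor x" shows "x \<in> under"
proof -
  obtain R where R: "poor R" "h x < pm R" "R (h x) = x" using assms(2) by (auto simp: below_poor_def)
  have "exit_to (R (pm R - 1)) (Some (R (pm R)))" using R unfolding exit_to_def by auto
  then have "R (pm R - 1) \<in> Y" by (auto simp: Y_def)
  moreover have "R (pm R - 1) \<in> C (h x) x"
    using normal_rayD(6)[OF killedD(3)[OF R(1)], of "h x" "pm R - 1"] R by simp
  ultimately show ?thesis using assms(1) by (auto simp: under_def)
qed

lemma killed_nodes_under: "x \<in> killed_nodes \<Longrightarrow> x \<in> under \<or> x \<in> Zall"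
  using below_poor_under rich_under killed_nodesD(2) by (auto simp: rich_def)

text \<open>By isolation no other killed ray passes through the start of a rebuilt tail. So an exit
  above it would come from a node of that tail or from a node below it, neither of which is rich, or
  from the poor ray itself, whose exit lies lower.\<close>

lemma under_not_Z: assumes z: "z \<in> under" shows "z \<notin> Zall"
proof
  assume "z \<in> Zall"
  then obtain R where p: "poor R" and zZ: "z \<in> Z R" by (auto simp: Zall_def)
  have R: "normal_ray R" by (rule killedD(3)[OF p])
  obtain y where y: "z \<in> T" "y \<in> Y" "y \<in> C (h z) z" using z by (auto simp: under_def)
  have zR: "pm R \<le> h z" "z = R (h z)" using Z_T[OF p zZ y(1)] by auto
  have "y \<in> cone R (h z)" using y(3) zR(2) by simp
  then have yR: "y \<in> cone R (pm R)" using normal_ray_C_mono[OF R zR(1)] by blast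
  note yC = normal_ray_C_eq[OF R yR]
  have yT: "y \<in> T" using y(2) Y_T by blast
  have hy: "pm R \<le> h y" using yC T_C_iff[OF yT] by blast
  obtain e where "exit_to y e" using y(2) by (auto simp: Y_def)
  then consider (a) x where "x \<in> rich" "attach x = (y, e)" | (b) S where "poor S" "0 < pm S" "y = S (pm S - 1)"
    by (auto simp: exit_to_def)
  then show False
  proof cases
    case b
    have S: "normal_ray S" by (rule killedD(3)[OF b(1)])
    have "h y = pm S - 1" using b(3) normal_rayD(3)[OF S] by simp
    then have le: "pm R \<le> pm S - 1" using hy by simp
    have "t (pm R) y = S (pm R)" using normal_rayD(8)[OF S le] b(3) by simp
    then have "S (pm R) = R (pm R)" using yC by simp
    then have "S = R" using isolated[OF p] killedD(2)[OF b(1)] by blast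
    then show False using le b(2) by simp
  next
    case a
    have x: "x \<in> T" "x \<in> W" using richD a(1) by auto
    have yx: "y \<in> C (h x) x" using attach[OF a(1)] a(2) by (simp add: attach_ok_def)
    have Rm: "R (pm R) \<in> T" "h (R (pm R)) = pm R" using normal_rayD(2,3)[OF R] by auto
    show False
    proof (cases "pm R \<le> h x")
      case True
      have "t (pm R) x = R (pm R)"
        using cone_compare[OF Rm(1) x(1), of y] Rm(2) yR yx True by simp
      moreover obtain S where S: "killed S" "x = S (h x)" using killed_nodesD(1) richD(1)[OF a(1)] by blast
      moreover have "t (pm R) x = S (pm R)" using normal_rayD(8)[OF killedD(1)[OF S(1)] True] S(2) by simp
      ultimately have "S = R" using isolated[OF p] by simp
      then have "x \<in> Z R" using S(2) tail_Z[OF True] by simp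
      then show False using a(1) p by (auto simp: rich_def Zall_def)
    next
      case False
      have "t (h x) (R (pm R)) = x"
        using cone_compare[OF x(1) Rm(1), of y] Rm(2) yR yx False by simp
      then have "R (h x) = x" using normal_rayD(8)[OF R, of "h x" "pm R"] False by simp
      then have "below_poor x" using p False by (auto simp: below_poor_def)
      then show False using a(1) by (simp add: rich_def)
    qed
  qed
qed

text \<open>The measure that makes climbing terminate: the number of levels up to a lowest exit
  above \<open>z\<close>.\<close>

definition depth :: "'a \<Rightarrow> nat" where
  "depth z = (LEAST n. \<exists>y\<in>Y. y \<in> C (h z) z \<and> h y = h z + n)"

definition up :: "'a \<Rightarrow> 'a" where
  "up z = (SOME v. v \<in> under \<and> E z v \<and> depth v < depth z \<and> h v = Suc (h z))"

lemma up: assumes z: "z \<in> under" "z \<notin> Y"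
  shows "up z \<in> under" "E z (up z)" "depth (up z) < depth z" "h (up z) = Suc (h z)"
proof -
  have zT: "z \<in> T" "z \<in> W" using z(1) T_in_W by (auto simp: under_def)
  obtain y0 where y0: "y0 \<in> Y" "y0 \<in> C (h z) z" using z(1) by (auto simp: under_def)
  have zin: "z \<in> C (h z) z" using T_h[OF zT(1)] by blast
  have y0h: "h z \<le> h y0" using C_cong[OF zT(2) y0(2)] T_C_iff[of y0 "h z"] Y_T y0 by auto
  have "\<exists>n. \<exists>y\<in>Y. y \<in> C (h z) z \<and> h y = h z + n"
    by (rule exI[of _ "h y0 - h z"]) (use y0 y0h in auto)
  then have "\<exists>y\<in>Y. y \<in> C (h z) z \<and> h y = h z + depth z" unfolding depth_def by (rule LeastI_ex)
  then obtain y where y: "y \<in> Y" "y \<in> C (h z) z" "h y = h z + depth z" by blast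
  have yT: "y \<in> T" "y \<in> W" using y(1) Y_T T_in_W by auto
  have ty: "t (h z) y = z" using t_cong[OF zT(2) y(2)] T_h[OF zT(1)] by simp
  have "depth z \<noteq> 0"
  proof
    assume "depth z = 0"
    then have "t (h z) y = y" using y(3) T_h[OF yT(1)] by simp
    then show False using ty y(1) z(2) by simp
  qed
  then have le: "Suc (h z) \<le> h y" using y(3) by simp
  have yC: "y \<in> C (Suc (h z)) y" using T_C_iff[OF yT(1)] le by simp
  define v where "v = t (Suc (h z)) y"
  note nv = t_node[OF yT(2) yC, folded v_def]
  have "E z v" using t_edge[OF yT(2) yC] ty by (simp add: v_def)
  moreover have "v \<in> under" using nv yC y(1) by (auto simp: under_def)
  moreover have "depth v \<le> depth z - 1" unfolding depth_def[of v]
    by (rule Least_le) (use nv yC y le in \<open>auto intro!: bexI[of _ y]\<close>)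
  then have "depth v < depth z" using \<open>depth z \<noteq> 0\<close> by simp
  ultimately have "\<exists>v. v \<in> under \<and> E z v \<and> depth v < depth z \<and> h v = Suc (h z)" using nv(2) by blast
  then have "up z \<in> under \<and> E z (up z) \<and> depth (up z) < depth z \<and> h (up z) = Suc (h z)"
    unfolding up_def by (rule someI_ex)
  then show "up z \<in> under" "E z (up z)" "depth (up z) < depth z" "h (up z) = Suc (h z)" by auto
qed

text \<open>A ray of a component of \<open>W - T\<close> that lies in the closure of all these sets
  is equivalent in \<open>W\<close> to the branch below the component. Adding them to
  \<open>B\<close> keeps the forest of the component from representing the end of that branch a
  second time.\<close>

definition nbrs_above :: "nat \<Rightarrow> 'a set" where
  "nbrs_above n = {u. \<exists>v\<in>T. n \<le> h v \<and> E u v}"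

abbreviation B' :: "nat \<Rightarrow> 'a set" where "B' \<equiv> \<lambda>n. B n \<union> nbrs_above n"

lemma nbrs_above_anti: "antimono nbrs_above"
  unfolding antimono_def nbrs_above_def by (blast intro: order_trans)

lemma B'_anti: "antimono B'"
  using nbrs_above_anti B_anti unfolding antimono_def by blast

definition pK_ok :: "'a set \<Rightarrow> ('a \<Rightarrow> 'a option) \<Rightarrow> bool" where
  "pK_ok D p \<longleftrightarrow> good D B' p \<and>
     (\<forall>x\<in>rich. \<forall>y u. attach x = (y, Some u) \<longrightarrow> piece (own x) = D \<longrightarrow> leads p u (own x) \<and> p (own x) = None)"

definition pK :: "'a set \<Rightarrow> 'a \<Rightarrow> 'a option" where "pK D = (SOME p. pK_ok D p)"

lemma has_T_nbr: assumes "d \<in> W" "d \<notin> T" shows "\<exists>u v. u \<in> K d \<and> E u v \<and> v \<in> T"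
  using piece_attached[OF assms assms(1), of 0] assms C_0 by (auto simp: piece_def)

text \<open>A component has a neighbour in the tree, so \<open>B' 0\<close> meets it and the
  induction hypothesis applies. Since \<open>own_inj\<close> assigns the component to at most one
  rich node, a single rerouting meets all demands.\<close>

lemma pK: assumes d: "d \<in> W" "d \<notin> T" shows "pK_ok (K d) (pK (K d))"
proof -
  have cK: "conn (K d)" using conn_comp d by blast
  obtain u v where uv: "u \<in> K d" "E u v" "v \<in> T" using has_T_nbr[OF d] by blast
  then have "u \<in> B' 0" by (auto simp: nbrs_above_def)
  then have "\<exists>p. good (K d \<union> {}) B' p" using uv cK B'_anti
    by (intro IH[OF d, of _ _ B' u]) auto
  then obtain p where p: "good (K d) B' p" by auto
  have "\<exists>p. pK_ok (K d) p"
  proof (cases "\<exists>x\<in>rich. \<exists>y u. attach x = (y, Some u) \<and> piece (own x) = K d")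
    case False then show ?thesis using p unfolding pK_ok_def by (intro exI[of _ p]) blast
  next
    case True
    then obtain x y u where x: "x \<in> rich" "attach x = (y, Some u)" "piece (own x) = K d" by blast
    have u: "u \<in> K d" using attach[OF x(1)] x by (simp add: attach_ok_def)
    have o: "own x \<in> K d" "own x \<in> B' 0" using piece_self[OF own(3)[OF x(1)]] own(1)[OF x(1)] x(3) by auto
    obtain q where q: "good (K d) B' q" "leads q u (own x)" "q (own x) = None"
      using good_reroute[OF p B'_anti cK u o] by blast
    have "pK_ok (K d) q" unfolding pK_ok_def
    proof (intro conjI ballI allI impI)
      fix x' y' u' assume *: "x' \<in> rich" "attach x' = (y', Some u')" "piece (own x') = K d"
      then have "x' = x" using own_inj[OF _ x(1)] x(3) by simp
      then show "leads q u' (own x')" "q (own x') = None" using q * x(2) by auto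
    qed (rule q)
    then show ?thesis by blast
  qed
  then show ?thesis unfolding pK_def by (rule someI_ex)
qed

lemma pK_good: "d \<in> W \<Longrightarrow> d \<notin> T \<Longrightarrow> good (K d) B' (pK (K d))"
  using pK by (auto simp: pK_ok_def)

definition exit :: "'a \<Rightarrow> 'a option" where "exit y = (SOME e. exit_to y e)"

definition ray_of :: "'a \<Rightarrow> nat \<Rightarrow> 'a" where "ray_of x = (SOME R. poor R \<and> x \<in> Z R)"

text \<open>Nodes below an exit walk up the tree to a nearest exit, which breaks every killed ray
  infinitely often; the other nodes walk down the tree.\<close>

definition p :: "'a \<Rightarrow> 'a option" where
  "p x = (if x \<in> Zall then pZ (ray_of x) x
    else if x \<in> T then
      (if x \<in> Y then exit x else if x \<in> under then Some (up x)
       else if h x = 0 then None else Some (t (h x - 1) x))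
    else case pK (K x) x of Some y \<Rightarrow> Some y
      | None \<Rightarrow> if x \<in> B 0 then None else Some (SOME v. v \<in> T \<and> E x v))"

section \<open>Values and termination of the parent function\<close>

lemma ray_of: assumes "poor R" "x \<in> Z R" shows "ray_of x = R"
proof -
  have "poor (ray_of x) \<and> x \<in> Z (ray_of x)" unfolding ray_of_def
    by (rule someI[of "\<lambda>R. poor R \<and> x \<in> Z R" R]) (use assms in simp)
  then show ?thesis using Z_disjoint assms by blast
qed

lemma p_Z: assumes "poor R" "x \<in> Z R" shows "p x = pZ R x"
proof -
  have "x \<in> Zall" using assms by (auto simp: Zall_def)
  then show ?thesis using ray_of[OF assms] by (simp add: p_def)
qed

lemma K_Zall: assumes "x \<in> W" "x \<notin> T" "x \<notin> Zall" shows "K x \<inter> Zall = {}"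
proof (rule ccontr)
  assume "\<not> ?thesis"
  then obtain y R where y: "y \<in> K x" "poor R" "y \<in> Z R" by (auto simp: Zall_def)
  have "y \<notin> T" using comp_branch(5)[OF assms(1,2) y(1)] .
  then have "K x = K (pd R)" using Z_notT[OF y(2,3)] comp_eq[OF y(1)] by simp
  then have "x \<in> Z R" using KZ comp_self assms by blast
  then show False using assms(3) y(2) by (auto simp: Zall_def)
qed

lemma exit_cases:
  assumes "y \<in> Y"
  obtains (none) "exit y = None" "y \<in> B 0"
  | (poor) R where "poor R" "exit y = Some (R (pm R))" "E y (R (pm R))" "R (pm R) \<in> Z R"
  | (rich) x u where "x \<in> rich" "exit y = Some u" "E y u" "u \<in> K u" "u \<in> W" "u \<notin> T" "u \<notin> Zall"
      "leads (pK (K u)) u (own x)" "pK (K u) (own x) = None" "own x \<in> K u" "own x \<in> B 0"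
proof -
  have "exit_to y (exit y)" using assms unfolding exit_def Y_def by (auto intro: someI_ex)
  then consider (a) x where "x \<in> rich" "attach x = (y, exit y)"
    | (b) R where "poor R" "0 < pm R" "y = R (pm R - 1)" "exit y = Some (R (pm R))" by (auto simp: exit_to_def)
  then show thesis
  proof cases
    case b
    have "E y (R (pm R))" using normal_ray_edge[OF killedD(3)[OF b(1)], of "pm R - 1"] b(2,3) by simp
    then show thesis using b tail_Z by (intro that(2)) auto
  next
    case a
    note at = attach[OF a(1), unfolded attach_ok_def a(2)]
    show thesis
    proof (cases "exit y")
      case None then show thesis using at that(1) by simp
    next
      case (Some u)
      have u: "u \<in> piece (own x)" "own x \<notin> T" "E y u" using at Some by auto
      have o: "own x \<in> W" "own x \<in> B 0" using own[OF a(1)] by auto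
      have pc: "piece (own x) = K (own x)" using u(2) by (simp add: piece_def)
      have uK: "u \<in> K (own x)" using u(1) pc by simp
      note uc = comp_branch[OF o(1) u(2) uK] and Ku = comp_eq[OF uK]
      \<comment> \<open>Otherwise the branch below \<open>own x\<close> is a poor ray. It passes
        through \<open>x\<close>, so \<open>x\<close> lies in its rebuilt tail or below that tail,
        and is not rich.\<close>
      have "own x \<notin> Zall"
      proof
        assume "own x \<in> Zall"
        then obtain R where R: "poor R" "own x \<in> Z R" by (auto simp: Zall_def)
        have xT: "x \<in> T" by (rule richD(2)[OF a(1)])
        have "t (h x) (own x) = x"
          using t_cong[OF richD(3)[OF a(1)] own(2)[OF a(1)]] T_h[OF xT] by simp
        then have x: "R (h x) = x" using Z_notT[OF R u(2)] by simp
        show False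
        proof (cases "pm R \<le> h x")
          case True
          then have "x \<in> Zall" using tail_Z[OF True] x R(1) by (auto simp: Zall_def)
          then show False using a(1) by (simp add: rich_def)
        next
          case False
          then have "below_poor x" using x R(1) by (auto simp: below_poor_def)
          then show False using a(1) by (simp add: rich_def)
        qed
      qed
      then have "u \<notin> Zall" using K_Zall[OF o(1) u(2)] uK by blast
      moreover have "leads (pK (K u)) u (own x) \<and> pK (K u) (own x) = None"
        using pK[OF o(1) u(2)] a Some pc unfolding pK_ok_def Ku by metis
      moreover have "own x \<in> K u" using comp_self o u(2) unfolding Ku by blast
      ultimately show thesis using that(3)[of x u] a(1) Some u(3) uc comp_self o by blast
    qed
  qed
qed

lemma p_K_Some: assumes "x \<in> W" "x \<notin> T" "x \<notin> Zall" "pK (K x) x = Some y" shows "p x = Some y"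
  using assms by (simp add: p_def)

lemma p_K_cases:
  assumes x: "x \<in> W" "x \<notin> T" "x \<notin> Zall" and px: "p x = Some y"
  shows "pK (K x) x = Some y \<and> y \<in> K x \<or> pK (K x) x = None \<and> y \<in> T \<and> E x y"
proof (cases "pK (K x) x")
  case None
  have g: "x \<in> B' 0" using pK_good[OF x(1,2)] None comp_self[of x] x(1,2) unfolding good_def by blast
  have y: "x \<notin> B 0" "y = (SOME v. v \<in> T \<and> E x v)" using px x None by (auto simp: p_def split: if_splits)
  then have "\<exists>v. v \<in> T \<and> E x v" using g by (auto simp: nbrs_above_def)
  then have "y \<in> T \<and> E x y" unfolding y(2) by (rule someI_ex)
  then show ?thesis using None by simp
next
  case (Some z)
  then have "z = y" using px x by (simp add: p_def)
  moreover have "z \<in> K x" using pK_good[OF x(1,2)] Some comp_self[of x] x(1,2) unfolding good_def by blast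
  ultimately show ?thesis using Some by simp
qed

lemma p_K_None: assumes "x \<in> W" "x \<notin> T" "x \<notin> Zall" "x \<in> B 0" "pK (K x) x = None" shows "p x = None"
  using assms by (simp add: p_def)

lemma p_under: assumes "x \<in> under" shows "x \<in> Y \<Longrightarrow> p x = exit x" "x \<notin> Y \<Longrightarrow> p x = Some (up x)"
  using assms under_not_Z[OF assms] by (auto simp: p_def under_def)

lemma p_rest: assumes "x \<in> T" "x \<notin> under" "x \<notin> Zall"
  shows "h x = 0 \<Longrightarrow> p x = None" "h x \<noteq> 0 \<Longrightarrow> p x = Some (t (h x - 1) x)"
  using assms Y_under by (auto simp: p_def)

lemma under_T: "under \<subseteq> T" by (auto simp: under_def)

lemma tree_parent:
  assumes "x \<in> T" "h x \<noteq> 0"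
  shows "t (h x - 1) x \<in> T" "E (t (h x - 1) x) x" "h (t (h x - 1) x) = h x - 1"
proof -
  have x: "x \<in> W" "x \<in> C (h x) x" "x \<in> C (h x - 1) x" using assms T_in_W T_C_iff by auto
  show "t (h x - 1) x \<in> T" "h (t (h x - 1) x) = h x - 1" using t_node[OF x(1,3)] by auto
  show "E (t (h x - 1) x) x" using t_edge[OF x(1), of "h x - 1"] x(2) assms T_h by simp
qed

text \<open>Besides carrying the rerouted path over to \<open>p\<close>, this records that the walk
  from an exit never comes back to the tree, because it stops at a root in
  \<open>B 0\<close>.\<close>

lemma leads_in_K:
  assumes d: "d \<in> W" "d \<notin> T" "d \<notin> Zall" and b: "b \<in> B 0" "pK (K d) b = None"
  shows "leads (pK (K d)) v b \<Longrightarrow> v \<in> K d \<Longrightarrow> leads p v b \<and> p b = None \<and> (\<forall>y. leads p v y \<longrightarrow> y \<in> K d)"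
proof (induction rule: leads_induct)
  case refl
  note bb = comp_branch[OF d(1,2) refl] and Kb = comp_eq[OF refl]
  have "b \<notin> Zall" using K_Zall[OF d] refl by blast
  then have "p b = None" using p_K_None[OF bb(4,5)] b Kb by simp
  then show ?case using leads_refl leads_cases[of p b] refl by force
next
  case (step v c)
  note vb = comp_branch[OF d(1,2) step.prems] and Kv = comp_eq[OF step.prems]
  have "v \<notin> Zall" using K_Zall[OF d] step.prems by blast
  then have pv: "p v = Some c" using p_K_Some[OF vb(4,5)] step.hyps(1) Kv by simp
  have "c \<in> K d" using pK_good[OF d(1,2)] step.hyps(1) step.prems unfolding good_def by blast
  then have IH: "leads p c b" "p b = None" "\<forall>y. leads p c y \<longrightarrow> y \<in> K d" using step.IH by auto
  have "y \<in> K d" if "leads p v y" for y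
    using leads_cases[OF that] pv IH(3) step.prems by auto
  then show ?case using leads_step[of p v c b, OF pv IH(1)] IH(2) by blast
qed

lemma exit_leads:
  assumes "x \<in> rich" "u \<in> W" "u \<notin> T" "u \<notin> Zall"
    "leads (pK (K u)) u (own x)" "pK (K u) (own x) = None" "own x \<in> B 0"
  shows "leads p u (own x)" "p (own x) = None" "leads p u y \<Longrightarrow> y \<in> K u"
  using leads_in_K[OF assms(2,3,4,7,6,5)] comp_self assms by auto

lemma p_None: assumes "x \<in> W" "p x = None" shows "x \<in> B 0"
proof (cases "x \<in> Zall")
  case True
  then obtain R where "poor R" "x \<in> Z R" by (auto simp: Zall_def)
  then show ?thesis using pZ_good p_Z assms(2) unfolding good_def by metis
next
  case False
  show ?thesis
  proof (cases "x \<in> T")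
    case True
    show ?thesis
    proof (cases "x \<in> under")
      case u: True
      have xY: "x \<in> Y" using p_under(2)[OF u] assms(2) by auto
      then have "exit x = None" using p_under(1)[OF u] assms(2) by simp
      with xY show ?thesis by (cases rule: exit_cases[of x]) auto
    next
      case nu: False
      then have "h x = 0" using p_rest[OF True nu False] assms(2) by auto
      then show ?thesis using T_h[OF True] root[OF assms(1)] by simp
    qed
  next
    case nT: False
    then show ?thesis using assms False by (auto simp: p_def split: option.splits if_splits)
  qed
qed

lemma p_Some: assumes "x \<in> W" "p x = Some y" shows "y \<in> W \<and> E x y"
proof (cases "x \<in> Zall")
  case True
  then obtain R where R: "poor R" "x \<in> Z R" by (auto simp: Zall_def)
  then have "pZ R x = Some y" using p_Z assms(2) by simp
  then have "y \<in> Z R \<and> E x y" using pZ_good[OF R(1)] R(2) unfolding good_def by blast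
  then show ?thesis using Z_W[OF R(1)] by blast
next
  case False
  show ?thesis
  proof (cases "x \<in> T")
    case True
    show ?thesis
    proof (cases "x \<in> under")
      case u: True
      show ?thesis
      proof (cases "x \<in> Y")
        case True
        have px: "p x = exit x" using p_under[OF u] True by simp
        from True show ?thesis
        proof (cases rule: exit_cases)
          case (poor R) then show ?thesis using px assms(2) Z_W by auto
        qed (use px assms(2) in auto)
      next
        case F: False
        then show ?thesis using up[OF u F] p_under[OF u] assms(2) under_T T_in_W by auto
      qed
    next
      case nu: False
      then show ?thesis
        using p_rest[OF True nu False] assms(2) tree_parent[OF True] E_sym T_in_W by (cases "h x = 0") auto
    qed
  next
    case nT: False
    show ?thesis using p_K_cases[OF assms(1) nT False assms(2)]
    proof
      assume a: "pK (K x) x = Some y \<and> y \<in> K x"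
      then have "E x y" using pK_good[OF assms(1) nT] comp_self[of x] assms(1) nT unfolding good_def by blast
      then show ?thesis using a comp_subset by blast
    qed (use T_in_W in blast)
  qed
qed

lemma p_terminates_Z: assumes "poor R" "x \<in> Z R" shows "terminates p x"
proof -
  have "terminates (pZ R) x" using pZ_good[OF assms(1)] assms(2) unfolding good_def by blast
  then show ?thesis using assms(2)
  proof (induction rule: terminates.induct)
    case (1 x) then show ?case using p_Z[OF assms(1)] terminates.intros(1) by metis
  next
    case (2 x y)
    then have "y \<in> Z R" using pZ_good[OF assms(1)] unfolding good_def by blast
    then show ?case using 2 p_Z[OF assms(1)] terminates.intros(2) by metis
  qed
qed

text \<open>Three layers: an exit stops or leads to a root within a component or rebuilt region; a
  climb to an exit decreases \<open>depth\<close>; a descent decreases \<open>h\<close> until it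
  stops or meets one of the former.\<close>

lemma p_terminates_T: "x \<in> T \<Longrightarrow> terminates p x"
proof -
  have Y: "terminates p x" if x: "x \<in> Y" for x
  proof -
    have px: "p x = exit x" using p_under x Y_under by blast
    from x show ?thesis
    proof (cases rule: exit_cases)
      case none then show ?thesis using px terminates.intros(1) by metis
    next
      case (poor R)
      then show ?thesis using px p_terminates_Z[of R] terminates.intros(2) by metis
    next
      case (rich z u)
      have "leads p u (own z)" "p (own z) = None" using exit_leads rich by blast+
      then have "terminates p u" using leads_terminates terminates.intros(1) by metis
      then show ?thesis using px rich(2) terminates.intros(2) by metis
    qed
  qed
  have H: "terminates p x" if "x \<in> under" for x
    using that
  proof (induction "depth x" arbitrary: x rule: less_induct)
    case less
    show ?case
    proof (cases "x \<in> Y")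
      case False
      then show ?thesis using less up[OF less.prems False] p_under(2)[OF less.prems False] terminates.intros(2) by metis
    qed (rule Y)
  qed
  show "x \<in> T \<Longrightarrow> terminates p x"
  proof (induction "h x" arbitrary: x rule: less_induct)
    case less
    show ?case
    proof (cases "x \<in> under \<or> x \<in> Zall")
      case True then show ?thesis using H p_terminates_Z by (auto simp: Zall_def)
    next
      case False
      show ?thesis
      proof (cases "h x = 0")
        case True then show ?thesis using p_rest(1)[OF less.prems] False terminates.intros(1) by metis
      next
        case hx: False
        have "terminates p (t (h x - 1) x)"
          by (rule less.hyps) (use tree_parent[OF less.prems hx] hx in auto)
        then show ?thesis using p_rest(2)[OF less.prems _ _ hx] False terminates.intros(2) by metis
      qed
    qed
  qed
qed

lemma p_terminates: assumes "x \<in> W" shows "terminates p x"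
proof (cases "x \<in> T \<or> x \<in> Zall")
  case True then show ?thesis using p_terminates_T p_terminates_Z by (auto simp: Zall_def)
next
  case False
  then have x: "x \<in> W" "x \<notin> T" "x \<notin> Zall" using assms by auto
  have "terminates p v" if "terminates (pK (K x)) v" "v \<in> K x" for v
    using that
  proof (induction rule: terminates.induct)
    case (1 v)
    note vb = comp_branch[OF x(1,2) 1(2)] and Kv = comp_eq[OF 1(2)]
    have vZ: "v \<notin> Zall" using K_Zall[OF x] 1 by blast
    show ?case
    proof (cases "p v")
      case None then show ?thesis by (rule terminates.intros)
    next
      case (Some y)
      then have "y \<in> T" using p_K_cases[OF vb(4,5) vZ Some] 1 Kv by auto
      then show ?thesis using Some p_terminates_T terminates.intros(2) by metis
    qed
  next
    case (2 v y)
    note vb = comp_branch[OF x(1,2) 2(4)] and Kv = comp_eq[OF 2(4)]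
    have vZ: "v \<notin> Zall" using K_Zall[OF x] 2 by blast
    have "p v = Some y" using p_K_Some[OF vb(4,5) vZ] 2(1) Kv by simp
    moreover have "y \<in> K x" using pK_good[OF x(1,2)] 2(1,4) unfolding good_def by blast
    ultimately show ?case using 2 terminates.intros(2) by metis
  qed
  moreover have "terminates (pK (K x)) x" using pK_good[OF x(1,2)] comp_self[of x] x unfolding good_def by blast
  ultimately show ?thesis using comp_self x by blast
qed

section \<open>The induction step: rays of the new tree\<close>

lemma parent_ray_p_W: "parent_ray W p r \<Longrightarrow> r n \<in> W \<and> p (r (Suc n)) = Some (r n)"
  by (simp add: parent_ray_def)

lemma p_Z_closed: "poor R \<Longrightarrow> x \<in> Z R \<Longrightarrow> p x = Some y \<Longrightarrow> y \<in> Z R"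
  using pZ_good p_Z unfolding good_def by metis

text \<open>Only an exit leads from the tree into a component outside \<open>Zall\<close>, and the
  walk to the root after such an exit stays in the component. A ray that has been in the tree closer
  to its root therefore cannot return to the tree.\<close>

lemma p_ray_leaves_tree:
  assumes r: "parent_ray W p r" and a: "r a \<in> T" "r a \<notin> Zall" and n: "a \<le> n" "r n \<notin> T" "r n \<notin> Zall"
  shows "r (Suc n) \<in> K (r n) \<and> r (Suc n) \<notin> T \<and> r (Suc n) \<notin> Zall"
proof -
  let ?x = "r (Suc n)" and ?u = "r n"
  have px: "p ?x = Some ?u" and W: "?x \<in> W" "?u \<in> W" using parent_ray_p_W[OF r] by auto
  have xZ: "?x \<notin> Zall" using n(3) p_Z_closed[OF _ _ px] by (auto simp: Zall_def)
  have xT: "?x \<notin> T"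
  proof
    assume xT: "?x \<in> T"
    show False
    proof (cases "?x \<in> under")
      case False
      then show False using p_rest[OF xT False xZ] px tree_parent[OF xT] n(2) by (cases "h ?x = 0") auto
    next
      case u: True
      have xY: "?x \<in> Y"
      proof (rule ccontr)
        assume nY: "?x \<notin> Y"
        then show False using p_under(2)[OF u nY] px up(1)[OF u nY] under_T n(2) by auto
      qed
      have ex: "exit ?x = Some ?u" using p_under(1)[OF u xY] px by simp
      from xY show False
      proof (cases rule: exit_cases)
        case none then show False using ex by simp
      next
        case (poor R)
        then have "?u \<in> Z R" using ex by simp
        then show False using poor(1) n(3) by (auto simp: Zall_def)
      next
        case (rich x u)
        have "u = ?u" using ex rich(2) by simp
        have "leads p u (r a)" using parent_ray_leads[OF r n(1)] \<open>u = ?u\<close> by simp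
        then have "r a \<in> K u" using exit_leads(3) rich by blast
        then show False using a(1) comp_branch(5) rich(5,6) by blast
      qed
    qed
  qed
  have "?u \<in> K ?x" using p_K_cases[OF W(1) xT xZ px] n(2) by blast
  then have "K ?u = K ?x" by (rule comp_eq)
  then show ?thesis using xT xZ W(1) comp_self by auto
qed

lemma p_ray_tail:
  assumes r: "parent_ray W p r"
  obtains (Z) a R where "poor R" "\<And>n. n \<ge> a \<Longrightarrow> r n \<in> Z R"
  | (K) a where "r a \<in> W" "r a \<notin> T" "r a \<notin> Zall" "\<And>n. n \<ge> a \<Longrightarrow> r n \<in> K (r a)"
  | (T) a where "\<And>n. n \<ge> a \<Longrightarrow> r n \<in> T \<and> r n \<notin> under \<and> r n \<notin> Zall"
proof -
  have W: "r n \<in> W" and pr: "p (r (Suc n)) = Some (r n)" for n using r by (auto simp: parent_ray_def)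
  \<comment> \<open>Rebuilt regions are closed under parents, so a ray outside \<open>Zall\<close>
    at one index stays outside at all later ones.\<close>
  have Zback: "r n \<in> Zall" if "r m \<in> Zall" "n \<le> m" for n m
    using that(2,1)
  proof (induction rule: inc_induct)
    case (step n)
    then show ?case using p_Z_closed[OF _ _ pr] by (auto simp: Zall_def)
  qed
  show thesis
  proof (cases "\<exists>a. r a \<in> T \<and> r a \<notin> Zall")
    case True
    then obtain a where a: "r a \<in> T" "r a \<notin> Zall" by blast
    have nZ: "r n \<notin> Zall" if "n \<ge> a" for n using Zback[of n a] that a(2) by blast
    show thesis
    proof (cases "\<exists>b\<ge>a. r b \<notin> T")
      case True
      then obtain b where b: "b \<ge> a" "r b \<notin> T" by blast
      have "r n \<in> K (r b) \<and> r n \<notin> T" if "n \<ge> b" for n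
        using that
      proof (induction rule: dec_induct)
        case base then show ?case using b W comp_self by blast
      next
        case (step n)
        then show ?case using p_ray_leaves_tree[OF r a, of n] comp_eq[of "r n"] b(1) nZ[of n] by auto
      qed
      then show thesis using K[of b] W b nZ by blast
    next
      case False
      then have inT: "r n \<in> T" if "n \<ge> a" for n using that by blast
      \<comment> \<open>Read away from the root, a stretch in \<open>under\<close> is a climb
        traversed backwards: heights fall along it, so it is finite.\<close>
      have desc: "r n \<in> under \<and> h (r n) = Suc (h (r (Suc n)))" if "n \<ge> a" "r (Suc n) \<in> under" for n
      proof -
        have "r (Suc n) \<notin> Y"
        proof
          assume Y: "r (Suc n) \<in> Y"
          have ex: "exit (r (Suc n)) = Some (r n)" using p_under(1)[OF that(2) Y] pr by simp
          from Y show False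
            by (cases rule: exit_cases) (use ex inT[OF that(1)] nZ[OF that(1)] in \<open>auto simp: Zall_def\<close>)
        qed
        then show ?thesis using up[OF that(2)] p_under(2)[OF that(2)] pr[of n] by simp
      qed
      have "\<exists>b\<ge>a. r b \<notin> under"
      proof (rule ccontr)
        assume no: "\<not> ?thesis"
        have "h (r (a + i)) + i = h (r a)" for i
        proof (induction i)
          case (Suc i) then show ?case using desc[of "a + i"] no by simp
        qed simp
        from this[of "Suc (h (r a))"] show False by simp
      qed
      then obtain b where b: "b \<ge> a" "r b \<notin> under" by blast
      have "r n \<notin> under" if "n \<ge> b" for n
        using that
      proof (induction rule: dec_induct)
        case (step n) then show ?case using desc[of n] b(1) by auto
      qed (rule b)
      then show thesis using T[of b] inT nZ b(1) by (meson order_trans)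
    qed
  next
    case noT: False
    show thesis
    proof (cases "\<exists>a. r a \<notin> Zall")
      case True
      then obtain a where a: "r a \<notin> Zall" by blast
      have nn: "r n \<notin> Zall" "r n \<notin> T" if "n \<ge> a" for n using Zback[of n a] that a noT by blast+
      have "r n \<in> K (r a)" if "n \<ge> a" for n
        using that
      proof (induction rule: dec_induct)
        case base then show ?case using nn[of a] W comp_self by blast
      next
        case (step n)
        have "r n \<in> K (r (Suc n))" using p_K_cases[OF W _ _ pr[of n]] nn[of n] nn[of "Suc n"] step.hyps by auto
        then have "K (r n) = K (r (Suc n))" by (rule comp_eq)
        moreover have "K (r n) = K (r a)" using step.IH by (rule comp_eq)
        ultimately show ?case using comp_self[of "r (Suc n)" "W - T"] nn[of "Suc n"] W step.hyps by auto
      qed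
      then show thesis using K[of a] nn[of a] W by blast
    next
      case False
      then obtain R where R: "poor R" "r 0 \<in> Z R" by (auto simp: Zall_def)
      have "r n \<in> Z R" for n
      proof (induction n)
        case (Suc n)
        obtain S where S: "poor S" "r (Suc n) \<in> Z S" using False by (auto simp: Zall_def)
        then have "r n \<in> Z S" using p_Z_closed pr by blast
        then show ?case using Z_disjoint[OF S(1) R(1) _ Suc] S(2) by blast
      qed (rule R)
      then show thesis using Z R(1) by blast
    qed
  qed
qed

lemma p_ray_is_ray: "parent_ray W p r \<Longrightarrow> is_ray W r"
  by (rule parent_ray_is_ray) (use p_terminates p_Some in blast)+

lemma tree_ray_normal:
  assumes r: "parent_ray W p r" and T: "\<And>n. n \<ge> a \<Longrightarrow> r n \<in> T \<and> r n \<notin> under \<and> r n \<notin> Zall"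
  shows "\<exists>R. normal_ray R \<and> (\<forall>n. r (n + a) = R (n + h (r a)))"
proof -
  have st: "h (r (Suc n)) = Suc (h (r n)) \<and> t (h (r n)) (r (Suc n)) = r n" if "n \<ge> a" for n
  proof -
    have T': "r (Suc n) \<in> T" "r (Suc n) \<notin> under" "r (Suc n) \<notin> Zall" using T[of "Suc n"] that by auto
    have pr: "p (r (Suc n)) = Some (r n)" using parent_ray_p_W[OF r] by blast
    have h0: "h (r (Suc n)) \<noteq> 0" using p_rest(1)[OF T'] pr by auto
    then show ?thesis using p_rest(2)[OF T' h0] pr tree_parent(3)[OF T'(1) h0] by auto
  qed
  have hh: "h (r (n + a)) = n + h (r a)" for n
    by (induction n) (use st in auto)
  have tt: "t (h (r n)) (r m) = r n" if "n \<ge> a" "m \<ge> n" for n m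
    using that(2)
  proof (induction rule: dec_induct)
    case base then show ?case using T_h T that by blast
  next
    case (step m)
    have m: "r (Suc m) \<in> T" "r (Suc m) \<in> W" "m \<ge> a" using T[of "Suc m"] T_in_W step.hyps that by auto
    have "r m \<in> C (h (r m)) (r (Suc m))"
      using t_in[OF m(2), of "h (r m)"] T_C_iff[OF m(1)] st[OF m(3)] by simp
    moreover have "h (r n) \<le> h (r m)" using hh[of "n - a"] hh[of "m - a"] step.hyps that by simp
    ultimately have "r m \<in> C (h (r n)) (r (Suc m))" using C_mono[OF m(2)] by blast
    then show ?case using t_cong[OF m(2)] step.IH by simp
  qed
  obtain R where R: "normal_ray R" "\<And>k. \<exists>n. \<forall>i\<ge>n. r i \<in> C k (R k)"
    using ray_branch[OF p_ray_is_ray[OF r]] by blast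
  have "r (n + a) = R (n + h (r a))" for n
  proof -
    obtain m where m: "\<forall>i\<ge>m. r i \<in> cone R (n + h (r a))" using R(2) by blast
    let ?i = "max m (n + a)"
    have "t (n + h (r a)) (r ?i) = R (n + h (r a))" using m normal_ray_C_eq[OF R(1), of "r ?i"] by simp
    then show ?thesis using tt[of "n + a" ?i] hh[of n] by simp
  qed
  then show ?thesis using R(1) by blast
qed

section \<open>Confinement of forest rays to components\<close>

lemma K_isl:
  assumes d: "d \<in> W" "d \<notin> T" and r: "\<And>n. n \<ge> a \<Longrightarrow> r n \<in> K d" and nl: "\<not> lim (K d) B' r"
  shows "isl W (K d) r"
proof -
  obtain X n where X: "finite X" "\<forall>i\<ge>n. \<forall>b\<in>B' n. \<not> reach (K d - X) (r i) b" using not_limE[OF nl] .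
  show ?thesis
  proof (rule islI[OF d X(1), of "max a n"])
    show "r i \<in> K d" if "i \<ge> max a n" for i using r that by simp
    show "\<not> E u (t j d)" if *: "i \<ge> max a n" "j \<ge> max a n" "reach (K d - X) (r i) u" for i u j
    proof
      assume E: "E u (t j d)"
      have "t j d \<in> T" "h (t j d) = j" using t_node[OF d(1) notT_C[OF d]] by auto
      then have "u \<in> B' n" using E *(2) by (auto simp: nbrs_above_def)
      then show False using X(2) * by auto
    qed
  qed
qed

text \<open>Within \<open>Z R\<close> the ray \<open>R\<close> lies in the closure of all
  \<open>B n\<close>. So a ray not in this closure is inequivalent to \<open>R\<close> there, is
  finitely separated from a tail of \<open>R\<close>, and stays in the component.\<close>

lemma Z_isl:
  assumes R: "poor R" and r: "is_ray W r" "\<And>n. n \<ge> a \<Longrightarrow> r n \<in> Z R" and nl: "\<not> lim (Z R) B r"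
  shows "isl W (K (pd R)) r"
proof -
  have rZ: "is_ray (Z R) (\<lambda>n. R (n + pm R))"
    by (rule ray_shift_into[OF normal_ray_is_ray[OF killedD(3)[OF R]]]) (rule tail_Z)
  have "\<not> eqv (Z R) r (\<lambda>n. R (n + pm R))"
    using lim_cong_eqv[OF _ rZ, of r B] lim_shift[OF B_anti] poorD(5)[OF R] nl by blast
  then have "\<not> eqv (Z R) r R" by (simp add: eqv_shift_right)
  then obtain X n where X: "finite X" "\<forall>i\<ge>n. \<forall>b\<in>R ` {n..}. \<not> reach (Z R - X) (r i) b"
    unfolding eqv_def by (rule not_limE)
  define N where "N = max (max n (pm R)) a"
  have N: "n \<le> N" "pm R \<le> N" "a \<le> N" by (auto simp: N_def)
  have no: "\<not> reach (Z R - X) (r i) (R j)" if "i \<ge> N" "j \<ge> N" for i j using X(2) that N by auto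
  note pdR = poorD(1,2,3)[OF R]
  show ?thesis
  proof (rule islI[OF pdR(1,2), of "X \<union> R ` {..<N}" N])
    show "finite (X \<union> R ` {..<N})" using X(1) by simp
    show "r i \<in> K (pd R)" if i: "i \<ge> N" "r i \<in> W - (X \<union> R ` {..<N})" for i
    proof (rule ccontr)
      assume "r i \<notin> K (pd R)"
      then obtain j where j: "r i = R j" using r(2)[of i] i N by (auto simp: Z_def)
      then have "j \<ge> N" using i(2) by (metis Diff_iff UnCI imageI lessThan_iff not_le)
      moreover have "reach (Z R - X) (r i) (R j)" using reach_refl r(2)[of i] i N j by auto
      ultimately show False using no i(1) by blast
    qed
    show "\<not> E u (t j (pd R))" if *: "i \<ge> N" "j \<ge> N" "reach (K (pd R) - (X \<union> R ` {..<N})) (r i) u"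
        "t j (pd R) \<notin> X \<union> R ` {..<N}" for i u j
    proof
      assume "E u (t j (pd R))"
      then have E: "E u (R j)" using pdR(3) by simp
      have "reach (Z R - X) (r i) u" by (rule reach_mono[OF *(3)]) (use KZ in blast)
      moreover have "R j \<in> Z R - X" using tail_Z[of R j] *(2,4) N pdR(3) by simp
      ultimately show False using reach_step E no *(1,2) by blast
    qed
  qed
qed

lemma parent_ray_Z:
  assumes "poor R" "parent_ray W p r" "\<And>n. n \<ge> a \<Longrightarrow> r n \<in> Z R"
  shows "parent_ray (Z R) (pZ R) (\<lambda>n. r (n + a))"
  using assms p_Z[OF assms(1)] by (simp add: parent_ray_def) (metis le_SucI le_add2)

lemma parent_ray_K:
  assumes r: "parent_ray W p r" and d: "r a \<in> W" "r a \<notin> T" "r a \<notin> Zall" "\<And>n. n \<ge> a \<Longrightarrow> r n \<in> K (r a)"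
  shows "parent_ray (K (r a)) (pK (K (r a))) (\<lambda>n. r (n + a))"
  unfolding parent_ray_def
proof (intro allI conjI)
  fix n
  have i: "r (n + a) \<in> K (r a)" "r (Suc n + a) \<in> K (r a)" using d(4)[of "n + a"] d(4)[of "Suc n + a"] by auto
  then show "r (n + a) \<in> K (r a)" by blast
  have pr: "p (r (Suc n + a)) = Some (r (n + a))" using parent_ray_p_W[OF r] by simp
  note c = comp_branch[OF d(1,2) i(2)] and e = comp_eq[OF i(2)]
  have "r (Suc n + a) \<notin> Zall" using K_Zall[OF d(1-3)] i by blast
  moreover have "r (n + a) \<notin> T" using comp_branch(5)[OF d(1,2) i(1)] .
  ultimately show "pK (K (r a)) (r (Suc n + a)) = Some (r (n + a))"
    using p_K_cases[OF c(4,5) _ pr] e by auto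
qed

lemma p_ray_Z:
  assumes R: "poor R" and r: "parent_ray W p r" "\<And>n. n \<ge> a \<Longrightarrow> r n \<in> Z R"
  shows "isl W (K (pd R)) r" "\<not> lim W B r"
proof -
  have "\<not> lim (Z R) B (\<lambda>n. r (n + a))" using pZ_good[OF R] parent_ray_Z[OF R r] unfolding good_def by blast
  then have nl: "\<not> lim (Z R) B r" by (simp add: lim_shift[OF B_anti])
  show i: "isl W (K (pd R)) r" by (rule Z_isl[OF R p_ray_is_ray[OF r(1)] r(2) nl])
  show "\<not> lim W B r"
    using isl_lim[OF i _ B_anti] lim_mono[OF _ KZ, of R B r B] nl by blast
qed

lemma p_ray_K:
  assumes r: "parent_ray W p r" and d: "r a \<in> W" "r a \<notin> T" "r a \<notin> Zall" "\<And>n. n \<ge> a \<Longrightarrow> r n \<in> K (r a)"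
  shows "isl W (K (r a)) r" "\<not> lim W B r"
proof -
  have "\<not> lim (K (r a)) B' (\<lambda>n. r (n + a))"
    using pK_good[OF d(1,2)] parent_ray_K[OF r d] unfolding good_def by blast
  then have nl: "\<not> lim (K (r a)) B' r" by (simp add: lim_shift[OF B'_anti])
  show i: "isl W (K (r a)) r" by (rule K_isl[OF d(1,2,4) nl])
  show "\<not> lim W B r"
    using isl_lim[OF i _ B_anti] lim_mono[OF _ subset_refl, of "K (r a)" B r B'] nl by blast
qed

lemma killed_tail:
  assumes "killed R" shows "R k \<in> under \<or> R k \<in> Zall"
  by (rule killed_nodes_under) (use assms in \<open>auto simp: killed_nodes_def\<close>)

lemma p_ray_not_lim: assumes r: "parent_ray W p r" shows "\<not> lim W B r"
  using r
proof (cases rule: p_ray_tail)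
  case (Z a R) then show ?thesis using p_ray_Z(2)[OF _ r] by blast
next
  case (K a) then show ?thesis using p_ray_K(2)[OF r] by blast
next
  case (T a)
  obtain R where R: "normal_ray R" "\<And>n. r (n + a) = R (n + h (r a))" using tree_ray_normal[OF r T] by blast
  have "\<not> killed R" using killed_tail[of R "0 + h (r a)"] R(2)[of 0] T[of "0 + a"] by auto
  then have "\<not> lim W B (\<lambda>n. R (n + h (r a)))" using R(1) by (simp add: lim_shift[OF B_anti] killed_def)
  then show ?thesis using R(2) lim_shift[OF B_anti, of W r a] by simp
qed

text \<open>Deleting initial segments of both branches leaves a connecting path inside a cone of
  \<open>R\<close>; thus the cones meet at every height.\<close>

lemma normal_rays_eqv: assumes R: "normal_ray R" and S: "normal_ray S" and e: "eqv W R S" shows "R = S"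
proof (rule normal_ray_eqI[OF R S])
  fix k
  have "finite (R ` {..<k} \<union> S ` {..<k})" by simp
  then obtain i j where ij: "i \<ge> k" "j \<ge> k" "reach (W - (R ` {..<k} \<union> S ` {..<k})) (R i) (S j)"
    using e unfolding eqv_alt by blast
  have "S j \<in> cone R k" by (rule normal_ray_sep[OF R ij(3)]) (use normal_rayD(6)[OF R ij(1)] in auto)
  then show "\<exists>k'\<ge>k. cone R k' \<inter> cone S k' \<noteq> {}" using normal_rayD(6)[OF S ij(2)] by blast
qed

lemma tail_eq_sym: "tail_eq r s \<Longrightarrow> tail_eq s r"
  unfolding tail_eq_def by metis

text \<open>Confinement drags the equivalence and a tail of \<open>s\<close> into the component,
  where the forest from the induction hypothesis has only one ray per end. The two alternatives in
  \<open>rr\<close> are a rebuilt region and an ordinary component.\<close>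

lemma p_rays_eqv_isl:
  assumes r: "parent_ray W p r" and s: "parent_ray W p s" and e: "eqv W r s"
    and i: "isl W (K d) r" and d: "d \<in> W" "d \<notin> T"
    and rr: "(\<exists>R. poor R \<and> K d = K (pd R) \<and> (\<exists>a. \<forall>n\<ge>a. r n \<in> Z R)) \<or>
      (d \<notin> Zall \<and> (\<exists>a. r a \<in> W \<and> r a \<notin> T \<and> r a \<notin> Zall \<and> K (r a) = K d \<and> (\<forall>n\<ge>a. r n \<in> K (r a))))"
  shows "tail_eq r s"
proof -
  have eK: "eqv (K d) r s" by (rule isl_eqv[OF i e])
  obtain m where m: "\<And>n. n \<ge> m \<Longrightarrow> s n \<in> K d" using isl_tail[OF i e p_ray_is_ray[OF s]] by blast
  from rr show ?thesis
  proof (elim disjE exE conjE)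
    fix R a assume R: "poor R" "K d = K (pd R)" and a: "\<forall>n\<ge>a. r n \<in> Z R"
    have sZ: "s n \<in> Z R" if "n \<ge> m" for n using m[OF that] R(2) KZ by blast
    have "eqv (Z R) r s" using eqv_mono[OF eK] R(2) KZ by simp
    then have "eqv (Z R) (\<lambda>n. r (n + a)) (\<lambda>n. s (n + m))" by (simp add: eqv_shift_left eqv_shift_right)
    then have "tail_eq (\<lambda>n. r (n + a)) (\<lambda>n. s (n + m))"
      using pZ_good[OF R(1)] parent_ray_Z[OF R(1) r, of a] parent_ray_Z[OF R(1) s, of m] a sZ
      unfolding good_def by blast
    then show ?thesis by (rule tail_eq_shift)
  next
    fix a assume dZ: "d \<notin> Zall" and a: "r a \<in> W" "r a \<notin> T" "r a \<notin> Zall" "K (r a) = K d" "\<forall>n\<ge>a. r n \<in> K (r a)"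
    have sm: "s m \<in> K d" using m by simp
    note sc = comp_branch[OF d sm] and se = comp_eq[OF sm]
    have sZ: "s m \<notin> Zall" using K_Zall[OF d dZ] sm by blast
    have "eqv (K d) (\<lambda>n. r (n + a)) (\<lambda>n. s (n + m))" using eK by (simp add: eqv_shift_left eqv_shift_right)
    moreover have "parent_ray (K d) (pK (K d)) (\<lambda>n. r (n + a))" using parent_ray_K[OF r a(1-3)] a(4,5) by simp
    moreover have "parent_ray (K d) (pK (K d)) (\<lambda>n. s (n + m))" using parent_ray_K[OF s sc(4,5) sZ] se m by simp
    ultimately have "tail_eq (\<lambda>n. r (n + a)) (\<lambda>n. s (n + m))"
      using pK_good[OF d] unfolding good_def by blast
    then show ?thesis by (rule tail_eq_shift)
  qed
qed

lemma p_rays_eqv_off_tree: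
  assumes r: "parent_ray W p r" and s: "parent_ray W p s" and e: "eqv W r s"
    and nT: "\<not> (\<exists>a. \<forall>n\<ge>a. r n \<in> T \<and> r n \<notin> under \<and> r n \<notin> Zall)"
  shows "tail_eq r s"
  using r
proof (cases rule: p_ray_tail)
  case (Z a R)
  show ?thesis
    by (rule p_rays_eqv_isl[OF r s e p_ray_Z(1)[OF Z(1) r Z(2)] poorD(1,2)[OF Z(1)]]) (use Z in blast)+
next
  case (K a)
  show ?thesis
    by (rule p_rays_eqv_isl[OF r s e p_ray_K(1)[OF r K] K(1,2)]) (use K in blast)+
next
  case T then show ?thesis using nT by blast
qed

lemma p_rays_eqv:
  assumes r: "parent_ray W p r" and s: "parent_ray W p s" and e: "eqv W r s" shows "tail_eq r s"
proof (cases "(\<exists>a. \<forall>n\<ge>a. r n \<in> T \<and> r n \<notin> under \<and> r n \<notin> Zall) \<and> (\<exists>a. \<forall>n\<ge>a. s n \<in> T \<and> s n \<notin> under \<and> s n \<notin> Zall)")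
  case True
  then obtain a b where T: "\<And>n. n \<ge> a \<Longrightarrow> r n \<in> T \<and> r n \<notin> under \<and> r n \<notin> Zall"
    "\<And>n. n \<ge> b \<Longrightarrow> s n \<in> T \<and> s n \<notin> under \<and> s n \<notin> Zall" by blast
  obtain R where R: "normal_ray R" "\<And>n. r (n + a) = R (n + h (r a))" using tree_ray_normal[OF r T(1)] by blast
  obtain S where S: "normal_ray S" "\<And>n. s (n + b) = S (n + h (s b))" using tree_ray_normal[OF s T(2)] by blast
  have "eqv W (\<lambda>n. r (n + a)) (\<lambda>n. s (n + b))" using e by (simp add: eqv_shift_left eqv_shift_right)
  then have "eqv W R S" unfolding R(2) S(2) by (simp add: eqv_shift_left eqv_shift_right)
  then have "R = S" by (rule normal_rays_eqv[OF R(1) S(1)])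
  have "r (n + (h (s b) + a)) = s (n + (h (r a) + b))" for n
    using R(2)[of "n + h (s b)"] S(2)[of "n + h (r a)"] \<open>R = S\<close> by (simp add: ac_simps)
  then show ?thesis unfolding tail_eq_def by blast
next
  case False
  then show ?thesis using p_rays_eqv_off_tree[OF r s e] p_rays_eqv_off_tree[OF s r eqv_sym[OF e]] tail_eq_sym by blast
qed

section \<open>The induction step: all ends are covered\<close>

text \<open>The nodes may lie on different killed rays. With infinitely many pieces at every height
  \<open>rich_lim\<close> applies; otherwise beyond some height only one killed ray remains, and it
  is \<open>R\<close>.\<close>

lemma nodes_ray_lim: assumes R: "normal_ray R" and kn: "\<And>k. R k \<in> killed_nodes" shows "lim W B R"
proof (cases "\<exists>n. finite (piece ` (B n \<inter> cone R n))")
  case False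
  then show ?thesis using rich_lim[OF R B_anti] by blast
next
  case True
  then obtain n where n: "finite (piece ` (B n \<inter> cone R n))" by blast
  obtain m where deep: "\<And>b k. b \<in> B m \<Longrightarrow> b \<in> cone R m \<Longrightarrow> b \<in> cone R k"
    using finite_pieces_deep[OF R n] by blast
  obtain S where S: "killed S" "R m = S (h (R m))" using killed_nodesD(1)[OF kn] by blast
  then have "S m = R m" using normal_rayD(3)[OF R] by simp
  then have "S = R" using deep_isolates[OF R deep S(1)] by blast
  then show ?thesis using S(1) by (simp add: killed_def)
qed

text \<open>If \<open>R\<close> met rebuilt tails infinitely often, isolation would make the poor
  rays involved coincide, and \<open>R\<close> would be that killed ray.\<close>

lemma normal_tail_Zall:
  assumes R: "normal_ray R" and nk: "\<not> killed R" shows "\<exists>k0. \<forall>k\<ge>k0. R k \<notin> Zall"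
proof (rule ccontr)
  assume "\<not> ?thesis"
  then have inf: "\<exists>k\<ge>n. R k \<in> Zall" for n by blast
  have Zk: "\<exists>S. poor S \<and> pm S \<le> k \<and> R k = S k" if "R k \<in> Zall" for k
    using that Z_T[of _ "R k"] normal_rayD(2,3)[OF R] by (auto simp: Zall_def)
  obtain k1 where k1: "R k1 \<in> Zall" using inf by blast
  obtain S where S: "poor S" "pm S \<le> k1" "R k1 = S k1" using Zk[OF k1] by blast
  have nS: "normal_ray S" by (rule killedD(3)[OF S(1)])
  have "R = S"
  proof
    fix n
    obtain k where k: "k \<ge> max n k1" "R k \<in> Zall" using inf by blast
    obtain S' where S': "poor S'" "pm S' \<le> k" "R k = S' k" using Zk[OF k(2)] by blast
    have nS': "normal_ray S'" by (rule killedD(3)[OF S'(1)])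
    have "R (pm S) = S' (pm S)" by (rule normal_ray_share(2)[OF R nS' S'(3)]) (use S(2) k in simp)
    moreover have "R (pm S) = S (pm S)" by (rule normal_ray_share(2)[OF R nS S(3) S(2)])
    ultimately have "S' = S" using isolated[OF S(1) killedD(2)[OF S'(1)]] by simp
    moreover have "R n = S' n" by (rule normal_ray_share(2)[OF R nS' S'(3)]) (use k in simp)
    ultimately show "R n = S n" by simp
  qed
  then show False using nk S(1) killedD(2) by blast
qed

lemma killed_nodes_down: "R k \<in> killed_nodes \<Longrightarrow> normal_ray R \<Longrightarrow> j \<le> k \<Longrightarrow> R j \<in> killed_nodes"
proof -
  assume a: "R k \<in> killed_nodes" "normal_ray R" "j \<le> k"
  obtain S where S: "killed S" "R k = S (h (R k))" using killed_nodesD(1)[OF a(1)] by blast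
  have "R j = S j" by (rule normal_ray_share(2)[OF a(2) killedD(1)[OF S(1)] S(2) a(3)])
  then show ?thesis using S(1) by (auto simp: killed_nodes_def)
qed

text \<open>Beyond some height no node of \<open>R\<close> lies on a killed ray. Exits above such
  nodes can only belong to rich nodes lower on \<open>R\<close>, of which there are finitely many,
  each with one exit.\<close>

lemma normal_tail_under:
  assumes R: "normal_ray R" and nl: "\<not> lim W B R" shows "\<exists>k0. \<forall>k\<ge>k0. R k \<notin> under"
proof -
  obtain k0 where k0: "R k0 \<notin> killed_nodes" using nodes_ray_lim[OF R] nl by blast
  have kn: "R k \<notin> killed_nodes" if "k \<ge> k0" for k using killed_nodes_down[OF _ R that] k0 by blast
  \<comment> \<open>A bound for the heights of those exits. For \<open>R j\<close> not rich the
    value of \<open>attach\<close> is arbitrary and only adds to the bound.\<close>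
  define M where "M = Max (insert k0 ((\<lambda>j. h (fst (attach (R j)))) ` {..<k0}))"
  have M: "k0 \<le> M" "\<And>j. j < k0 \<Longrightarrow> h (fst (attach (R j))) \<le> M" by (auto simp: M_def)
  have "R k \<notin> under" if k: "k > M" for k
  proof
    assume "R k \<in> under"
    then obtain y where y: "y \<in> Y" "y \<in> cone R k" using normal_rayD(3)[OF R] by (auto simp: under_def)
    note yC = normal_ray_C_eq[OF R y(2)]
    have yT: "y \<in> T" using y(1) Y_T by blast
    have hy: "k \<le> h y" using yC T_C_iff[OF yT] by blast
    obtain e where "exit_to y e" using y(1) by (auto simp: Y_def)
    then consider (a) x where "x \<in> rich" "attach x = (y, e)" | (b) S where "poor S" "0 < pm S" "y = S (pm S - 1)"
      by (auto simp: exit_to_def)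
    then show False
    proof cases
      case b
      have S: "normal_ray S" by (rule killedD(3)[OF b(1)])
      have "h y = pm S - 1" using b(3) normal_rayD(3)[OF S] by simp
      then have "S k = t k y" using normal_rayD(8)[OF S] hy b(3) by simp
      then have "S k = R k" using yC by simp
      moreover have "S k \<in> killed_nodes" using killedD(2)[OF b(1)] by (auto simp: killed_nodes_def)
      ultimately show False using kn[of k] k M(1) by simp
    next
      case a
      have x: "x \<in> T" using richD a(1) by auto
      have yx: "y \<in> C (h x) x" using attach[OF a(1)] a(2) by (simp add: attach_ok_def)
      have Rk: "R k \<in> T" "h (R k) = k" using normal_rayD(2,3)[OF R] by auto
      show False
      proof (cases "k \<le> h x")
        case True
        have tx: "t k x = R k" using cone_compare[OF Rk(1) x, of y] Rk(2) y(2) yx True by simp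
        obtain S where S: "killed S" "x = S (h x)" using killed_nodesD(1) richD(1)[OF a(1)] by blast
        have "t k x = S k" using normal_rayD(8)[OF killedD(1)[OF S(1)] True] S(2) by simp
        then have "R k \<in> killed_nodes" using tx S(1) by (auto simp: killed_nodes_def)
        then show False using kn[of k] k M(1) by simp
      next
        case False
        have "t (h x) (R k) = x" using cone_compare[OF x Rk(1), of y] Rk(2) y(2) yx False by simp
        then have xR: "R (h x) = x" using normal_rayD(8)[OF R, of "h x" k] False by simp
        have "h x < k0" using kn[of "h x"] xR richD(1)[OF a(1)] by (metis not_le)
        then have "h y \<le> M" using M(2)[of "h x"] xR a(2) by simp
        then show False using hy k by simp
      qed
    qed
  qed
  then show ?thesis by (intro exI[of _ "Suc M"]) auto
qed

lemma covered_by_tree: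
  assumes R: "normal_ray R" and nl: "\<not> lim W B R"
  shows "\<exists>a. parent_ray W p (\<lambda>n. R (n + a))"
proof -
  obtain k1 where k1: "\<forall>k\<ge>k1. R k \<notin> under" using normal_tail_under[OF R nl] by blast
  obtain k2 where k2: "\<forall>k\<ge>k2. R k \<notin> Zall" using normal_tail_Zall[OF R] nl by (auto simp: killed_def)
  let ?a = "max k1 k2"
  have "p (R (Suc n + ?a)) = Some (R (n + ?a))" for n
  proof -
    have x: "R (Suc n + ?a) \<in> T" "R (Suc n + ?a) \<notin> under" "R (Suc n + ?a) \<notin> Zall" "h (R (Suc n + ?a)) = Suc (n + ?a)"
      using normal_rayD(2,3)[OF R] k1 k2 by auto
    have "t (n + ?a) (R (Suc n + ?a)) = R (n + ?a)" by (rule normal_rayD(8)[OF R]) linarith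
    then show ?thesis using p_rest(2)[OF x(1-3)] x(4) by simp
  qed
  then show ?thesis using normal_rayD(1)[OF R] unfolding parent_ray_def by blast
qed

lemma covered:
  assumes r: "is_ray W r" and nl: "\<not> lim W B r" shows "\<exists>s. parent_ray W p s \<and> eqv W r s"
proof -
  obtain R where R: "normal_ray R" and br: "\<And>k. \<exists>n. \<forall>i\<ge>n. r i \<in> C k (R k)" using ray_branch[OF r] by blast
  show ?thesis
  proof (cases "eqv W r R")
    case True
    have "\<not> lim W B R" using lim_cong_eqv[OF True normal_ray_is_ray[OF R]] nl by blast
    then obtain a where "parent_ray W p (\<lambda>n. R (n + a))" using covered_by_tree[OF R] by blast
    then show ?thesis using True eqv_shift_right by blast
  next
    case ne: False
    obtain n where n: "r n \<in> W" "r n \<notin> T" "\<And>k. t k (r n) = R k" "\<And>i. i \<ge> n \<Longrightarrow> r i \<in> K (r n)"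
      using non_branch_ray[OF r R br ne] by blast
    let ?D = "K (r n)" and ?r = "\<lambda>i. r (i + n)"
    have rD: "is_ray ?D ?r" by (rule ray_shift_into[OF r n(4)])
    show ?thesis
    proof (cases "r n \<in> Zall")
      case True
      then obtain S where S: "poor S" "r n \<in> Z S" by (auto simp: Zall_def)
      have "?D \<subseteq> Z S" using Z_notT[OF S n(2)] KZ by simp
      then have rZ: "is_ray (Z S) ?r" by (rule ray_mono[OF rD])
      have "\<not> lim (Z S) B ?r" using lim_mono[OF _ Z_W[OF S(1)], of B r B] nl lim_shift[OF B_anti] by blast
      then obtain s where s: "parent_ray (Z S) (pZ S) s" "eqv (Z S) ?r s"
        using pZ_good[OF S(1)] rZ unfolding good_def by blast
      have "parent_ray W p s" using s(1) p_Z[OF S(1)] Z_W[OF S(1)] by (auto simp: parent_ray_def)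
      moreover have "eqv W r s" using eqv_mono[OF s(2) Z_W[OF S(1)]] by (simp add: eqv_shift_left)
      ultimately show ?thesis by blast
    next
      case nZ: False
      have DW: "?D \<subseteq> W" using comp_subset by blast
      have 1: "\<not> lim ?D B ?r" using lim_mono[OF _ DW, of B ?r B] nl lim_shift[OF B_anti] by blast
      \<comment> \<open>Being close to neighbours of ever higher nodes would make the ray equivalent
        to its branch \<open>R\<close>, the case already settled.\<close>
      have 2: "\<not> lim ?D nbrs_above ?r"
      proof
        assume l: "lim ?D nbrs_above ?r"
        have "eqv W ?r R" unfolding eqv_alt
        proof (intro allI impI)
          fix X :: "'a set" and k :: nat assume X: "finite X"
          obtain k1 where k1: "\<forall>j\<ge>k1. R j \<notin> X"
            using inj_avoid[of R X] normal_ray_is_ray[OF R] X by (auto simp: is_ray_def)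
          obtain i u where iu: "i \<ge> max k k1" "u \<in> nbrs_above (max k k1)" "reach (?D - X) (?r i) u"
            using limE[OF l X] by metis
          obtain v where v: "v \<in> T" "max k k1 \<le> h v" "E u v" using iu(2) by (auto simp: nbrs_above_def)
          have "u \<in> ?D" using reach_in[OF iu(3)] by blast
          note u = comp_branch[OF n(1,2) this]
          have vR: "R (h v) = v" using nbr_T[OF u(4,5) v(1,3)] u(3) n(3) by simp
          have "reach (W - X) (?r i) u" by (rule reach_mono[OF iu(3)]) (use DW in blast)
          moreover have "R (h v) \<in> W - X" using k1 v(2) normal_rayD(1)[OF R] by simp
          ultimately have "reach (W - X) (?r i) (R (h v))" using reach_step v(3) vR by metis
          then show "\<exists>i\<ge>k. \<exists>j\<ge>k. reach (W - X) (?r i) (R j)" using iu(1) v(2) by (meson max.boundedE)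
        qed
        then show False using ne by (simp add: eqv_shift_left)
      qed
      have "\<not> lim ?D B' ?r" using 1 2 lim_union[OF B_anti nbrs_above_anti] by blast
      then obtain s where s: "parent_ray ?D (pK ?D) s" "eqv ?D ?r s"
        using pK_good[OF n(1,2)] rD unfolding good_def by blast
      have "parent_ray W p s" unfolding parent_ray_def
      proof (intro allI conjI)
        fix k
        have k: "s k \<in> ?D" "s (Suc k) \<in> ?D" "pK ?D (s (Suc k)) = Some (s k)" using s(1) by (auto simp: parent_ray_def)
        show "s k \<in> W" using k(1) DW by blast
        note c = comp_branch[OF n(1,2) k(2)] and e = comp_eq[OF k(2)]
        have "s (Suc k) \<notin> Zall" using K_Zall[OF n(1,2) nZ] k(2) by blast
        then show "p (s (Suc k)) = Some (s k)" using p_K_Some[OF c(4,5)] k(3) e by simp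
      qed
      moreover have "eqv W r s" using eqv_mono[OF s(2) DW] by (simp add: eqv_shift_left)
      ultimately show ?thesis by blast
    qed
  qed
qed

lemma p_good: "good W B p"
  unfolding good_def using p_None p_Some p_terminates p_ray_not_lim p_rays_eqv covered by blast

end

context sgraph begin

text \<open>The class of graphs having a rank: the ordinal rank function is replaced by the
  induction principle.\<close>

inductive traceable :: "'a set \<Rightarrow> 'a set \<Rightarrow> bool" for V where
  traceable: "sigma_dispersed V U \<Longrightarrow> (\<And>d. d \<in> W - U \<Longrightarrow> traceable V (comp (W - U) d)) \<Longrightarrow> traceable V W"

lemma traceable_mono: "traceable V W \<Longrightarrow> W' \<subseteq> W \<Longrightarrow> traceable V W'"
proof (induction arbitrary: W' rule: traceable.induct)
  case (traceable U W)
  show ?case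
  proof (rule traceable.traceable[OF traceable.hyps(1)])
    fix d assume d: "d \<in> W' - U"
    have "comp (W' - U) d \<subseteq> comp (W - U) d"
      unfolding comp_def using traceable.prems by (auto intro: reach_mono)
    then show "traceable V (comp (W' - U) d)" using traceable.IH d traceable.prems by blast
  qed
qed

text \<open>The vertices in \<open>W' - W\<close> are needed because the induction step attaches to a component
  the tail of a normal ray converging to it.\<close>

lemma traceable_good:
  assumes "traceable V W" "conn W'" "W' \<subseteq> V" "sigma_dispersed V (W' - W)" "antimono B" "b \<in> B 0" "b \<in> W'"
  shows "\<exists>p. good W' B p"
  using assms
proof (induction arbitrary: W' B b rule: traceable.induct)
  case (traceable U W)
  \<comment> \<open>The normal tree must also absorb the extra vertices \<open>W' - W\<close>; then
    every component it leaves lies inside a component of \<open>W - U\<close>.\<close>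
  have "sigma_dispersed V (U \<union> (W' - W))" using sigma_dispersed_Un traceable.hyps(1) traceable.prems(3) by blast
  then obtain C t where ns: "normal_structure E W' C t" "\<And>w. t 0 w = b"
    and U: "(U \<union> (W' - W)) \<inter> W' \<subseteq> normal_structure.T W' C t"
    using normal_structure_exists[OF traceable.prems(1,6,2)] by blast
  interpret normal_structure E W' C t by (rule ns(1))
  interpret induction_step E W' C t B
  proof
    show "antimono B" by (rule traceable.prems)
    show "t 0 w \<in> B 0" for w using ns(2) traceable.prems by simp
    show "\<exists>p. good (comp (W' - T) d \<union> F) B' p"
      if d: "d \<in> W'" "d \<notin> T" and F: "F \<subseteq> range f" "F \<subseteq> W'" and c: "conn (comp (W' - T) d \<union> F)"
        and B': "antimono B'" "b \<in> B' 0" "b \<in> comp (W' - T) d \<union> F" for d F B' b and f :: "nat \<Rightarrow> 'a"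
    proof -
      have sub: "W' - T \<subseteq> W - U" using U by blast
      then have cs: "comp (W' - T) d \<subseteq> comp (W - U) d" unfolding comp_def by (auto intro: reach_mono)
      have dU: "d \<in> W - U" using sub d by blast
      show ?thesis
      proof (rule traceable.IH[OF dU c _ _ B'])
        show "comp (W' - T) d \<union> F \<subseteq> V" using comp_subset[of "W' - T" d] F(2) traceable.prems(2) by blast
        show "sigma_dispersed V (comp (W' - T) d \<union> F - comp (W - U) d)"
          by (rule sigma_dispersed_mono[OF sigma_dispersed_range[of V f]]) (use cs F(1) in blast)
      qed
    qed
  qed
  show ?case using p_good by blast
qed

end

section \<open>From parent functions to spanning trees\<close>

lemma sgraph_adj: "sgraph (adj G)"
  by unfold_locales (simp add: adj_commute)

lemma rays_subgraph:
  assumes "subgraph H G" "r \<in> rays H" shows "r \<in> rays G"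
  using assms(2) adj_subgraph[OF assms(1)] assms(1) by (auto simp: rays_def ray_def subgraph_def)

context
  fixes G :: "'a ugraph"
  assumes G: "is_graph G"
begin

interpretation sgraph "adj G" by (rule sgraph_adj)

lemma reach_delete_verts:
  assumes "d \<in> verts G - X"
  shows "(adj (delete_verts G X))\<^sup>*\<^sup>* d v \<longleftrightarrow> reach (verts G - X) d v"
proof
  have a: "adj (delete_verts G X) u v \<longleftrightarrow> adj G u v \<and> u \<notin> X \<and> v \<notin> X" for u v
    by (auto simp: adj_def delete_verts_def)
  show "(adj (delete_verts G X))\<^sup>*\<^sup>* d v \<Longrightarrow> reach (verts G - X) d v"
  proof (induction rule: rtranclp_induct)
    case (step y z)
    then show ?case using is_graph_edgeD[OF G, of y z] a reach_step by blast
  qed (use assms reach_refl in blast)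
  show "reach (verts G - X) d v \<Longrightarrow> (adj (delete_verts G X))\<^sup>*\<^sup>* d v"
  proof (induction rule: reach_induct)
    case (step b c)
    then have "b \<notin> X" "c \<notin> X" using reach_in by blast+
    then show ?case using step a rtranclp.rtrancl_into_rtrancl[of "adj (delete_verts G X)" d b c] by blast
  qed simp
qed

lemma delete_verts_empty: "delete_verts G {} = G"
  by (cases G) (simp add: delete_verts_def)

lemma conn_verts: "connected G \<Longrightarrow> conn (verts G)"
  using reach_delete_verts[of _ "{}"] by (simp add: conn_def connected_iff_rtranclp delete_verts_empty)

lemma rays_iff: "r \<in> rays G \<longleftrightarrow> is_ray (verts G) r"
  by (auto simp: rays_def ray_def is_ray_def)

lemma reach_path:
  assumes "S \<subseteq> verts G" "reach S a b"
  shows "\<exists>q. path_between G a q b \<and> set q \<subseteq> S"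
proof -
  let ?D = "delete_verts G (verts G - S)"
  have S: "verts G - (verts G - S) = S" using assms(1) by blast
  have a: "a \<in> S" using reach_in[OF assms(2)] by blast
  have "(adj ?D)\<^sup>*\<^sup>* a b" using reach_delete_verts[of a "verts G - S" b] assms(2) a unfolding S by blast
  moreover have aD: "a \<in> verts ?D" using a assms(1) by (auto simp: delete_verts_def)
  ultimately obtain q where q: "path_between ?D a q b"
    using path_between_iff_rtranclp[OF is_graph_delete_verts[OF G] aD] by blast
  have "successively (adj G) q"
    by (rule successively_mono[of "adj ?D"]) (use q in \<open>auto simp: path_between_def path_def adj_def delete_verts_def\<close>)
  then have "path_between G a q b \<and> set q \<subseteq> S"
    using q assms(1) by (auto simp: path_between_def path_def delete_verts_def)
  then show ?thesis ..
qed

lemma path_reach: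
  assumes "path G q" "set q \<subseteq> S" shows "reach S (hd q) (last q)"
proof -
  have "successively (step S) q"
    using assms by (auto simp: path_def successively_conv_nth step_def)
  then have "(step S)\<^sup>*\<^sup>* (hd q) (last q)" using successively_imp_rtranclp assms(1) by (auto simp: path_def)
  then show ?thesis using assms by (auto simp: reach_def path_def)
qed

lemma ray_equiv_iff:
  "(r, s) \<in> ray_equiv G \<longleftrightarrow> r \<in> rays G \<and> s \<in> rays G \<and> eqv (verts G) r s"
proof
  assume rs: "(r, s) \<in> ray_equiv G"
  have "\<exists>i\<ge>n. \<exists>j\<ge>n. reach (verts G - X) (r i) (s j)" if X: "finite X" for X n
  proof -
    \<comment> \<open>\<open>ray_equiv\<close> quantifies over sets of vertices of \<open>G\<close>
      only, whereas \<open>eqv\<close> allows any finite set.\<close>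
    let ?X = "X \<inter> verts G"
    obtain D where D: "component (delete_verts G ?X) D" "has_tail_in r D" "has_tail_in s D"
      using rs X by (auto simp: ray_equiv_def)
    then obtain k m where k: "\<forall>i\<ge>k. r i \<in> verts D" "\<forall>i\<ge>m. s i \<in> verts D" by (auto simp: has_tail_in_def)
    let ?i = "max n (max k m)"
    have i: "r ?i \<in> verts D" "s ?i \<in> verts D" using k by auto
    have "verts D \<subseteq> verts G - ?X" using D(1) by (auto simp: component_def subgraph_def delete_verts_def)
    then have ri: "r ?i \<in> verts G - ?X" using i(1) by blast
    have "(adj (delete_verts G ?X))\<^sup>*\<^sup>* (r ?i) (s ?i)" using i(2) unfolding component_verts(1)[OF D(1) i(1)] by blast
    then have "reach (verts G - ?X) (r ?i) (s ?i)" using reach_delete_verts[OF ri] by blast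
    moreover have "verts G - ?X = verts G - X" by blast
    ultimately show ?thesis by (metis max.cobounded1)
  qed
  then show "r \<in> rays G \<and> s \<in> rays G \<and> eqv (verts G) r s" using rs by (auto simp: ray_equiv_def eqv_alt)
next
  assume rs: "r \<in> rays G \<and> s \<in> rays G \<and> eqv (verts G) r s"
  have "\<exists>D. component (delete_verts G X) D \<and> has_tail_in r D \<and> has_tail_in s D" if X: "finite X" for X
  proof -
    obtain D where D: "component (delete_verts G X) D" "has_tail_in r D"
      using ray_has_tail_in_component[OF G _ X] rs by blast
    obtain F where F: "component (delete_verts G X) F" "has_tail_in s F"
      using ray_has_tail_in_component[OF G _ X] rs by blast
    obtain k m where k: "\<forall>i\<ge>k. r i \<in> verts D" "\<forall>i\<ge>m. s i \<in> verts F"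
      using D(2) F(2) by (auto simp: has_tail_in_def)
    obtain i j where ij: "i \<ge> max k m" "j \<ge> max k m" "reach (verts G - X) (r i) (s j)"
      using rs X unfolding eqv_alt by metis
    have i: "r i \<in> verts D" "s j \<in> verts F" using k ij by auto
    have "r i \<in> verts G - X" using reach_in[OF ij(3)] by blast
    then have "s j \<in> verts D" using component_verts(1)[OF D(1) i(1)] reach_delete_verts ij(3) by simp
    then have "D = F" using component_eqI[OF D(1) F(1)] i(2) by blast
    then show ?thesis using D F by blast
  qed
  then show "(r, s) \<in> ray_equiv G" using rs by (auto simp: ray_equiv_def)
qed

lemma tail_eq_ray_equiv:
  assumes r: "r \<in> rays G" and s: "s \<in> rays G" and e: "tail_eq r s" shows "(r, s) \<in> ray_equiv G"
proof -
  obtain a b where ab: "\<And>n. r (n + a) = s (n + b)" using e by (auto simp: tail_eq_def)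
  have "eqv (verts G) r (\<lambda>n. r (n + a))" using eqv_refl r rays_iff eqv_shift_right by blast
  then have "eqv (verts G) r s" unfolding ab by (simp add: eqv_shift_right)
  then show ?thesis using r s ray_equiv_iff by blast
qed

end

definition parent_graph :: "'a set \<Rightarrow> ('a \<Rightarrow> 'a option) \<Rightarrow> 'a ugraph" where
  "parent_graph V p = Graph V {{x, y} | x y. x \<in> V \<and> p x = Some y}"

text \<open>A potential that drops by one at each step to the parent, used against cycles and
  against rays running to the root. The final step to \<open>None\<close> is counted.\<close>

definition steps_to_root :: "('a \<Rightarrow> 'a option) \<Rightarrow> 'a \<Rightarrow> nat" where
  "steps_to_root p x = (LEAST n. ((\<lambda>a. Option.bind a p) ^^ n) (Some x) = None)"

lemma steps_to_root_Some:
  assumes "terminates p x" "p x = Some y" shows "steps_to_root p x = Suc (steps_to_root p y)"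
proof -
  let ?f = "\<lambda>a. Option.bind a p"
  have shift: "(?f ^^ Suc n) (Some z) = (?f ^^ n) (p z)" for n z by (simp add: funpow_Suc_right del: funpow.simps)
  have "\<exists>n. (?f ^^ n) (Some x) = None" using assms(1)
  proof (induction rule: terminates.induct)
    case (1 z) then show ?case by (intro exI[of _ 1]) simp
  next
    case (2 z w)
    then obtain n where "(?f ^^ n) (Some w) = None" by blast
    then show ?case using shift[of n z] 2(1) by (intro exI[of _ "Suc n"]) simp
  qed
  then obtain n where "(?f ^^ n) (Some x) = None" ..
  then have "(LEAST n. (?f ^^ n) (Some x) = None) = Suc (LEAST n. (?f ^^ Suc n) (Some x) = None)"
    by (rule Least_Suc) simp
  then show ?thesis unfolding steps_to_root_def shift assms(2) .
qed

context
  fixes G :: "'a ugraph" and p :: "'a \<Rightarrow> 'a option" and B :: "nat \<Rightarrow> 'a set" and v0 :: 'a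
  assumes G: "is_graph G" and v0: "v0 \<in> verts G"
    and B: "B = (\<lambda>n. if n = 0 then {v0} else {})"
    and good: "sgraph.good (adj G) (verts G) B p"
begin

interpretation sgraph "adj G" by (rule sgraph_adj)

abbreviation (input) "PT \<equiv> parent_graph (verts G) p"

lemma pg_good:
  shows "x \<in> verts G \<Longrightarrow> p x = None \<Longrightarrow> x = v0" "x \<in> verts G \<Longrightarrow> p x = Some y \<Longrightarrow> y \<in> verts G \<and> adj G x y"
    "x \<in> verts G \<Longrightarrow> terminates p x"
    "parent_ray (verts G) p r \<Longrightarrow> parent_ray (verts G) p s \<Longrightarrow> eqv (verts G) r s \<Longrightarrow> tail_eq r s"
    "is_ray (verts G) r \<Longrightarrow> \<exists>s. parent_ray (verts G) p s \<and> eqv (verts G) r s"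
proof -
  \<comment> \<open>\<open>B 1\<close> is empty, so no end is exempt from representation, while
    \<open>B 0\<close> leaves \<open>v0\<close> as the only possible root.\<close>
  have "\<not> lim (verts G) B r" for r
  proof
    assume "lim (verts G) B r"
    then obtain b where "b \<in> B (Suc 0)" using limE[OF _ finite.emptyI] by metis
    then show False by (simp add: B)
  qed
  then show "x \<in> verts G \<Longrightarrow> p x = None \<Longrightarrow> x = v0" "x \<in> verts G \<Longrightarrow> p x = Some y \<Longrightarrow> y \<in> verts G \<and> adj G x y"
    "x \<in> verts G \<Longrightarrow> terminates p x"
    "parent_ray (verts G) p r \<Longrightarrow> parent_ray (verts G) p s \<Longrightarrow> eqv (verts G) r s \<Longrightarrow> tail_eq r s"
    "is_ray (verts G) r \<Longrightarrow> \<exists>s. parent_ray (verts G) p s \<and> eqv (verts G) r s"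
    using good B unfolding good_def by auto
qed

lemma pg_verts: "verts PT = verts G" by (simp add: parent_graph_def)

lemma pg_adj: "adj PT x y \<longleftrightarrow> x \<in> verts G \<and> p x = Some y \<or> y \<in> verts G \<and> p y = Some x"
  by (auto simp: parent_graph_def adj_def doubleton_eq_iff)

lemma pg_subgraph: "subgraph PT G"
proof -
  have "e \<in> edges G" if "e \<in> edges PT" for e
    using that pg_good(2) by (auto simp: parent_graph_def adj_def)
  then show ?thesis using G by (auto simp: subgraph_def is_graph_def parent_graph_def)
qed

lemma pg_connected: "connected PT"
proof -
  have "(adj PT)\<^sup>*\<^sup>* x b" if "leads p x b" "x \<in> verts G" for x b
    using that
  proof (induction rule: leads_induct)
    case (step a c)
    then have "adj PT a c" "c \<in> verts G" using pg_good(2) by (auto simp: pg_adj)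
    then show ?case using step.IH converse_rtranclp_into_rtranclp by metis
  qed simp
  moreover have "\<exists>b. leads p x b \<and> b = v0" if x: "x \<in> verts G" for x
  proof -
    obtain b where b: "leads p x b" "p b = None" using terminates_leads[OF pg_good(3)[OF x]] by blast
    have "b \<in> verts G" using b(1) x
    proof (induction rule: leads_induct)
      case (step a c) then show ?case using pg_good(2) by blast
    qed
    then show ?thesis using b pg_good(1) by blast
  qed
  ultimately have to: "(adj PT)\<^sup>*\<^sup>* x v0" if "x \<in> verts G" for x using that by blast
  have "(adj PT)\<^sup>*\<^sup>* x y" if "x \<in> verts G" "y \<in> verts G" for x y
    using to[OF that(1)] rtranclp_adj_sym[OF to[OF that(2)]] by (rule rtranclp_trans)
  then show ?thesis using pg_subgraph v0 by (auto simp: connected_iff_rtranclp subgraph_def pg_verts)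
qed

lemma steps: "x \<in> verts G \<Longrightarrow> p x = Some y \<Longrightarrow> steps_to_root p x = Suc (steps_to_root p y)"
  using steps_to_root_Some pg_good(3) by metis

text \<open>On a cycle, both neighbours of a vertex farthest from the root would be its parent.\<close>

lemma pg_acyclic: "\<not> cycle PT q"
proof
  assume q: "cycle PT q"
  let ?n = "length q"
  have n: "?n \<ge> 3" "distinct q" "set q \<subseteq> verts G" using q by (auto simp: cycle_def path_def pg_verts)
  have ad: "adj PT (q ! j) (q ! (Suc j mod ?n))" if "j < ?n" for j
  proof (cases "Suc j < ?n")
    case True
    then show ?thesis using q by (auto simp: cycle_def path_def successively_conv_nth)
  next
    case False
    then have j: "j = ?n - 1" using that by simp
    have "q \<noteq> []" using n(1) by (cases q) auto
    then show ?thesis using q n j by (simp add: cycle_def last_conv_nth hd_conv_nth)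
  qed
  define f where "f j = steps_to_root p (q ! j)" for j
  have "finite (f ` {..<?n})" "f ` {..<?n} \<noteq> {}" using n by (auto simp: lessThan_empty_iff)
  then obtain i where i: "i < ?n" "\<And>j. j < ?n \<Longrightarrow> f j \<le> f i"
    using Max_in[of "f ` {..<?n}"] Max_ge[of "f ` {..<?n}"] by (metis imageE imageI lessThan_iff)
  have par: "p (q ! i) = Some (q ! j)" if "j < ?n" "adj PT (q ! i) (q ! j)" for j
  proof (rule ccontr)
    assume "p (q ! i) \<noteq> Some (q ! j)"
    then have "q ! j \<in> verts G" "p (q ! j) = Some (q ! i)" using that(2) by (auto simp: pg_adj)
    then have "f j = Suc (f i)" unfolding f_def by (rule steps)
    then show False using i(2)[OF that(1)] by simp
  qed
  define k where "k = (if i = 0 then ?n - 1 else i - 1)"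
  have k: "k < ?n" "Suc k mod ?n = i" using i(1) n(1) by (auto simp: k_def)
  have m: "Suc i mod ?n < ?n" using n(1) by (intro mod_less_divisor) linarith
  have "adj PT (q ! i) (q ! k)" using ad[OF k(1)] k(2) adj_commute by metis
  then have "q ! k = q ! (Suc i mod ?n)" using par[OF k(1)] par[OF m ad[OF i(1)]] by simp
  then have "k = Suc i mod ?n" using nth_eq_iff_index_eq[OF n(2) k(1) m] by simp
  then show False using i(1) n(1) unfolding k_def by (cases "Suc i = ?n") (auto split: if_splits)
qed

text \<open>Steps towards the root lower \<open>steps_to_root\<close>, so some step leads away from
  it. After that injectivity forbids turning back, since parents are unique.\<close>

lemma pg_ray_tail: assumes "r \<in> rays PT" shows "\<exists>a. parent_ray (verts G) p (\<lambda>n. r (n + a))"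
proof -
  have r: "inj r" "\<And>n. r n \<in> verts G" "\<And>n. adj PT (r n) (r (Suc n))"
    using assms by (auto simp: rays_def ray_def pg_verts)
  have persist: "p (r (Suc (Suc n))) = Some (r (Suc n))" if "p (r (Suc n)) = Some (r n)" for n
  proof (rule ccontr)
    assume "\<not> ?thesis"
    then have "p (r (Suc n)) = Some (r (Suc (Suc n)))" using r(3)[of "Suc n"] by (simp add: pg_adj)
    then have "r n = r (Suc (Suc n))" using that by simp
    then show False using r(1) by (auto dest: injD)
  qed
  have "\<exists>a. p (r (Suc a)) = Some (r a)"
  proof (rule ccontr)
    assume no: "\<not> ?thesis"
    then have d: "p (r n) = Some (r (Suc n))" for n using r(3)[of n] by (auto simp: pg_adj)
    have "steps_to_root p (r n) + n = steps_to_root p (r 0)" for n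
    proof (induction n)
      case (Suc n) then show ?case using steps[OF r(2)[of n] d[of n]] by simp
    qed simp
    from this[of "Suc (steps_to_root p (r 0))"] show False by simp
  qed
  then obtain a where a: "p (r (Suc a)) = Some (r a)" ..
  have "p (r (Suc n + a)) = Some (r (n + a))" for n
    by (induction n) (use a persist in auto)
  then show ?thesis using r(2) unfolding parent_ray_def by auto
qed

lemma pg_parent_ray: assumes "parent_ray (verts G) p r" shows "r \<in> rays PT" "r \<in> rays G"
proof -
  have "inj r" by (rule parent_ray_inj[OF assms pg_good(3)])
  moreover have "adj PT (r n) (r (Suc n))" for n using assms by (auto simp: parent_ray_def pg_adj)
  moreover have "range r \<subseteq> verts G" using assms by (auto simp: parent_ray_def)
  ultimately show "r \<in> rays PT" by (simp add: rays_def ray_def pg_verts)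
  then show "r \<in> rays G" by (rule rays_subgraph[OF pg_subgraph])
qed

lemma pg_end_faithful: "end_faithful_spanning_tree G PT"
proof -
  have T: "is_graph PT" using pg_subgraph by (simp add: subgraph_def)
  note em = end_map[OF pg_subgraph]
  have eT: "equiv (rays PT) (ray_equiv PT)" and eG: "equiv (rays G) (ray_equiv G)"
    using equiv_ray_equiv T G by auto
  have inj: "inj_on (end_map PT G) (ends PT)"
  proof (rule inj_onI)
    fix \<eta> \<theta> assume \<eta>: "\<eta> \<in> ends PT" and \<theta>: "\<theta> \<in> ends PT" and eq: "end_map PT G \<eta> = end_map PT G \<theta>"
    obtain r where r: "r \<in> rays PT" "\<eta> = ray_equiv PT `` {r}" using \<eta> by (auto simp: ends_def elim: quotientE)
    obtain s where s: "s \<in> rays PT" "\<theta> = ray_equiv PT `` {s}" using \<theta> by (auto simp: ends_def elim: quotientE)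
    have "r \<in> end_map PT G \<eta>" using em(2)[OF \<eta>] equiv_class_self[OF eT r(1)] r(2) by blast
    moreover have "s \<in> end_map PT G \<eta>" using em(2)[OF \<theta>] equiv_class_self[OF eT s(1)] s(2) eq by blast
    ultimately have "(r, s) \<in> ray_equiv G"
      using em(1)[OF \<eta>] quotient_eq_iff[OF eG] unfolding ends_def by metis
    then have e: "eqv (verts G) r s" using ray_equiv_iff[OF G] by blast
    obtain a where a: "parent_ray (verts G) p (\<lambda>n. r (n + a))" using pg_ray_tail[OF r(1)] by blast
    obtain b where b: "parent_ray (verts G) p (\<lambda>n. s (n + b))" using pg_ray_tail[OF s(1)] by blast
    have "eqv (verts G) (\<lambda>n. r (n + a)) (\<lambda>n. s (n + b))" using e by (simp add: eqv_shift_left eqv_shift_right)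
    then have "tail_eq r s" using pg_good(4)[OF a b] tail_eq_shift by blast
    then have "(r, s) \<in> ray_equiv PT" using tail_eq_ray_equiv[OF T r(1) s(1)] by blast
    then show "\<eta> = \<theta>" using equiv_class_eq[OF eT] r(2) s(2) by simp
  qed
  have surj: "end_map PT G ` ends PT = ends G"
  proof
    show "end_map PT G ` ends PT \<subseteq> ends G" using em(1) by blast
    show "ends G \<subseteq> end_map PT G ` ends PT"
    proof
      fix \<omega> assume \<omega>: "\<omega> \<in> ends G"
      then obtain r where r: "r \<in> rays G" "\<omega> = ray_equiv G `` {r}" by (auto simp: ends_def elim: quotientE)
      obtain s where s: "parent_ray (verts G) p s" "eqv (verts G) r s"
        using pg_good(5) rays_iff[OF G] r(1) by blast
      note sr = pg_parent_ray[OF s(1)]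
      let ?\<eta> = "ray_equiv PT `` {s}"
      have \<eta>: "?\<eta> \<in> ends PT" using sr(1) by (auto simp: ends_def intro: quotientI)
      have "s \<in> end_map PT G ?\<eta>" using em(2)[OF \<eta>] equiv_class_self[OF eT sr(1)] by blast
      moreover have "s \<in> \<omega>" using s(2) r sr(2) ray_equiv_iff[OF G] by auto
      ultimately have "\<omega> = end_map PT G ?\<eta>"
        using quotient_disj[OF eG] em(1)[OF \<eta>] \<omega> unfolding ends_def by blast
      then show "\<omega> \<in> end_map PT G ` ends PT" using \<eta> by blast
    qed
  qed
  show ?thesis unfolding end_faithful_spanning_tree_def spanning_tree_def tree_def bij_betw_def
    using pg_subgraph pg_connected pg_acyclic pg_verts inj surj by blast
qed

end

lemma traceable_end_faithful:
  assumes c: "connected G" and tr: "sgraph.traceable (adj G) (verts G) (verts G)"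
  shows "\<exists>T. end_faithful_spanning_tree G T"
proof -
  interpret sgraph "adj G" by (rule sgraph_adj)
  have G: "is_graph G" using c by (simp add: connected_def)
  obtain v0 where v0: "v0 \<in> verts G" using c by (auto simp: connected_def)
  define B where "B = (\<lambda>n :: nat. if n = 0 then {v0} else {})"
  have "antimono B" by (auto simp: antimono_def B_def)
  moreover have "sigma_dispersed (verts G) (verts G - verts G)"
    by (rule sigma_dispersed_mono[OF sigma_dispersed_range]) simp
  moreover have "v0 \<in> B 0" by (simp add: B_def)
  ultimately obtain p where "good (verts G) B p"
    using traceable_good[OF tr conn_verts[OF G c]] v0 by blast
  then show ?thesis using pg_end_faithful[OF G v0 B_def] by blast
qed

section \<open>Normally spanned sets\<close>

lemma path_prefix:
  assumes "path G (l @ r)" "l \<noteq> []" shows "path G l"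
  using assms by (auto simp: path_def successively_append_iff)

lemma path_suffix:
  assumes "path G (l @ r)" "r \<noteq> []" shows "path G r"
  using assms by (auto simp: path_def successively_append_iff)

text \<open>Where two paths first diverge at \<open>u\<close>, their remainders connect the two next
  vertices without \<open>u\<close> and close a cycle through it.\<close>

lemma tree_path_unique:
  assumes T: "is_graph T" and ac: "\<nexists>q. cycle T q"
  shows "path_between T u l v \<Longrightarrow> path_between T u m v \<Longrightarrow> l = m"
proof (induction l arbitrary: u m)
  case Nil then show ?case by (simp add: path_between_def path_def)
next
  case (Cons x l)
  have x: "x = u" using Cons.prems(1) by (simp add: path_between_def)
  obtain m' where m: "m = u # m'" using Cons.prems(2) by (cases m) (auto simp: path_between_def path_def)
  have dl: "u \<notin> set l" "u \<notin> set m'" using Cons.prems x m by (auto simp: path_between_def path_def)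
  have lastl: "last (u # l) = v" "last (u # m') = v" using Cons.prems x m by (auto simp: path_between_def)
  show ?case
  proof (cases "l = [] \<or> m' = []")
    case True
    have "l = [] \<longleftrightarrow> m' = []" using lastl dl by (metis last.simps last_in_set)
    then show ?thesis using True x m by simp
  next
    case False
    then obtain a l' b m'' where ab: "l = a # l'" "m' = b # m''" by (meson list.exhaust)
    have pl: "path_between T a l v" "adj T u a"
      using Cons.prems(1) x ab by (auto simp: path_between_def path_def)
    have pm: "path_between T b m' v" "adj T u b"
      using Cons.prems(2) m ab by (auto simp: path_between_def path_def)
    show ?thesis
    proof (cases "a = b")
      case True then show ?thesis using Cons.IH[OF pl(1), of m'] pm x m by simp
    next
      case ne: False
      let ?D = "delete_verts T {u}"
      have su: "successively (adj ?D) q" if "path T q" "u \<notin> set q" for q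
        using that by (auto simp: path_def successively_conv_nth adj_def delete_verts_def)
      have r1: "(adj ?D)\<^sup>*\<^sup>* a v" using successively_imp_rtranclp[OF su[of l]] pl dl(1) by (auto simp: path_between_def path_def)
      have r2: "(adj ?D)\<^sup>*\<^sup>* b v" using successively_imp_rtranclp[OF su[of m']] pm dl(2) by (auto simp: path_between_def path_def)
      have r: "(adj ?D)\<^sup>*\<^sup>* a b" using r1 rtranclp_adj_sym[OF r2] by (rule rtranclp_trans)
      have "a \<in> verts ?D" using pl dl(1) ab by (auto simp: path_between_def path_def delete_verts_def)
      then obtain q where q: "path_between ?D a q b"
        using path_between_iff_rtranclp[OF is_graph_delete_verts[OF T]] r by blast
      have qs: "successively (adj T) q"
        by (rule successively_mono[of "adj ?D"]) (use q in \<open>auto simp: path_between_def path_def adj_def delete_verts_def\<close>)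
      obtain q' where q': "q = a # q'" using q by (cases q) (auto simp: path_between_def path_def)
      have "q' \<noteq> []" using q q' ne by (auto simp: path_between_def)
      have "path T (u # q)" using q q' qs pl(2) is_graph_edgeD[OF T pl(2)]
        by (auto simp: path_between_def path_def delete_verts_def)
      moreover have "adj T (last (u # q)) (hd (u # q))" using q q' pm(2) adj_commute[of T u b] by (auto simp: path_between_def)
      moreover have "length (u # q) \<ge> 3" using q' \<open>q' \<noteq> []\<close> by (cases q') auto
      ultimately have "cycle T (u # q)" by (simp add: cycle_def)
      then show ?thesis using ac by blast
    qed
  qed
qed

context
  fixes G T :: "'a ugraph" and r0 :: 'a
  assumes nt: "normal_tree G T r0" and G: "connected G"
begin

interpretation sgraph "adj G" by (rule sgraph_adj)

lemma nt_facts: "is_graph G" "is_graph T" "subgraph T G" "r0 \<in> verts T" "verts T \<subseteq> verts G" "connected T" "\<nexists>q. cycle T q"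
  using nt by (auto simp: normal_tree_def subgraph_def tree_def)

abbreviation tp :: "'a list \<Rightarrow> 'a \<Rightarrow> bool" where "tp l x \<equiv> path_between T r0 l x"

lemma tp_unique: "tp l x \<Longrightarrow> tp m x \<Longrightarrow> l = m"
  by (rule tree_path_unique[OF nt_facts(2,7)])

lemma tp_prefix: "tp (l @ z # m) x \<Longrightarrow> tp (l @ [z]) z"
  using path_prefix[of T "l @ [z]" m] by (auto simp: path_between_def hd_append)

lemma tp_extend:
  assumes "tp l z" "adj T z y" "y \<notin> set l" shows "tp (l @ [y]) y"
  using assms is_graph_edgeD[OF nt_facts(2) assms(2)]
  by (auto simp: path_between_def path_def successively_append_iff hd_append)

lemma tp_below:
  assumes q: "tp q s" and z: "tp (q @ m) z" and l: "tp l y" and yz: "y \<in> set (q @ m)" and y: "y \<notin> set (butlast q)"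
  shows "\<exists>m. tp (q @ m) y"
proof -
  have qne: "q \<noteq> []" "last q = s" using q by (auto simp: path_between_def path_def)
  show ?thesis
  proof (cases "y \<in> set m")
    case True
    then obtain m1 m2 where "m = m1 @ y # m2" by (auto simp: in_set_conv_decomp)
    then have "tp ((q @ m1) @ [y]) y" using tp_prefix[of "q @ m1" y m2 z] z by simp
    then show ?thesis by auto
  next
    case False
    then have "y \<in> set q" using yz by simp
    then have "y = s" using y qne by (metis Un_iff append_butlast_last_id empty_iff empty_set insert_iff list.simps(15) set_append)
    then show ?thesis using q by (metis append_Nil2)
  qed
qed

text \<open>Along a walk avoiding the vertices strictly below \<open>s\<close>, the last tree vertex seen stays
  above \<open>s\<close>.\<close>

lemma normal_up_closed:
  assumes q: "tp q s" and x: "x \<in> verts T" and re: "reach (verts G - set (butlast q)) s x"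
  shows "\<exists>m. tp (q @ m) x"
proof -
  have tpx: "\<exists>l. tp l y" if "y \<in> verts T" for y
    using that nt_facts(4,6) by (simp add: connected_def)
  have sT: "s \<in> verts T" using q by (auto simp: path_between_def path_def)
  let ?S = "\<lambda>z. verts G - verts T \<union> {z}"
  have "\<exists>z m. tp (q @ m) z \<and> z \<in> verts T \<and> reach (?S z) z x"
    using re
  proof (induction rule: reach_induct)
    case refl
    show ?case by (rule exI[of _ s], rule exI[of _ "[]"]) (use q sT reach_refl in auto)
  next
    case (step y y')
    then obtain z m where z: "tp (q @ m) z" "z \<in> verts T" "reach (?S z) z y" by blast
    have yS: "y \<in> ?S z" using reach_in[OF z(3)] by blast
    show ?case
    proof (cases "y' \<in> verts T \<and> y' \<noteq> z")
      case False
      then have "y' \<in> ?S z" using step.hyps by blast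
      then show ?thesis using z reach_step[OF z(3) step.hyps(2)] by blast
    next
      case True
      obtain l where l: "tp l y'" using tpx True by blast
      have down: "\<exists>m. tp (q @ m) y'" if "y' \<in> set (q @ m)"
        by (rule tp_below[OF q z(1) l that]) (use step.hyps(3) in blast)
      have le: "\<exists>m. tp (q @ m) y'" if "tree_le T r0 z y' \<or> tree_le T r0 y' z"
        using that
      proof
        assume "tree_le T r0 z y'"
        then have "z \<in> set l" using tp_unique[OF l] by (auto simp: tree_le_def on_tree_path_def)
        then obtain l1 l2 where l12: "l = l1 @ z # l2" by (auto simp: in_set_conv_decomp)
        then have "tp (l1 @ [z]) z" using tp_prefix l by blast
        then have "l1 @ [z] = q @ m" using tp_unique z(1) by blast
        then have "l = q @ (m @ l2)" using l12 by simp
        then show ?thesis using l by blast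
      next
        assume "tree_le T r0 y' z"
        then obtain l' where "tp l' z" "y' \<in> set l'" by (auto simp: tree_le_def on_tree_path_def)
        then have "y' \<in> set (q @ m)" using tp_unique[OF z(1)] by metis
        then show ?thesis by (rule down)
      qed
      have "\<exists>m. tp (q @ m) y'"
      proof (cases "adj T z y'")
        case adjT: True
        show ?thesis
        proof (cases "y' \<in> set (q @ m)")
          case False
          then have "tp ((q @ m) @ [y']) y'" by (rule tp_extend[OF z(1) adjT])
          then show ?thesis by auto
        qed (rule down)
      next
        case nadj: False
        have sub: "?S z \<subseteq> verts G" using z(2) nt_facts(5) by blast
        obtain w where w: "path_between G z w y" "set w \<subseteq> ?S z"
          using reach_path[OF nt_facts(1) sub z(3)] by blast
        have y'w: "y' \<notin> set w" using w(2) True by blast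
        have ww: "w \<noteq> []" "hd w = z" "last w = y" "z \<in> set w" using w by (auto simp: path_between_def path_def)
        let ?p = "w @ [y']"
        have pp: "path G ?p" using w(1) y'w step.hyps ww by (auto simp: path_between_def path_def successively_append_iff)
        have inter: "set ?p \<inter> verts T = {hd ?p, last ?p}" using w(2) ww True z(2) by auto
        \<comment> \<open>The only tree vertices on this path are its ends \<open>z\<close> and
          \<open>y'\<close>, so an edge of it in \<open>T\<close> would join them, which
          \<open>nadj\<close> excludes.\<close>
        have noedge: "path_edges ?p \<inter> edges T = {}"
        proof (rule ccontr)
          assume "\<not> ?thesis"
          then obtain i where i: "Suc i < length ?p" "adj T (?p ! i) (?p ! Suc i)" by (auto simp: path_edges_def adj_def)
          have iT: "?p ! i \<in> verts T" "?p ! Suc i \<in> verts T" using is_graph_edgeD[OF nt_facts(2) i(2)] by auto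
          have wi: "?p ! i = w ! i" "i < length w" using i(1) by (auto simp: nth_append)
          have dist: "distinct ?p" using pp by (simp add: path_def)
          have "w ! i = z" using w(2) wi iT(1) nth_mem by fastforce
          then have "i = 0" using ww(1,2) wi dist by (metis distinct_append hd_conv_nth length_greater_0_conv nth_eq_iff_index_eq)
          have "?p ! Suc i = y'"
          proof (rule ccontr)
            assume ne: "?p ! Suc i \<noteq> y'"
            then have "Suc i < length w" using i(1) by (metis length_append_singleton less_antisym nth_append_length)
            then have "w ! Suc i \<in> set w" "?p ! Suc i = w ! Suc i" by (auto simp: nth_append)
            then have "w ! Suc i = z" using w(2) iT(2) by auto
            then show False using \<open>w ! i = z\<close> dist \<open>Suc i < length w\<close> wi(2)
              by (metis distinct_append n_not_Suc_n nth_eq_iff_index_eq)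
          qed
          then show False using nadj i(2) wi \<open>w ! i = z\<close> by simp
        qed
        have "H_path G T ?p" unfolding H_path_def using pp inter noedge ww(1) by (cases w) auto
        then have "tree_le T r0 z y' \<or> tree_le T r0 y' z" using nt ww by (auto simp: normal_tree_def)
        then show ?thesis by (rule le)
      qed
      then show ?thesis using True reach_refl by blast
    qed
  qed
  then obtain z m where z: "tp (q @ m) z" "reach (?S z) z x" by blast
  have "x = z" using reach_in[OF z(2)] x by blast
  then show ?thesis using z(1) by blast
qed

definition level :: "nat \<Rightarrow> 'a set" where
  "level k = {x. \<exists>l. tp l x \<and> length l \<le> k}"

text \<open>A ray in the closure of a level can be followed up the tree: after deletion of the tree
  path to \<open>s\<close>, vertices of the level remain reachable, by normality they lie above
  \<open>s\<close>, and the next node towards one of them can replace \<open>s\<close>. At height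
  beyond \<open>k\<close> no vertex of the level is left.\<close>

lemma level_dispersed: "dispersed (verts G) (level k)"
  unfolding dispersed_def
proof (intro allI impI notI)
  fix r assume r: "is_ray (verts G) r" and lim: "lim (verts G) (\<lambda>_. level k) r"
  have above: "\<exists>i\<ge>m. \<exists>x\<in>level k. \<exists>l. reach (verts G - set q) (r i) x \<and> tp (q @ l) x"
    if q: "tp q s" "\<And>i. i \<ge> n \<Longrightarrow> reach (verts G - set (butlast q)) (r i) s" for q s n m
  proof -
    obtain i x where ix: "i \<ge> max n m" "x \<in> level k" "reach (verts G - set q) (r i) x"
      using limE[OF lim, of "set q" "max n m"] by blast
    have xT: "x \<in> verts T" using ix(2) by (auto simp: level_def path_between_def path_def)
    have sub: "verts G - set q \<subseteq> verts G - set (butlast q)" using in_set_butlastD by fast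
    have "reach (verts G - set (butlast q)) s x"
      using reach_trans[OF reach_sym[OF q(2)] reach_mono[OF ix(3) sub]] ix(1) by simp
    then show ?thesis using normal_up_closed[OF q(1) xT] ix by (meson max.boundedE)
  qed
  have "\<exists>q s n. tp q s \<and> length q = Suc j \<and> (\<forall>i\<ge>n. reach (verts G - set (butlast q)) (r i) s)" for j
  proof (induction j)
    case 0
    have "tp [r0] r0" using nt_facts(4) by (simp add: path_between_def path_def)
    moreover have "reach (verts G) (r i) r0" for i
      using conn_verts[OF nt_facts(1) G] r nt_facts(4,5) by (auto simp: conn_def is_ray_def)
    ultimately show ?case by (intro exI[of _ "[r0]"]) auto
  next
    case (Suc j)
    then obtain q s n where q: "tp q s" "length q = Suc j" "\<And>i. i \<ge> n \<Longrightarrow> reach (verts G - set (butlast q)) (r i) s" by blast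
    obtain m where m: "\<And>i j. i \<ge> m \<Longrightarrow> j \<ge> m \<Longrightarrow> reach (verts G - set q) (r i) (r j)"
      using ray_tail_reach[OF r, of "set q"] by blast
    obtain i x l where ix: "i \<ge> m" "reach (verts G - set q) (r i) x" and l: "tp (q @ l) x"
      using above[OF q(1,3)] by blast
    have "x \<notin> set q" using reach_in[OF ix(2)] by blast
    then have "l \<noteq> []" using l by (auto simp: path_between_def path_def)
    then obtain c l' where c: "l = c # l'" by (cases l) auto
    have pl: "path T l" "hd l = c" "last l = x" "set l \<inter> set q = {}"
      using path_suffix[of T q l] l c by (auto simp: path_between_def path_def)
    have lG: "successively (adj G) l" "set l \<subseteq> verts G"
      using pl(1) nt_facts(5) adj_subgraph[OF nt_facts(3)] by (auto simp: path_def intro: successively_mono[of "adj T"])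
    then have "path G l" using pl(1) by (simp add: path_def)
    then have "reach (verts G - set q) c x" using path_reach[OF nt_facts(1), of l "verts G - set q"] pl lG by auto
    then have "reach (verts G - set q) (r i') c" if "i' \<ge> m" for i'
      using reach_trans[OF m[OF that ix(1)] reach_trans[OF ix(2) reach_sym]] by blast
    moreover have "tp (q @ [c]) c" using tp_prefix[of q c l' x] l c by simp
    ultimately show ?case using q(2) by (intro exI[of _ "q @ [c]"] exI[of _ c] exI[of _ m]) simp
  qed
  then obtain q s n where q: "tp q s" "length q = Suc k" "\<And>i. i \<ge> n \<Longrightarrow> reach (verts G - set (butlast q)) (r i) s" by blast
  obtain x l where l: "x \<in> level k" "tp (q @ l) x" using above[OF q(1,3)] by blast
  then obtain l' where l': "tp l' x" "length l' \<le> k" by (auto simp: level_def)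
  have "l' = q @ l" by (rule tp_unique[OF l'(1) l(2)])
  then show False using l'(2) q(2) by simp
qed

lemma normal_tree_sigma_dispersed: "sigma_dispersed (verts G) (verts T)"
proof -
  have "verts T \<subseteq> (\<Union>k. level k)"
    using nt_facts(4,6) by (auto simp: level_def connected_def)
  then show ?thesis unfolding sigma_dispersed_def using level_dispersed by blast
qed

end

lemma normally_spanned_sigma_dispersed:
  assumes "connected G" "normally_spanned G U"
  shows "sgraph.sigma_dispersed (adj G) (verts G) U"
proof -
  obtain T r where T: "normal_tree G T r" "U \<subseteq> verts T" using assms(2) by (auto simp: normally_spanned_def)
  show ?thesis
    by (rule sgraph.sigma_dispersed_mono[OF sgraph_adj normal_tree_sigma_dispersed[OF T(1) assms(1)] T(2)])
qed

section \<open>Rayless tree-decompositions\<close>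

text \<open>The segment up to the first repetition has at least three distinct vertices, by the
  absence of loops and of backtracking, and is a cycle.\<close>

lemma non_backtracking_inj:
  assumes S: "is_graph S" and ac: "\<nexists>q. cycle S q"
    and x: "\<And>i. adj S (x i) (x (Suc i))" "\<And>i. x (Suc (Suc i)) \<noteq> x i"
  shows "inj (x :: nat \<Rightarrow> 'b)"
proof (rule ccontr)
  assume "\<not> inj x"
  then have ex: "\<exists>j. \<exists>i<j. x i = x j" by (metis injI linorder_neqE_nat)
  define j where "j = (LEAST j. \<exists>i<j. x i = x j)"
  obtain i where i: "i < j" "x i = x j" using LeastI_ex[OF ex] unfolding j_def by blast
  have min: "x a \<noteq> x b" if "a < b" "b < j" for a b
    using not_less_Least[of b "\<lambda>j. \<exists>i<j. x i = x j"] that unfolding j_def by blast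
  have xV: "x k \<in> verts S" for k using is_graph_edgeD[OF S x(1)] by blast
  have noloop: "x k \<noteq> x (Suc k)" for k
  proof
    assume "x k = x (Suc k)"
    then have "{x k} \<in> edges S" using x(1)[of k] by (simp add: adj_def)
    then show False using S by (auto simp: is_graph_def)
  qed
  have ge: "j \<ge> i + 3"
  proof (rule ccontr)
    assume "\<not> ?thesis"
    then have "j = Suc i \<or> j = Suc (Suc i)" using i(1) by auto
    then show False using i(2) noloop[of i] x(2)[of i] by auto
  qed
  let ?q = "map x [i..<j]"
  have "distinct ?q" using min by (auto simp: distinct_map inj_on_def) (metis linorder_neqE_nat)
  moreover have "successively (adj S) ?q" using x(1) by (auto simp: successively_conv_nth)
  moreover have "hd ?q = x i" "last ?q = x (j - 1)" using i(1) by (auto simp: hd_map last_map)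
  moreover have "adj S (x (j - 1)) (x i)" using x(1)[of "j - 1"] i by simp
  ultimately have "cycle S ?q" using ge xV i(1) by (auto simp: cycle_def path_def)
  then show False using ac by blast
qed

context
  fixes G :: "'a ugraph" and S :: "'b ugraph" and P :: "'b \<Rightarrow> 'a set"
  assumes G: "connected G" and td: "tree_decomposition G S P" and rl: "rayless S"
    and parts: "\<And>s. s \<in> verts S \<Longrightarrow> normally_spanned G (P s)"
begin

interpretation sgraph "adj G" by (rule sgraph_adj)
interpretation S: sgraph "adj S" by (rule sgraph_adj)

definition branch :: "'b \<Rightarrow> 'b \<Rightarrow> 'b set" where
  "branch s c = {u. S.reach (verts S - {s}) c u}"

definition part_union :: "'b set \<Rightarrow> 'a set" where "part_union A = (\<Union>u\<in>A. P u)"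

lemma td_facts: "is_graph G" "is_graph S" "connected S" "\<nexists>q. cycle S q"
  using G td by (auto simp: connected_def tree_decomposition_def tree_def)

text \<open>Every path of \<open>S\<close> from inside this branch to outside it passes through
  \<open>c\<close>.\<close>

lemma branch_separated:
  assumes "u \<in> branch c d" "w \<in> verts S" "w \<notin> branch c d" "c \<in> verts S"
  shows "P u \<inter> P w \<subseteq> P c"
proof -
  have u: "u \<in> verts S" "u \<noteq> c" using assms(1) S.reach_in by (auto simp: branch_def)
  obtain l where l: "path_between S u l w" using td_facts(3) u assms(2) by (auto simp: connected_def)
  have "c \<in> set l"
  proof (rule ccontr)
    assume "c \<notin> set l"
    then have "S.reach (verts S - {c}) u w"
      using path_reach[OF td_facts(2), of l "verts S - {c}"] l by (auto simp: path_between_def path_def)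
    moreover have "S.reach (verts S - {c}) d u" using assms(1) by (simp add: branch_def)
    ultimately have "S.reach (verts S - {c}) d w" by (rule S.reach_trans[rotated])
    then show False using assms(3) by (simp add: branch_def)
  qed
  then have "on_tree_path S u c w" using l by (auto simp: on_tree_path_def)
  then show ?thesis using td u assms by (auto simp: tree_decomposition_def)
qed

lemma comp_in_branch:
  assumes A: "A \<subseteq> verts G" and c: "c \<in> verts S" and x: "x \<in> A - P c" "x \<in> P u" "u \<in> branch c d"
  shows "comp (A - P c) x \<subseteq> part_union (branch c d)"
proof
  fix y assume "y \<in> comp (A - P c) x"
  then have "reach (A - P c) x y" by (simp add: comp_def)
  then show "y \<in> part_union (branch c d)"
  proof (induction rule: reach_induct)
    case refl then show ?case using x by (auto simp: part_union_def)
  next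
    case (step y z)
    obtain v where v: "v \<in> branch c d" "y \<in> P v" using step.IH by (auto simp: part_union_def)
    have yc: "y \<notin> P c" using reach_in[OF step.hyps(1)] by blast
    obtain w where w: "w \<in> verts S" "{y, z} \<subseteq> P w" using step.hyps(2) td by (auto simp: tree_decomposition_def adj_def)
    have "w \<in> branch c d" using branch_separated[OF v(1) w(1) _ c] v(2) w(2) yc by blast
    then show ?case using w(2) by (auto simp: part_union_def)
  qed
qed

text \<open>An order on oriented edges of the decomposition tree in which smaller edges continue
  larger ones without turning back. A descending chain would be a ray, so raylessness becomes a
  principle of well-founded induction.\<close>

definition child :: "('b \<times> 'b) rel" where
  "child = {((c, d), (s, c')) | c d s c'. c = c' \<and> adj S s c \<and> adj S c d \<and> d \<noteq> s}"

lemma wf_child: "wf child"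
  unfolding wf_iff_no_infinite_down_chain
proof
  assume "\<exists>f. \<forall>i. (f (Suc i), f i) \<in> child"
  then obtain f where f: "\<And>i. (f (Suc i), f i) \<in> child" by blast
  define x where "x i = fst (f i)" for i
  have st: "fst (f (Suc i)) = snd (f i) \<and> adj S (fst (f i)) (snd (f i)) \<and> snd (f (Suc i)) \<noteq> fst (f i)" for i
    using f[of i] by (auto simp: child_def)
  have 1: "adj S (x i) (x (Suc i))" "x (Suc (Suc i)) \<noteq> x i" for i
    using st[of i] st[of "Suc i"] by (auto simp: x_def)
  then have "inj x" by (rule non_backtracking_inj[OF td_facts(2,4)])
  moreover have "range x \<subseteq> verts S" using is_graph_edgeD[OF td_facts(2) 1(1)] by blast
  ultimately have "ray S x" using 1 by (simp add: ray_def)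
  then show False using rl by (auto simp: rayless_def rays_def)
qed

lemma next_branch:
  assumes c: "c \<in> verts S" and u: "S.reach Q c u" "u \<noteq> c" "Q \<subseteq> verts S"
  shows "\<exists>d. adj S c d \<and> d \<in> Q \<and> u \<in> branch c d"
proof -
  obtain d e where d: "S.reach (Q \<inter> - {c}) u d" "adj S d e" "e \<in> Q - (- {c})"
    using S.reach_exit[OF S.reach_sym[OF u(1)], of "- {c}"] u(2) by blast
  have "S.reach (verts S - {c}) d u" by (rule S.reach_mono[OF S.reach_sym[OF d(1)]]) (use u(3) in blast)
  moreover have "d \<in> Q" using S.reach_in[OF d(1)] by blast
  moreover have "adj S c d" using d(2,3) adj_commute by fastforce
  ultimately show ?thesis by (auto simp: branch_def)
qed

lemma parts_sigma: "s \<in> verts S \<Longrightarrow> sigma_dispersed (verts G) (P s)"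
  using normally_spanned_sigma_dispersed[OF G parts] .

lemma part_union_G: "A \<subseteq> verts S \<Longrightarrow> part_union A \<subseteq> verts G"
  using td by (auto simp: part_union_def tree_decomposition_def)

text \<open>Deleting the part at the first node of a branch leaves components each confined to one
  branch farther out, that is, to a smaller oriented edge.\<close>

lemma branch_traceable:
  "adj S (fst sc) (snd sc) \<Longrightarrow> traceable (verts G) (part_union (branch (fst sc) (snd sc)))"
proof (induction sc rule: wf_induct_rule[OF wf_child])
  case (1 sc)
  obtain s c where sc: "sc = (s, c)" by fastforce
  have adj: "adj S s c" using 1 sc by simp
  have c: "c \<in> verts S" using is_graph_edgeD[OF td_facts(2) adj] by blast
  have bS: "branch s c \<subseteq> verts S" using S.reach_in by (auto simp: branch_def)
  show ?case unfolding sc fst_conv snd_conv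
  proof (rule traceable.traceable[OF parts_sigma[OF c]])
    fix x assume x: "x \<in> part_union (branch s c) - P c"
    then obtain u where u: "u \<in> branch s c" "x \<in> P u" by (auto simp: part_union_def)
    then have "u \<noteq> c" using x by blast
    then obtain d where d: "adj S c d" "d \<in> verts S - {s}" "u \<in> branch c d"
      using next_branch[OF c, of "verts S - {s}" u] u(1) by (auto simp: branch_def)
    have "((c, d), sc) \<in> child" using sc adj d by (auto simp: child_def)
    then have "traceable (verts G) (part_union (branch c d))" using "1.IH"[of "(c, d)"] d(1) by simp
    then show "traceable (verts G) (comp (part_union (branch s c) - P c) x)"
      using traceable_mono comp_in_branch[OF part_union_G[OF bS] c x u(2) d(3)] by blast
  qed
qed

lemma decomposition_traceable: "traceable (verts G) (verts G)"
proof -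
  obtain c where c: "c \<in> verts S" using td_facts(3) by (auto simp: connected_def)
  show ?thesis
  proof (rule traceable.traceable[OF parts_sigma[OF c]])
    fix x assume x: "x \<in> verts G - P c"
    have "(\<Union>u\<in>verts S. P u) = verts G" using td by (simp add: tree_decomposition_def)
    then obtain u where u: "u \<in> verts S" "x \<in> P u" using x by blast
    have "S.reach (verts S) c u" using conn_verts[OF td_facts(2,3)] c u by (auto simp: S.conn_def)
    moreover have "u \<noteq> c" using x u by blast
    ultimately obtain d where d: "adj S c d" "u \<in> branch c d" using next_branch[OF c] by blast
    have "traceable (verts G) (part_union (branch c d))" using branch_traceable[of "(c, d)"] d(1) by simp
    then show "traceable (verts G) (comp (verts G - P c) x)"
      using traceable_mono comp_in_branch[OF subset_refl c x u(2) d(2)] by blast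
  qed
qed

end

theorem theorem1:
  fixes G :: "'a ugraph"
  assumes "normally_traceable TYPE('b) G"
  shows "\<exists>T. end_faithful_spanning_tree G T"
  using assms traceable_end_faithful decomposition_traceable
  unfolding normally_traceable_def by blast

end
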